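(* For positive primes $p$ and $q$ and a positive integer $c$, the equation $$|p^x - q^y| = c$$ has at most two solutions $(x,y)$ in nonnegative integers $x$ and $y$, except when $(p,q,c)$ or $(q,p,c)$ is one of $(3,5,2)$, $(2,3,5)$, $(2,3,7)$, $(2,11,7)$, or $(2,F,F-2)$ where $F$ is a Fermat prime.
   Context: A Fermat prime is a prime of the form $2^{2^k}+1$ with $k\ge 0$ an integer. The primes $p$ and $q$ are not assumed distinct. *)

theory Defs
  imports Complex_Main "HOL-Computational_Algebra.Primes"
begin

definition fermat_prime :: "nat \<Rightarrow> bool" where
  "fermat_prime F \<longleftrightarrow> prime F \<and> (\<exists>k::nat. F = 2 ^ (2 ^ k) + 1)"

definition solutions :: "nat \<Rightarrow> nat \<Rightarrow> nat \<Rightarrow> (nat \<times> nat) set" where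
  "solutions p q c = {(x, y). \<bar>int p ^ x - int q ^ y\<bar> = int c}"

(* Fermat primes are at least 3, so the subtraction F - 2 does not truncate. *)
definition exceptional_triples :: "(nat \<times> nat \<times> nat) set" where
  "exceptional_triples =
     {(3, 5, 2), (2, 3, 5), (2, 3, 7), (2, 11, 7)} \<union> {(2, F, F - 2) | F. fermat_prime F}"

end

theory Submission
  imports Defs "HOL-Number_Theory.Number_Theory"
begin

text \<open>Call \<open>(x, y)\<close> a plus solution if \<open>p ^ x = c + q ^ y\<close> and a minus
solution if \<open>q ^ y = c + p ^ x\<close>; exchanging \<open>p\<close> and \<open>q\<close>
exchanges the two kinds. Within one kind, either exponent determines the other. The proof bounds
the number of solutions of each kind by the parity of one exponent, and then excludes the
remaining combinations by congruences.

Parity. Let \<open>p\<close> be an odd prime. A plus solution makes \<open>sqrt c + i * sqrt (q ^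
y)\<close> an element of norm \<open>p ^ x\<close>. Its square lies in \<open>Z[sqrt (- c * q ^
y)]\<close>, and if \<open>y\<close> is replaced by \<open>y + 2 * k\<close>, the ring of the
second square is contained in that of the first. An integer of the form \<open>a\<^sup>2 + N *
b\<^sup>2\<close> that is a power of a prime is represented essentially once
(\<open>norm_form_unique_odd\<close>), so suitable powers of the two squares coincide up to sign
and conjugation. Comparing their imaginary parts \<open>q\<close>-adically, by lifting the
exponent (\<open>prime_power_dvd_index\<close>), gives \<open>q ^ k dvd x'\<close> for the larger
exponent \<open>x'\<close>. But \<open>p ^ x'\<close> is less than about \<open>q ^ (3 *
k)\<close>, hence than about \<open>x' ^ 3\<close>, which is impossible for \<open>c > 1\<close>.
Lifting fails only for \<open>q = 3\<close> and \<open>y = 1\<close>; there a descent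
(\<open>exponent_dvd_forms\<close>) leaves just \<open>p = 13\<close> and \<open>c = 10\<close>
(\<open>same_parity_solutions\<close>). Otherwise, for \<open>c > 1\<close>, plus solutions with
\<open>y > 0\<close> have different parities of \<open>y\<close>, and there are at most two of
them. Two plus solutions whose \<open>y\<close> differ in parity make \<open>q\<close> of odd
order modulo \<open>p\<close>, whereas a minus solution with \<open>x > 0\<close> makes \<open>-
1\<close> a power of \<open>q\<close>; so these do not coexist (\<open>opposite_sign\<close>).

Both primes odd. What is left involves a solution with a zero exponent, say \<open>p ^ x0 = c +
1\<close>. Two minus solutions besides it are excluded by counting factors 2
(\<open>zero_and_two_minus\<close>). A further plus solution with \<open>y\<close> even, \<open>y
= 2 * m\<close>, means that a power of \<open>1 + sqrt (- c)\<close> equals \<open>a + s * sqrt (-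
c)\<close> with \<open>s = 1\<close> or \<open>s = - 1\<close> and \<open>\<bar>a\<bar> = q ^
m\<close>. For \<open>s = 1\<close> lifting the exponent leaves only \<open>(1 + sqrt (- 2)) ^
3\<close>, which belongs to the triple \<open>(3, 5, 2)\<close>. For \<open>s = - 1\<close> the
exponent \<open>n\<close> satisfies \<open>c dvd n + 1\<close> while \<open>2 ^ (n - 1)\<close> is
\<open>- 1\<close> modulo \<open>p\<close>; Fermat's little theorem turns this into \<open>p =
5\<close> (\<open>zero_and_even_plus\<close>), where the residues of \<open>a\<close> modulo 3, 4
and 5 rule out any third solution.

The prime 2. For \<open>p = 2\<close> the argument above applies to minus solutions, whose norms
are powers of the odd prime \<open>q\<close>. For plus solutions it works after halving, through
Lucas sequences (\<open>two_plus_power2\<close>). The solution with a zero exponent is \<open>2 ^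
x0 = c + 1\<close>. Together with one solution of each kind it leads to the Fermat primes and to
the triples with \<open>c = 7\<close> (\<open>zero_plus_minus_power2\<close>). The other
combinations are excluded modulo 3, 4 and 8, except for \<open>(2, 3, 5)\<close> and \<open>(2, 5,
3)\<close>, the latter being the Fermat prime 5.\<close>

section \<open>Powers of a quadratic integer\<close>

text \<open>\<open>(A + sqrt (- M)) ^ n = qre A M n + qim A M n * sqrt (- M)\<close>. Working with these two
integer sequences keeps quadratic fields and complex numbers out of the proof; a general \<open>A
+ B * sqrt (- N)\<close> is covered by \<open>M = N * B\<^sup>2\<close>.\<close>

fun qre :: "int \<Rightarrow> int \<Rightarrow> nat \<Rightarrow> int" and qim :: "int \<Rightarrow> int \<Rightarrow> nat \<Rightarrow> int" where
  "qre A M 0 = 1"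
| "qim A M 0 = 0"
| "qre A M (Suc n) = A * qre A M n - M * qim A M n"
| "qim A M (Suc n) = qre A M n + A * qim A M n"

text \<open>The norm is multiplicative.\<close>

lemma qre_qim_norm: "(qre A M n)\<^sup>2 + M * (qim A M n)\<^sup>2 = (A\<^sup>2 + M) ^ n"
proof (induction n)
  case (Suc n)
  have "(qre A M (Suc n))\<^sup>2 + M * (qim A M (Suc n))\<^sup>2
      = (A\<^sup>2 + M) * ((qre A M n)\<^sup>2 + M * (qim A M n)\<^sup>2)"
    by (simp add: power2_eq_square algebra_simps)
  then show ?case by (simp add: Suc)
qed simp

lemma qre_qim_add:
  "qre A M (m + n) = qre A M m * qre A M n - M * qim A M m * qim A M n"
  "qim A M (m + n) = qre A M m * qim A M n + qim A M m * qre A M n"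
proof (induction m)
  case (Suc m)
  { case 1
    show ?case unfolding add_Suc qre.simps qim.simps Suc by (simp add: algebra_simps) }
  { case 2
    show ?case unfolding add_Suc qre.simps qim.simps Suc by (simp add: algebra_simps) }
qed simp_all

text \<open>A power of a power: \<open>(A + sqrt (- M)) ^ m\<close> has real part \<open>qre A M m\<close> and
the square of its imaginary part is \<open>M * (qim A M m)\<^sup>2\<close>.\<close>

lemma qre_qim_mult:
  "qre A M (m * n) = qre (qre A M m) (M * (qim A M m)\<^sup>2) n"
  "qim A M (m * n) = qim A M m * qim (qre A M m) (M * (qim A M m)\<^sup>2) n"
proof (induction n)
  case (Suc n)
  { case 1
    show ?case using Suc by (simp add: qre_qim_add power2_eq_square algebra_simps) }
  { case 2
    show ?case using Suc by (simp add: qre_qim_add power2_eq_square algebra_simps) }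
qed simp_all

text \<open>The binomial expansion of \<open>(A + sqrt (- M)) ^ n\<close> to first order in \<open>sqrt (-
M)\<close>.\<close>

lemma qre_qim_cong:
  "[qre A M n = A ^ n] (mod M)"
  "[qim A M (Suc n) = int (Suc n) * A ^ n] (mod M)"
proof (induction n)
  case (Suc n)
  { case 1
    have "[A * qre A M n - M * qim A M n = A * A ^ n - 0] (mod M)"
      by (intro cong_diff cong_mult Suc cong_refl) (simp add: cong_0_iff)
    then show ?case by simp }
  { case 2
    have "[A * qre A M n - M * qim A M n + A * qim A M (Suc n)
           = A * A ^ n - 0 + A * (int (Suc n) * A ^ n)] (mod M)"
      by (intro cong_add cong_diff cong_mult Suc cong_refl) (simp add: cong_0_iff)
    then show ?case by (simp add: algebra_simps) }
qed simp_all

text \<open>Modulo its norm \<open>A\<^sup>2 + M\<close>, the number \<open>A + sqrt (- M)\<close> is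
annihilated by its conjugate, so its powers form a geometric progression with the trace \<open>2 *
A\<close> as ratio.\<close>

lemma qre_qim_cong_norm:
  "[qre A M (Suc n) = A * qim A M (Suc n)] (mod (A\<^sup>2 + M))"
  "[qim A M (Suc n) = (2 * A) ^ n] (mod (A\<^sup>2 + M))"
proof -
  have *: "qre A M (Suc n) - A * qim A M (Suc n) = - ((A\<^sup>2 + M) * qim A M n)" for n
    by (simp add: power2_eq_square algebra_simps)
  show re: "[qre A M (Suc n) = A * qim A M (Suc n)] (mod (A\<^sup>2 + M))" for n
    unfolding cong_iff_dvd_diff * by simp
  show "[qim A M (Suc n) = (2 * A) ^ n] (mod (A\<^sup>2 + M))"
  proof (induction n)
    case (Suc n)
    have "[qre A M (Suc n) + A * qim A M (Suc n) = A * qim A M (Suc n) + A * qim A M (Suc n)]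
       (mod (A\<^sup>2 + M))"
      by (intro cong_add re cong_refl)
    also have "A * qim A M (Suc n) + A * qim A M (Suc n) = (2 * A) * qim A M (Suc n)" by simp
    also have "[\<dots> = 2 * A * (2 * A) ^ n] (mod (A\<^sup>2 + M))"
      by (intro cong_mult Suc cong_refl)
    finally show ?case by simp
  qed simp
qed

text \<open>The expansion with one more term each. It is needed modulo \<open>l\<^sup>2\<close> for primes
\<open>l\<close> that divide \<open>M\<close> only once.\<close>

lemma qre_qim_second_order:
  "M\<^sup>2 dvd qre A M (n + 3) - (A ^ (n + 3) - int ((n + 3) choose 2) * A ^ (n + 1) * M)"
  "M\<^sup>2 dvd qim A M (n + 3) - (int (n + 3) * A ^ (n + 2) - int ((n + 3) choose 3) * A ^ n * M)"
proof (induction n)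
  case 0
  { case 1 show ?case by (simp add: numeral_3_eq_3 power2_eq_square algebra_simps numeral_2_eq_2) }
  { case 2 show ?case by (simp add: numeral_3_eq_3 power2_eq_square algebra_simps numeral_2_eq_2) }
next
  case (Suc n)
  define R where "R = A ^ (n + 3) - int ((n + 3) choose 2) * A ^ (n + 1) * M"
  define I where "I = int (n + 3) * A ^ (n + 2) - int ((n + 3) choose 3) * A ^ n * M"
  from Suc obtain s where s: "qre A M (n + 3) = R + M\<^sup>2 * s"
    unfolding R_def[symmetric] by (metis dvdE add.commute diff_add_cancel)
  from Suc obtain t where t: "qim A M (n + 3) = I + M\<^sup>2 * t"
    unfolding I_def[symmetric] by (metis dvdE add.commute diff_add_cancel)
  have c2: "(Suc n + 3) choose 2 = (n + 3) + ((n + 3) choose 2)"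
    using binomial_Suc_Suc[of "n + 3" 1] by (simp add: numeral_2_eq_2)
  have c3: "(Suc n + 3) choose 3 = ((n + 3) choose 2) + ((n + 3) choose 3)"
    using binomial_Suc_Suc[of "n + 3" 2] by (simp add: numeral_3_eq_3 numeral_2_eq_2)
  define b2 b3 where "b2 = int ((n + 3) choose 2)" and "b3 = int ((n + 3) choose 3)"
  have step: "qre A M (Suc n + 3) = A * (R + M\<^sup>2 * s) - M * (I + M\<^sup>2 * t)"
    "qim A M (Suc n + 3) = (R + M\<^sup>2 * s) + A * (I + M\<^sup>2 * t)"
    unfolding s[symmetric] t[symmetric] add_Suc qre.simps qim.simps by (rule refl)+
  have RI: "R = A ^ n * A ^ 3 - b2 * (A ^ n * A) * M"
    "I = (int n + 3) * (A ^ n * A\<^sup>2) - b3 * A ^ n * M"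
    by (simp_all add: R_def I_def b2_def b3_def power_add power2_eq_square)
  { case 1
    have "qre A M (Suc n + 3) - (A ^ (Suc n + 3) - int ((Suc n + 3) choose 2) * A ^ (Suc n + 1) * M)
      = M\<^sup>2 * (A * s - M * t + b3 * A ^ n)"
      unfolding c2 step of_nat_add b2_def[symmetric] RI
      by (simp add: power2_eq_square power3_eq_cube power4_eq_xxxx algebra_simps power_add)
    then show ?case by simp }
  { case 2
    have "qim A M (Suc n + 3) - (int (Suc n + 3) * A ^ (Suc n + 2) - int ((Suc n + 3) choose 3) * A ^ Suc n * M)
      = M\<^sup>2 * (A * t + s)"
      unfolding c3 step of_nat_add b2_def[symmetric] b3_def[symmetric] RI
      by (simp add: power2_eq_square power3_eq_cube power4_eq_xxxx algebra_simps power_add)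
    then show ?case by simp }
qed

text \<open>In the expansion of \<open>qim A M l\<close>, the term after \<open>l * A ^ (l - 1)\<close>
contains \<open>M\<close> and the coefficient \<open>l choose 3\<close>. A prime \<open>l\<close>
above 3 divides both. For \<open>l = 3\<close> the coefficient is 1, hence the condition that
\<open>M\<close> is divisible by 9.\<close>

lemma qim_prime_index:
  fixes l :: nat
  assumes l: "prime l" and A: "\<not> int l dvd A" and M: "int l dvd M" and three: "l = 3 \<Longrightarrow> 9 dvd M"
  obtains w where "qim A M l = int l * w" and "\<not> int l dvd w"
proof -
  have pl: "prime (int l)" using l by simp
  consider "l = 2" | "l = 3" | "l \<ge> 5"
  proof -
    have "l \<noteq> 4" using l prime_product[of 2 "2::nat"] by auto
    then show ?thesis using that prime_ge_2_nat[OF l] by linarith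
  qed
  then show ?thesis
  proof cases
    case 1
    then have "qim A M l = int l * A" by (simp add: numeral_2_eq_2)
    then show ?thesis using A that by blast
  next
    case 2
    obtain m where m: "M = 9 * m" using three[OF 2] by (auto elim: dvdE)
    have "qim A M l = int l * (A\<^sup>2 - 3 * m)"
      using 2 m by (simp add: numeral_3_eq_3 power2_eq_square algebra_simps)
    moreover have "\<not> int l dvd A\<^sup>2 - 3 * m"
      using A 2 pl by (simp add: dvd_diff_left_iff prime_dvd_power_int_iff)
    ultimately show ?thesis using that by blast
  next
    case 3
    obtain m where m: "M = int l * m" using M by (auto elim: dvdE)
    define n where "n = l - 3"
    have n: "l = n + 3" using 3 by (simp add: n_def)
    obtain b where b: "l choose 3 = l * b"
      using dvd_choose_prime[of 3 l] l 3 by (auto elim: dvdE)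
    obtain s where "qim A M l - (int l * A ^ (n + 2) - int (l choose 3) * A ^ n * M) = M\<^sup>2 * s"
      using qre_qim_second_order(2)[of M A n] unfolding n by (auto elim: dvdE)
    then have "qim A M l = int l * (A ^ (n + 2) + int l * (m\<^sup>2 * s - int b * A ^ n * m))"
      unfolding b by (simp add: m power2_eq_square algebra_simps)
    moreover have "\<not> int l dvd A ^ (n + 2) + int l * (m\<^sup>2 * s - int b * A ^ n * m)"
      using prime_dvd_power[OF pl, of A "n + 2"] A by (auto simp: dvd_add_left_iff)
    ultimately show ?thesis using that by blast
  qed
qed

text \<open>Lifting the exponent: passing from \<open>n\<close> to \<open>l * n\<close> contributes exactly
one factor \<open>l\<close> to \<open>qim\<close>, and \<open>qim A M n\<close> is prime to
\<open>l\<close> when \<open>n\<close> is.\<close>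

lemma prime_power_dvd_index:
  fixes l :: nat
  assumes l: "prime l" and "\<not> int l dvd A" and "int l dvd M" and "l = 3 \<Longrightarrow> 9 dvd M"
    and "int l ^ e dvd qim A M n"
  shows "l ^ e dvd n"
  using assms(2-)
proof (induction e arbitrary: A M n)
  case (Suc e)
  have pl: "prime (int l)" using l by simp
  show ?case
  proof (cases n)
    case (Suc n')
    have "[qim A M n = int n * A ^ n'] (mod int l)"
      using qre_qim_cong(2)[of A M n'] Suc.prems(2) unfolding Suc by (rule cong_dvd_modulus)
    moreover have "int l dvd qim A M n"
      using Suc.prems(4) by (meson dvd_power dvd_trans zero_less_Suc)
    ultimately have "int l dvd int n * A ^ n'"
      using cong_dvd_iff by blast
    then have "l dvd n"
      using pl Suc.prems(1) by (simp add: prime_dvd_mult_iff prime_dvd_power_int_iff) (metis of_nat_dvd_iff prime_dvd_power pl)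
    then obtain j where j: "n = l * j" by (auto elim: dvdE)
    obtain w where w: "qim A M l = int l * w" "\<not> int l dvd w"
      using qim_prime_index[OF l Suc.prems(1,2,3)] by blast
    define A' where "A' = qre A M l"
    define M' where "M' = M * (qim A M l)\<^sup>2"
    have "qim A M n = qim A M l * qim A' M' j"
      unfolding j qre_qim_mult(2) A'_def M'_def ..
    then have "int l * int l ^ e dvd int l * (w * qim A' M' j)"
      using Suc.prems(4) by (simp add: w(1) mult.assoc)
    then have "int l ^ e dvd w * qim A' M' j"
      using l by (simp add: prime_gt_0_nat)
    moreover have "coprime (int l ^ e) w"
      using w(2) pl by (simp add: prime_imp_coprime)
    ultimately have e: "int l ^ e dvd qim A' M' j"
      by (simp add: coprime_dvd_mult_right_iff)
    have "[A' = A ^ l] (mod int l)"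
      using qre_qim_cong(1)[of A M l] Suc.prems(2) unfolding A'_def by (rule cong_dvd_modulus)
    then have "\<not> int l dvd A'"
      using Suc.prems(1) pl cong_dvd_iff prime_dvd_power by blast
    then have "l ^ e dvd j"
      using Suc.IH[of A' M' j] e Suc.prems(2,3) by (simp add: M'_def)
    then show ?thesis by (simp add: j)
  qed simp
qed simp

section \<open>Uniqueness of prime powers in a norm form\<close>

lemma small_multiple_zero:
  fixes N d P :: int
  assumes "P dvd d" "N * d\<^sup>2 < P\<^sup>2" "N > 0"
  shows "d = 0"
proof (rule ccontr)
  assume "d \<noteq> 0"
  with assms(1) have "\<bar>P\<bar> \<le> \<bar>d\<bar>" by (simp add: dvd_imp_le_int)
  then have "P\<^sup>2 \<le> d\<^sup>2" by (simp add: abs_le_square_iff)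
  also have "1 * d\<^sup>2 \<le> N * d\<^sup>2" using \<open>N > 0\<close> by (intro mult_right_mono) auto
  finally show False using assms(2) by simp
qed

text \<open>Brahmagupta's identity, in its two forms.\<close>

lemma cross_bound:
  fixes a b e h N S :: int
  assumes "a\<^sup>2 + N * b\<^sup>2 = S" "e\<^sup>2 + N * h\<^sup>2 = S"
  shows "N * (a * h - b * e)\<^sup>2 \<le> S\<^sup>2" "N * (a * h + b * e)\<^sup>2 \<le> S\<^sup>2"
proof -
  have "S\<^sup>2 = (a\<^sup>2 + N * b\<^sup>2) * (e\<^sup>2 + N * h\<^sup>2)"
    unfolding assms by (rule power2_eq_square)
  then have "S\<^sup>2 = (a * e + N * b * h)\<^sup>2 + N * (a * h - b * e)\<^sup>2"
    and "S\<^sup>2 = (a * e - N * b * h)\<^sup>2 + N * (a * h + b * e)\<^sup>2"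
    by (simp_all add: power2_eq_square algebra_simps)
  then show "N * (a * h - b * e)\<^sup>2 \<le> S\<^sup>2" "N * (a * h + b * e)\<^sup>2 \<le> S\<^sup>2"
    by (smt (verit) zero_le_power2)+
qed

text \<open>Two representations of \<open>S\<close> yield a product that is divisible by \<open>S\<close>.\<close>

lemma cross_prod:
  fixes a b e h N S :: int
  assumes "a\<^sup>2 + N * b\<^sup>2 = S" "e\<^sup>2 + N * h\<^sup>2 = S"
  shows "(a * h - b * e) * (a * h + b * e) = S * (h\<^sup>2 - b\<^sup>2)"
proof -
  have "(a * h - b * e) * (a * h + b * e) = a\<^sup>2 * h\<^sup>2 - b\<^sup>2 * e\<^sup>2"
    by (simp add: power2_eq_square algebra_simps)
  also have "\<dots> = (S - N * b\<^sup>2) * h\<^sup>2 - b\<^sup>2 * (S - N * h\<^sup>2)"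
    using assms by (metis add_diff_cancel_right')
  finally show ?thesis by (simp add: algebra_simps)
qed

text \<open>The prime power \<open>p ^ s\<close> divides the product of the two cross terms \<open>a * h - b *
e\<close> and \<open>a * h + b * e\<close> but \<open>p\<close> cannot divide both, so \<open>p ^
s\<close> divides one of them. By \<open>cross_bound\<close> that one is smaller than \<open>p ^
s\<close>, hence zero.\<close>

lemma norm_form_unique_odd:
  fixes a b e h N :: int
  assumes p: "prime p" "odd p" and N: "N \<ge> 2"
    and eq: "a\<^sup>2 + N * b\<^sup>2 = int p ^ s" "e\<^sup>2 + N * h\<^sup>2 = int p ^ s"
    and nd: "\<not> int p dvd a" "\<not> int p dvd h"
  shows "b\<^sup>2 = h\<^sup>2"
proof -
  let ?P = "int p ^ s"
  have pp: "prime (int p)" using p by simp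
  have P0: "?P > 0" using p by (simp add: prime_gt_0_nat)
  have prod: "(a * h - b * e) * (a * h + b * e) = ?P * (h\<^sup>2 - b\<^sup>2)"
    by (rule cross_prod[OF eq])
  have "(a * h - b * e) * (a * h + b * e) = 0"
  proof -
    have "\<not> (int p dvd a * h - b * e \<and> int p dvd a * h + b * e)"
    proof
      assume *: "int p dvd a * h - b * e \<and> int p dvd a * h + b * e"
      have "int p dvd (a * h - b * e) + (a * h + b * e)"
        by (rule dvd_add[OF conjunct1[OF *] conjunct2[OF *]])
      then have "int p dvd 2 * (a * h)" by (simp add: algebra_simps)
      moreover have "\<not> int p dvd 2"
        using p by (metis int_dvd_int_iff of_nat_numeral primes_dvd_imp_eq two_is_prime_nat dvd_refl)
      ultimately show False using nd pp by (auto simp: prime_dvd_mult_iff)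
    qed
    then consider "\<not> int p dvd a * h - b * e" | "\<not> int p dvd a * h + b * e" by blast
    then have "?P dvd a * h + b * e \<or> ?P dvd a * h - b * e"
    proof cases
      case 1
      then have "coprime ?P (a * h - b * e)" using pp by (simp add: prime_imp_coprime)
      then show ?thesis using prod by (metis coprime_dvd_mult_right_iff dvd_triv_left)
    next
      case 2
      then have "coprime ?P (a * h + b * e)" using pp by (simp add: prime_imp_coprime)
      then show ?thesis using prod by (metis coprime_dvd_mult_left_iff dvd_triv_left)
    qed
    moreover have "d = 0" if "?P dvd d" "N * d\<^sup>2 \<le> ?P\<^sup>2" for d
    proof (rule small_multiple_zero[OF that(1), of 1])
      have "2 * d\<^sup>2 \<le> N * d\<^sup>2" using N by (intro mult_right_mono) auto
      then show "1 * d\<^sup>2 < ?P\<^sup>2"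
        using that(2) P0 by (smt (verit) zero_less_power zero_le_power2)
    qed simp
    ultimately show ?thesis using cross_bound[OF eq] by fastforce
  qed
  then have "?P * (h\<^sup>2 - b\<^sup>2) = 0" using prod by simp
  then show ?thesis using P0 by (metis mult_eq_0_iff eq_iff_diff_eq_0 less_irrefl)
qed

lemma odd_square_8: "odd (a::int) \<Longrightarrow> 8 dvd a\<^sup>2 - 1"
proof -
  assume "odd a"
  then obtain k where k: "a = 2 * k + 1" by (auto elim: oddE)
  have "even (k * (k + 1))" by simp
  then obtain j where "k * (k + 1) = 2 * j" by (blast elim: evenE)
  then have "a\<^sup>2 - 1 = 8 * j" unfolding k by (simp add: power2_eq_square algebra_simps)
  then show ?thesis by simp
qed

text \<open>As in \<open>norm_form_unique_odd\<close>, but both cross terms are now even. The lost factor 2 is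
regained from \<open>h\<^sup>2 - b\<^sup>2\<close>, which is divisible by 8.\<close>

lemma norm_form_unique_two:
  fixes a b e h N :: int
  assumes N: "N \<ge> 1"
    and eq: "a\<^sup>2 + N * b\<^sup>2 = 2 ^ s" "e\<^sup>2 + N * h\<^sup>2 = 2 ^ s"
    and odd: "odd a" "odd b" "odd e" "odd h"
  shows "b\<^sup>2 = h\<^sup>2"
proof -
  have prod: "(a * h - b * e) * (a * h + b * e) = 2 ^ s * (h\<^sup>2 - b\<^sup>2)"
    by (rule cross_prod[OF eq])
  obtain u where u: "a * h - b * e = 2 * u" using odd by (metis dvdE even_diff even_mult_iff even_add)
  obtain v where v: "a * h + b * e = 2 * v" using odd by (metis dvdE even_add even_mult_iff)
  have "8 dvd (h\<^sup>2 - 1) - (b\<^sup>2 - 1)" using odd by (intro dvd_diff odd_square_8)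
  then obtain j where j: "h\<^sup>2 - b\<^sup>2 = 8 * j" by (auto elim: dvdE)
  have uv: "u * v = 2 ^ (s + 1) * j" using prod unfolding u v j by (simp add: algebra_simps)
  have "u + v = a * h" using u v by simp
  then have "odd (u + v)" using odd by simp
  then consider "odd u" | "odd v" by auto
  then have "2 ^ (s + 1) dvd v \<or> 2 ^ (s + 1) dvd u"
  proof cases
    case 1
    then have "coprime (2 ^ (s + 1)) u" by (simp add: coprime_commute)
    then show ?thesis using uv by (metis coprime_dvd_mult_right_iff dvd_triv_left)
  next
    case 2
    then have "coprime (2 ^ (s + 1)) v" by (simp add: coprime_commute)
    then show ?thesis using uv by (metis coprime_dvd_mult_left_iff dvd_triv_left)
  qed
  then have "2 ^ (s + 1) dvd a * h + b * e \<or> 2 ^ (s + 1) dvd a * h - b * e"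
    unfolding u v by auto
  moreover have "d = 0" if "2 ^ (s + 1) dvd d" "N * d\<^sup>2 \<le> (2 ^ s)\<^sup>2" for d :: int
  proof (rule small_multiple_zero[OF that(1), of N])
    have "(2 ^ s)\<^sup>2 < (2 ^ (s + 1) :: int)\<^sup>2" by simp
    then show "N * d\<^sup>2 < (2 ^ (s + 1))\<^sup>2" using that(2) by linarith
  qed (use N in simp)
  ultimately have "(a * h - b * e) * (a * h + b * e) = 0"
    using cross_bound[OF eq] by fastforce
  then show ?thesis using prod by simp
qed

lemma odd_prime_not_dvd_2: "prime (p::nat) \<Longrightarrow> odd p \<Longrightarrow> \<not> int p dvd 2"
  by (metis int_dvd_int_iff of_nat_numeral primes_dvd_imp_eq two_is_prime_nat dvd_refl)

text \<open>Powers of an element that \<open>p\<close> does not divide, and whose norm \<open>p\<close>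
divides, stay primitive. This is what \<open>norm_form_unique_odd\<close> requires.\<close>

lemma prime_not_dvd_qre_qim:
  fixes A M :: int
  assumes p: "prime p" "odd p" and d: "int p dvd A\<^sup>2 + M" and A: "\<not> int p dvd A" and n: "n > 0"
  shows "\<not> int p dvd qre A M n" "\<not> int p dvd qim A M n"
proof -
  have pp: "prime (int p)" using p by simp
  obtain m where m: "n = Suc m" using n by (cases n) auto
  have "\<not> int p dvd 2 * A" using A odd_prime_not_dvd_2[OF p] pp by (simp add: prime_dvd_mult_iff)
  then have "\<not> int p dvd (2 * A) ^ m" using pp prime_dvd_power by blast
  then show im: "\<not> int p dvd qim A M n"
    using qre_qim_cong_norm(2)[of A M m] d unfolding m by (meson cong_dvd_iff cong_dvd_modulus)
  then have "\<not> int p dvd A * qim A M n" using A pp by (simp add: prime_dvd_mult_iff)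
  then show "\<not> int p dvd qre A M n"
    using qre_qim_cong_norm(1)[of A M m] d unfolding m by (meson cong_dvd_iff cong_dvd_modulus)
qed

section \<open>Two solutions with exponents of equal parity\<close>

text \<open>Both \<open>(c - l ^ y1) + 2 * sqrt (- c * l ^ y1)\<close>, of norm \<open>p ^ (2 * x1)\<close>,
and \<open>(c - l ^ (y1 + 2 * k)) + 2 * l ^ k * sqrt (- c * l ^ y1)\<close>, of norm \<open>p ^ (2
* x2)\<close>, lie in \<open>Z[sqrt (- c * l ^ y1)]\<close>. The first to the power
\<open>x2\<close> and the second to the power \<open>x1\<close> have the same norm, so their
imaginary parts agree up to sign. That of the second is divisible by an extra \<open>l ^
k\<close>, and lifting the exponent moves this factor into \<open>x2\<close>.\<close>

lemma prime_power_dvd_exponent: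
  fixes p l c :: nat
  assumes p: "prime p" "odd p" and l: "prime l" "l \<noteq> p" and c: "c > 0"
    and e1: "p ^ x1 = c + l ^ y1" and e2: "p ^ x2 = c + l ^ (y1 + 2 * k)"
    and y1: "y1 > 0" and three: "l = 3 \<Longrightarrow> y1 > 1"
  shows "l ^ k dvd x2"
proof -
  have pp: "prime (int p)" using p by simp
  define M where "M = 4 * int c * int l ^ y1"
  define M2 where "M2 = M * (int l ^ k)\<^sup>2"
  define A1 A2 where "A1 = int c - int l ^ y1" and "A2 = int c - int l ^ (y1 + 2 * k)"
  have n1: "A1\<^sup>2 + M = int p ^ (2 * x1)"
  proof -
    have "A1\<^sup>2 + M = (int (c + l ^ y1))\<^sup>2"
      by (simp add: A1_def M_def power2_eq_square algebra_simps)
    then show ?thesis unfolding e1[symmetric] by (simp add: power_mult mult.commute)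
  qed
  have n2: "A2\<^sup>2 + M2 = int p ^ (2 * x2)"
  proof -
    have "M2 = 4 * int c * int l ^ (y1 + 2 * k)"
      by (simp add: M2_def M_def power_add power_mult power_mult_distrib mult_ac power2_eq_square)
    then have "A2\<^sup>2 + M2 = (int (c + l ^ (y1 + 2 * k)))\<^sup>2"
      by (simp add: A2_def power2_eq_square algebra_simps)
    then show ?thesis unfolding e2[symmetric] by (simp add: power_mult mult.commute)
  qed
  have lpos: "l ^ j \<ge> 1" for j using prime_gt_0_nat[OF l(1)] by (simp add: Suc_le_eq)
  have xpos: "x1 > 0" "x2 > 0"
    using e1 e2 c lpos[of y1] lpos[of "y1 + 2 * k"] by (intro Nat.gr0I; simp)+
  have pl: "\<not> int p dvd int l"
    using p l primes_dvd_imp_eq[of p l] by auto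
  have plj: "\<not> int p dvd int l ^ j" for j
    using pl prime_dvd_power[OF pp] by blast
  have pc: "\<not> p dvd c"
  proof
    assume "p dvd c"
    moreover have "p dvd c + l ^ y1" using xpos by (simp add: e1[symmetric])
    ultimately have "p dvd l ^ y1" by (simp add: dvd_add_right_iff)
    then show False using plj[of y1] by (metis int_dvd_int_iff of_nat_power)
  qed
  have pM: "\<not> int p dvd M"
    using pc plj[of y1] odd_prime_not_dvd_2[OF p] prime_dvd_mult_iff[OF pp, of 2 2]
    by (simp add: M_def prime_dvd_mult_iff[OF pp])
  have pM2: "\<not> int p dvd M2"
    using pM plj[of k] by (simp add: M2_def power2_eq_square prime_dvd_mult_iff[OF pp])
  have d1: "int p dvd A1\<^sup>2 + M" and d2: "int p dvd A2\<^sup>2 + M2"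
    unfolding n1 n2 using xpos by simp_all
  have pA1: "\<not> int p dvd A1" using d1 pM by (auto simp: power2_eq_square dvd_add_right_iff)
  have pA2: "\<not> int p dvd A2" using d2 pM2 by (auto simp: power2_eq_square dvd_add_right_iff)
  have eq1: "(qre A1 M x2)\<^sup>2 + M * (qim A1 M x2)\<^sup>2 = int p ^ (2 * x1 * x2)"
    unfolding qre_qim_norm n1 by (simp add: power_mult)
  have "(qre A2 M2 x1)\<^sup>2 + M2 * (qim A2 M2 x1)\<^sup>2 = int p ^ (2 * x2 * x1)"
    unfolding qre_qim_norm n2 by (simp add: power_mult)
  then have eq2: "(qre A2 M2 x1)\<^sup>2 + M * (int l ^ k * qim A2 M2 x1)\<^sup>2 = int p ^ (2 * x1 * x2)"
    by (simp add: M2_def power_mult_distrib mult_ac)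
  have "int (l ^ y1) \<ge> int 1" "int c \<ge> 1" using lpos[of y1] c by linarith+
  then have "int l ^ y1 \<ge> 1" "int c \<ge> 1" by simp_all
  then have "int c * int l ^ y1 \<ge> 1 * 1" by (intro mult_mono) auto
  then have M: "M \<ge> 2" by (simp add: M_def)
  have "\<not> int p dvd int l ^ k * qim A2 M2 x1"
    using prime_not_dvd_qre_qim(2)[OF p d2 pA2 xpos(1)] plj[of k]
    by (simp add: prime_dvd_mult_iff[OF pp])
  then have "(qim A1 M x2)\<^sup>2 = (int l ^ k * qim A2 M2 x1)\<^sup>2"
    using norm_form_unique_odd[OF p M eq1 eq2] prime_not_dvd_qre_qim(1)[OF p d1 pA1 xpos(2)] by blast
  then have "int l ^ k dvd qim A1 M x2" by (auto simp: power2_eq_iff)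
  moreover have "\<not> int l dvd A1"
  proof
    assume "int l dvd A1"
    then have "int l dvd A1 + int l ^ y1" using y1 by (intro dvd_add) auto
    then have "l dvd c" by (simp add: A1_def)
    then have "l dvd p ^ x1" using y1 by (simp add: e1)
    then show False using l p prime_dvd_power[OF l(1)] primes_dvd_imp_eq[of l p] by blast
  qed
  moreover have "int l dvd M" using y1 by (simp add: M_def)
  moreover have "9 dvd M" if "l = 3"
  proof -
    have "(3::int) ^ 2 dvd 3 ^ y1" using three[OF that] by (intro le_imp_power_dvd) simp
    then show ?thesis by (simp add: M_def that)
  qed
  ultimately show ?thesis using prime_power_dvd_index[OF l(1)] by blast
qed


lemma cubic_less_power3:
  "x \<ge> 4 \<Longrightarrow> x\<^sup>2 * (x + 1) < (3::nat) ^ x"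
proof (induction x rule: dec_induct)
  case (step x)
  have "4 * x \<le> x * x" "4 * (x * x) \<le> x * (x * x)"
    using mult_le_mono1[OF step.hyps(1), of x] mult_le_mono1[OF step.hyps(1), of "x * x"] by simp_all
  moreover have "(Suc x)\<^sup>2 * (Suc x + 1) = x * (x * x) + 4 * (x * x) + 5 * x + 2"
    "3 * (x\<^sup>2 * (x + 1)) = 3 * (x * (x * x)) + 3 * (x * x)"
    by (simp_all add: power2_eq_square algebra_simps)
  ultimately have "(Suc x)\<^sup>2 * (Suc x + 1) \<le> 3 * (x\<^sup>2 * (x + 1))"
    using step.hyps by linarith
  then show ?case using step.IH by simp
qed (simp add: power2_eq_square)

text \<open>The difference of the two equations shows that \<open>p ^ x1\<close> divides \<open>(l ^ k - 1) *
(l ^ k + 1)\<close>, and the odd prime \<open>p\<close> divides only one of the factors.\<close>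

lemma larger_solution_bounds:
  fixes p l c :: nat
  assumes p: "prime p" "odd p" and l: "prime l" "l \<noteq> p" and c: "c > 0"
    and e1: "p ^ x1 = c + l ^ y1" and e2: "p ^ x2 = c + l ^ (y1 + 2 * k)"
    and k: "k > 0"
  shows "p ^ x1 \<le> l ^ k + 1" "p ^ x2 < p ^ x1 * l ^ (2 * k)"
proof -
  have l2: "l \<ge> 2" by (rule prime_ge_2_nat[OF l(1)])
  have L: "2 \<le> l ^ k" "2 \<le> l ^ (2 * k)" using k l2 by (simp_all add: self_le_power order.trans)
  have "c * 1 < c * l ^ (2 * k)" using c L by (intro mult_strict_left_mono) auto
  then show "p ^ x2 < p ^ x1 * l ^ (2 * k)"
    unfolding e1 e2 by (simp add: power_add algebra_simps)
  have "l ^ y1 < l ^ (y1 + 2 * k)" using l2 k by simp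
  then have "p ^ x1 < p ^ x2" unfolding e1 e2 by simp
  then have x: "x1 < x2" using p prime_gt_1_nat power_less_imp_less_exp by blast
  have "p ^ x2 - p ^ x1 = l ^ y1 * (l ^ (2 * k) - 1)"
    unfolding e1 e2 by (simp add: power_add algebra_simps)
  moreover have "p ^ x1 dvd p ^ x2 - p ^ x1" using x by (intro dvd_diff_nat) (auto intro: le_imp_power_dvd)
  moreover have "coprime (p ^ x1) (l ^ y1)"
    using p l by (simp add: primes_coprime)
  ultimately have "p ^ x1 dvd l ^ (2 * k) - 1" by (simp add: coprime_dvd_mult_right_iff)
  also have "l ^ (2 * k) - 1 = (l ^ k - 1) * (l ^ k + 1)"
    by (simp add: power_mult power2_eq_square algebra_simps power_even_eq)
  finally have d: "p ^ x1 dvd (l ^ k - 1) * (l ^ k + 1)" .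
  have "\<not> (p dvd l ^ k - 1 \<and> p dvd l ^ k + 1)"
  proof
    assume *: "p dvd l ^ k - 1 \<and> p dvd l ^ k + 1"
    have "p dvd (l ^ k + 1) - (l ^ k - 1)"
      by (rule dvd_diff_nat[OF conjunct2[OF *] conjunct1[OF *]])
    also have "(l ^ k + 1) - (l ^ k - 1) = 2" using L by simp
    finally show False using p by (metis primes_dvd_imp_eq two_is_prime_nat dvd_refl)
  qed
  then have "coprime (p ^ x1) (l ^ k - 1) \<or> coprime (p ^ x1) (l ^ k + 1)"
    using p by (auto simp: prime_imp_coprime)
  then have "p ^ x1 dvd l ^ k - 1 \<or> p ^ x1 dvd l ^ k + 1"
    using d coprime_dvd_mult_right_iff coprime_dvd_mult_left_iff by metis
  then show "p ^ x1 \<le> l ^ k + 1"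
    using L by (auto dest: dvd_imp_le)
qed

text \<open>With \<open>l ^ k\<close> at most \<open>x2\<close>, the bounds give \<open>p ^ x2 < x2\<^sup>2 *
(x2 + 1)\<close>. This leaves \<open>p = 3\<close> and \<open>x2\<close> at most 3, so \<open>l =
2\<close> and \<open>c = 1\<close>.\<close>

lemma same_parity_imp_three:
  fixes p l c :: nat
  assumes p: "prime p" "odd p" and l: "prime l" "l \<noteq> p" and c: "c > 1"
    and e1: "p ^ x1 = c + l ^ y1" and e2: "p ^ x2 = c + l ^ (y1 + 2 * k)"
    and y1: "y1 > 0" and k: "k > 0"
  shows "l = 3 \<and> y1 = 1"
proof (rule ccontr)
  assume "\<not> (l = 3 \<and> y1 = 1)"
  then have three: "l = 3 \<Longrightarrow> y1 > 1" using y1 by auto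
  have c0: "c > 0" using c by simp
  have d: "l ^ k dvd x2" by (rule prime_power_dvd_exponent[OF p l c0 e1 e2 y1 three])
  have l2: "l \<ge> 2" by (rule prime_ge_2_nat[OF l(1)])
  have "c + l ^ (y1 + 2 * k) > 1" using c by simp
  then have x2: "x2 > 0" unfolding e2[symmetric] by (cases x2) auto
  have le: "l ^ k \<le> x2" using d x2 by (simp add: dvd_imp_le)
  note sb = larger_solution_bounds[OF p l c0 e1 e2 k]
  have "p ^ x1 * l ^ (2 * k) \<le> (x2 + 1) * x2\<^sup>2"
    using sb(1) le by (intro mult_mono) (auto simp: power_even_eq power_mono)
  then have b: "p ^ x2 < x2\<^sup>2 * (x2 + 1)" using sb(2) by (simp add: mult.commute)
  have p3: "p \<ge> 3" using p prime_ge_2_nat[OF p(1)] by (cases "p = 2") auto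
  have "(3::nat) ^ x2 \<le> p ^ x2" using p3 by (simp add: power_mono)
  then have "\<not> x2 \<ge> 4" using cubic_less_power3[of x2] b by linarith
  moreover have "x2 \<ge> 2" using le k l2 self_le_power[of l k] by linarith
  ultimately have x23: "x2 = 2 \<or> x2 = 3" by linarith
  have "p = 3"
  proof (rule ccontr)
    assume "p \<noteq> 3"
    then have "p \<ge> 5" using p3 p by (cases "p = 4") auto
    then have "5 ^ x2 \<le> p ^ x2" by (simp add: power_mono)
    then show False using x23 b by auto
  qed
  then have "l \<noteq> 3" using l by simp
  have lx: "l dvd x2" using d k by (meson dvd_power dvd_trans)
  have "l = 2" "x2 = 2"
  proof -
    from x23 have "prime x2" by auto
    then have "l = x2" using lx l primes_dvd_imp_eq by blast
    then show "l = 2" "x2 = 2" using x23 \<open>l \<noteq> 3\<close> by auto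
  qed
  have "l ^ k \<le> 2" using le \<open>x2 = 2\<close> by simp
  then have "p ^ x1 \<le> 3" using sb(1) by simp
  moreover have "l ^ y1 \<ge> 2" using y1 l2 self_le_power[of l y1] by linarith
  ultimately show False using e1 c by linarith
qed

lemma prime_power_dvd_one_factor:
  fixes p :: nat and u v :: int
  assumes p: "prime p" and uv: "int p ^ x dvd u * v" and n: "\<not> (int p dvd u \<and> int p dvd v)"
  shows "int p ^ x dvd u \<or> int p ^ x dvd v"
proof -
  have pp: "prime (int p)" using p by simp
  from n have "coprime (int p ^ x) u \<or> coprime (int p ^ x) v"
    using pp by (auto simp: prime_imp_coprime)
  then show ?thesis
    using uv by (auto simp: coprime_dvd_mult_right_iff coprime_dvd_mult_left_iff)
qed

lemma prime_dvd_if_dvd_sum_diff: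
  fixes p :: nat and u v :: int
  assumes p: "prime p" "odd p" and "int p dvd u - v" "int p dvd u + v"
  shows "int p dvd v"
proof -
  have "int p dvd (u + v) - (u - v)" by (rule dvd_diff[OF assms(4,3)])
  then have "int p dvd 2 * v" by (simp add: algebra_simps)
  then show ?thesis using odd_prime_not_dvd_2[OF p] p prime_dvd_mult_iff[of "int p" 2 v] by simp
qed

lemma one_le_square: "(a::int) \<noteq> 0 \<Longrightarrow> 1 \<le> a\<^sup>2"
  by (smt (verit) zero_less_power2)

section \<open>The exceptional base 3\<close>

text \<open>A descent that plays the role of the ideal class group. The element \<open>sqrt f + sqrt (-
g)\<close> has norm \<open>p ^ x0\<close>. Elements of norm a power of \<open>p\<close> are either
of the type \<open>a * sqrt f + b * sqrt (- g)\<close> or of the type \<open>a + b * sqrt (- f *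
g)\<close>. Dividing by \<open>sqrt f + sqrt (- g)\<close> or its conjugate exchanges the two
types and lowers the exponent by \<open>x0\<close>, and \<open>f + g\<close> is the least norm of
a primitive element other than a unit.\<close>

lemma exponent_dvd_forms:
  fixes f g :: int and p :: nat
  assumes p: "prime p" "odd p" and f: "f \<ge> 1" and g: "g \<ge> 1"
    and Q: "f + g = int p ^ x0" and nf: "\<not> int p dvd f" and ng: "\<not> int p dvd g"
  shows "(f * a\<^sup>2 + g * b\<^sup>2 = int p ^ l \<longrightarrow> \<not> int p dvd b \<longrightarrow> x0 dvd l) \<and>
         (a\<^sup>2 + f * g * b\<^sup>2 = int p ^ l \<longrightarrow> \<not> int p dvd b \<longrightarrow> x0 dvd l)"
proof (induction l arbitrary: a b rule: less_induct)
  case (less l)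
  have pp: "prime (int p)" using p by simp
  have p1: "int p > 1" using p prime_gt_1_nat by simp
  have "int p ^ x0 > 1" using Q f g by linarith
  then have x0: "x0 > 0" by (cases x0) auto
  have le: "x0 \<le> l" if "f + g \<le> int p ^ l"
    using that p1 unfolding Q by (simp only: power_increasing_iff)
  have O: "x0 dvd l" if eq: "f * a\<^sup>2 + g * b\<^sup>2 = int p ^ l" and b: "\<not> int p dvd b"
  proof (cases "l = 0")
    case False
    then have pl: "int p dvd f * a\<^sup>2 + g * b\<^sup>2" unfolding eq by simp
    have "\<not> int p dvd g * b\<^sup>2" using b ng pp prime_dvd_power[OF pp] by (auto simp: prime_dvd_mult_iff)
    then have "a \<noteq> 0" using pl by auto
    moreover have "b \<noteq> 0" using b by auto
    ultimately have "f * 1 \<le> f * a\<^sup>2" "g * 1 \<le> g * b\<^sup>2"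
      using f g one_le_square by (intro mult_left_mono; simp)+
    then have xl: "x0 \<le> l" using le eq by linarith
    have "int p ^ x0 dvd f * a\<^sup>2 + g * b\<^sup>2" unfolding eq using xl by (rule le_imp_power_dvd)
    then have "int p ^ x0 dvd (f * a\<^sup>2 + g * b\<^sup>2) - (f + g) * b\<^sup>2" by (intro dvd_diff) (simp_all add: Q)
    also have "(f * a\<^sup>2 + g * b\<^sup>2) - (f + g) * b\<^sup>2 = f * ((a - b) * (a + b))"
      by (simp add: power2_eq_square algebra_simps)
    finally have "int p ^ x0 dvd (a - b) * (a + b)"
      using nf pp by (simp add: coprime_dvd_mult_right_iff prime_imp_coprime)
    moreover have "\<not> (int p dvd a - b \<and> int p dvd a + b)"
      using b prime_dvd_if_dvd_sum_diff[OF p] by blast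
    ultimately have "int p ^ x0 dvd a - b \<or> int p ^ x0 dvd a + b"
      by (rule prime_power_dvd_one_factor[OF p(1)])
    then obtain b' where b': "b' = b \<or> b' = - b" and d: "int p ^ x0 dvd a - b'"
      by (metis diff_minus_eq_add)
    have eq': "f * a\<^sup>2 + g * b'\<^sup>2 = int p ^ l" and nb': "\<not> int p dvd b'" using eq b b' by auto
    from d obtain t where "a - b' = int p ^ x0 * t" by (auto elim: dvdE)
    then have t: "a = b' + (f + g) * t" by (simp add: Q)
    have "int p ^ l = (f + g) * ((b' + f * t)\<^sup>2 + f * g * t\<^sup>2)"
      unfolding eq'[symmetric] t by (simp add: power2_eq_square algebra_simps)
    moreover have "int p ^ l = (f + g) * int p ^ (l - x0)"
      using xl by (simp add: Q flip: power_add)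
    ultimately have new: "(b' + f * t)\<^sup>2 + f * g * t\<^sup>2 = int p ^ (l - x0)"
      using f g by simp
    have "x0 dvd l - x0"
    proof (cases "l - x0 = 0")
      case False
      have "\<not> int p dvd t"
      proof
        assume "int p dvd t"
        moreover have "int p dvd (b' + f * t)\<^sup>2 + f * g * t\<^sup>2" unfolding new using False by simp
        ultimately have "int p dvd (b' + f * t)\<^sup>2" by (auto simp: dvd_add_left_iff power2_eq_square)
        then have "int p dvd b' + f * t" by (rule prime_dvd_power[OF pp])
        with \<open>int p dvd t\<close> nb' show False by (simp add: dvd_add_left_iff)
      qed
      then show ?thesis using less[of "l - x0"] new x0 xl by auto
    qed simp
    then show ?thesis using xl by (simp add: dvd_minus_self)
  qed simp
  have E: "x0 dvd l" if eq: "a\<^sup>2 + f * g * b\<^sup>2 = int p ^ l" and b: "\<not> int p dvd b"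
  proof (cases "l = 0")
    case False
    then have pl: "int p dvd a\<^sup>2 + f * g * b\<^sup>2" unfolding eq by simp
    have "\<not> int p dvd f * g * b\<^sup>2" using b ng nf pp prime_dvd_power[OF pp] by (auto simp: prime_dvd_mult_iff)
    then have "a \<noteq> 0" using pl by auto
    moreover have "b \<noteq> 0" using b by auto
    moreover have "f * g \<ge> 0" "(f - 1) * (g - 1) \<ge> 0" using f g by simp_all
    ultimately have "1 \<le> a\<^sup>2" "f * g * 1 \<le> f * g * b\<^sup>2"
      using one_le_square by (simp, intro mult_left_mono) simp_all
    moreover have "f + g \<le> 1 + f * g" using \<open>(f - 1) * (g - 1) \<ge> 0\<close> by (simp add: algebra_simps)
    ultimately have xl: "x0 \<le> l" using le eq by linarith
    have "int p ^ x0 dvd a\<^sup>2 + f * g * b\<^sup>2" unfolding eq using xl by (rule le_imp_power_dvd)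
    then have "int p ^ x0 dvd (a\<^sup>2 + f * g * b\<^sup>2) - (f + g) * (g * b\<^sup>2)" by (intro dvd_diff) (simp_all add: Q)
    also have "(a\<^sup>2 + f * g * b\<^sup>2) - (f + g) * (g * b\<^sup>2) = (a - g * b) * (a + g * b)"
      by (simp add: power2_eq_square algebra_simps)
    finally have "int p ^ x0 dvd (a - g * b) * (a + g * b)" .
    moreover have "\<not> (int p dvd a - g * b \<and> int p dvd a + g * b)"
      using b ng pp prime_dvd_if_dvd_sum_diff[OF p, of a "g * b"] by (auto simp: prime_dvd_mult_iff)
    ultimately have "int p ^ x0 dvd a - g * b \<or> int p ^ x0 dvd a + g * b"
      by (rule prime_power_dvd_one_factor[OF p(1)])
    then obtain b' where b': "b' = b \<or> b' = - b" and d: "int p ^ x0 dvd a - g * b'"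
      by (metis diff_minus_eq_add mult_minus_right)
    have eq': "a\<^sup>2 + f * g * b'\<^sup>2 = int p ^ l" and nb': "\<not> int p dvd b'" using eq b b' by auto
    from d obtain t where "a - g * b' = int p ^ x0 * t" by (auto elim: dvdE)
    then have t: "a = g * b' + (f + g) * t" by (simp add: Q)
    have "int p ^ l = (f + g) * (f * t\<^sup>2 + g * (b' + t)\<^sup>2)"
      unfolding eq'[symmetric] t by (simp add: power2_eq_square algebra_simps)
    moreover have "int p ^ l = (f + g) * int p ^ (l - x0)"
      using xl by (simp add: Q flip: power_add)
    ultimately have new: "f * t\<^sup>2 + g * (b' + t)\<^sup>2 = int p ^ (l - x0)"
      using f g by simp
    have "x0 dvd l - x0"
    proof (cases "l - x0 = 0")
      case False
      have "\<not> int p dvd b' + t"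
      proof
        assume *: "int p dvd b' + t"
        moreover have "int p dvd f * t\<^sup>2 + g * (b' + t)\<^sup>2" unfolding new using False by simp
        ultimately have "int p dvd f * t\<^sup>2" by (auto simp: dvd_add_left_iff power2_eq_square)
        then have "int p dvd t" using nf prime_dvd_power[OF pp] by (auto simp: prime_dvd_mult_iff[OF pp])
        with * nb' show False by (simp add: dvd_add_left_iff)
      qed
      then show ?thesis using less[of "l - x0"] new x0 xl by auto
    qed simp
    then show ?thesis using xl by (simp add: dvd_minus_self)
  qed simp
  show ?case using O E by blast
qed

text \<open>The case in which lifting the exponent breaks down. By \<open>exponent_dvd_forms\<close> the
second solution comes from an honest power, with exponent \<open>j\<close>, of the first. As 3
divides the imaginary part, it divides \<open>j\<close>, so \<open>qim A M 3 = 3 * (c - 1) * (c -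
9)\<close> divides \<open>3 ^ k\<close>. The outcome is \<open>13 - 3 = 13 ^ 3 - 3 ^ 7 =
10\<close>.\<close>

lemma same_parity_three:
  fixes p c :: nat
  assumes p: "prime p" "odd p" "p \<noteq> 3" and c: "c > 1"
    and e1: "p ^ x1 = c + 3" and e2: "p ^ x2 = c + 3 ^ (1 + 2 * k)"
    and k: "k > 0"
  shows "p = 13 \<and> c = 10"
proof -
  have pp: "prime (int p)" using p by simp
  have p3: "\<not> p dvd 3" using p primes_dvd_imp_eq[of p 3] by auto
  have x1: "x1 > 0" using e1 by (intro Nat.gr0I) simp
  have x2: "x2 > 0" using e2 c by (intro Nat.gr0I) simp
  have pc: "\<not> p dvd c"
  proof
    assume "p dvd c"
    moreover have "p dvd c + 3" using x1 by (simp add: e1[symmetric])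
    ultimately show False using p3 by (simp add: dvd_add_right_iff)
  qed
  have c3: "\<not> 3 dvd c"
  proof
    assume "3 dvd c"
    then have "3 dvd p ^ x1" unfolding e1 by simp
    then have "3 dvd p" by (rule prime_dvd_power[rotated]) simp
    then show False using p primes_dvd_imp_eq[of 3 p] by simp
  qed
  define u where "u = (3::int) ^ k"
  have u2: "(3::int) ^ (1 + 2 * k) = 3 * u\<^sup>2" by (simp add: u_def power_even_eq)
  have ip3: "\<not> int p dvd 3" using p3 by (metis int_dvd_int_iff of_nat_numeral)
  have pu: "\<not> int p dvd u"
    using prime_dvd_power[OF pp] ip3 by (auto simp: u_def)
  have E1: "int c + 3 = int p ^ x1" using arg_cong[OF e1, of int] by simp
  have E2: "int c + 3 * u\<^sup>2 = int p ^ x2" using arg_cong[OF e2, of int] u2 by simp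
  have "x1 dvd x2"
    using exponent_dvd_forms[of p "int c" 3 x1 1 u x2] p c pc ip3 E1 E2 pu by simp
  then obtain j where j: "x2 = x1 * j" by (auto elim: dvdE)
  \<comment> \<open>The square of \<open>sqrt c + sqrt (- 3)\<close> is \<open>A + sqrt (- M)\<close>.\<close>
  define A M where "A = int c - 3" and "M = 12 * int c"
  have norm: "A\<^sup>2 + M = int p ^ (2 * x1)"
  proof -
    have "A\<^sup>2 + M = (int c + 3)\<^sup>2" by (simp add: A_def M_def power2_eq_square algebra_simps)
    then show ?thesis unfolding E1 by (simp add: power_mult mult.commute)
  qed
  have eq1: "(qre A M j)\<^sup>2 + M * (qim A M j)\<^sup>2 = int p ^ (2 * x2)"
    unfolding qre_qim_norm norm by (simp add: j mult.assoc flip: power_mult)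
  have eq2: "(int c - 3 * u\<^sup>2)\<^sup>2 + M * u\<^sup>2 = int p ^ (2 * x2)"
  proof -
    have "(int c - 3 * u\<^sup>2)\<^sup>2 + M * u\<^sup>2 = (int c + 3 * u\<^sup>2)\<^sup>2"
      by (simp add: M_def power2_eq_square algebra_simps)
    then show ?thesis unfolding E2 by (simp add: power_mult mult.commute)
  qed
  have j0: "j > 0" using j x2 by auto
  have d: "int p dvd A\<^sup>2 + M" unfolding norm using x1 by simp
  have "\<not> int p dvd M"
    using pc ip3 odd_prime_not_dvd_2[OF p(1,2)] prime_dvd_mult_iff[OF pp, of 2 2] prime_dvd_mult_iff[OF pp, of 4 3]
    by (simp add: M_def prime_dvd_mult_iff[OF pp])
  then have pA: "\<not> int p dvd A" using d by (auto simp: power2_eq_square dvd_add_right_iff)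
  have "M \<ge> 2" using c by (simp add: M_def)
  then have "(qim A M j)\<^sup>2 = u\<^sup>2"
    using norm_form_unique_odd[OF p(1,2) _ eq1 eq2 prime_not_dvd_qre_qim(1)[OF p(1,2) d pA j0] pu] by blast
  then have im: "qim A M j dvd 3 ^ k" "3 ^ k dvd qim A M j"
    by (auto simp: power2_eq_iff u_def)
  have A3: "\<not> 3 dvd A"
  proof
    assume "3 dvd A"
    then show False using c3 unfolding A_def by presburger
  qed
  have p3i: "prime (3::int)" by simp
  have "3 dvd j"
  proof -
    obtain i where i: "j = Suc i" using j0 by (cases j) auto
    have "3 dvd qim A M j" using im(2) k by (meson dvd_power dvd_trans)
    moreover have "[qim A M j = int j * A ^ i] (mod 3)"
      using qre_qim_cong(2)[of A M i] unfolding i[symmetric] by (rule cong_dvd_modulus) (simp add: M_def)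
    ultimately have "3 dvd int j * A ^ i" using cong_dvd_iff by blast
    then have "3 dvd int j" using A3 prime_dvd_power[OF p3i] by (auto simp: prime_dvd_mult_iff[OF p3i])
    then show ?thesis by presburger
  qed
  then obtain i where i: "j = 3 * i" by (auto elim: dvdE)
  have "qim A M 3 dvd qim A M j" unfolding i qre_qim_mult(2) by simp
  then have "qim A M 3 dvd 3 ^ k" using im(1) by (rule dvd_trans)
  moreover have im3: "qim A M 3 = 3 * (int c - 1) * (int c - 9)"
    by (simp add: A_def M_def numeral_3_eq_3 algebra_simps)
  moreover have "int c - 1 dvd qim A M 3" "int c - 9 dvd qim A M 3"
    unfolding im3 by (simp_all only: dvd_mult dvd_mult2 dvd_refl)
  ultimately have dd: "int c - 1 dvd 3 ^ k" "int c - 9 dvd 3 ^ k"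
    using dvd_trans by blast+
  have "\<not> 3 dvd int c - 9"
    using c3 by presburger
  then have "coprime (3 ^ k) (int c - 9)" using p3i by (simp add: prime_imp_coprime)
  then have "is_unit (int c - 9)" using dd(2) by (meson coprime_common_divisor dvd_refl)
  then have "c = 8 \<or> c = 10" by (auto simp: zdvd1_eq)
  moreover have "c \<noteq> 8"
  proof
    assume "c = 8"
    then have "7 dvd (3::int) ^ k" using dd(1) by simp
    then have "7 dvd (3::int)" by (rule prime_dvd_power[rotated]) simp
    then show False by simp
  qed
  ultimately have c10: "c = 10" by simp
  have "p dvd c + 3" using x1 by (simp add: e1[symmetric])
  then have "p dvd 13" using c10 by simp
  then have "p = 13" using p primes_dvd_imp_eq[of p 13] by simp
  then show ?thesis using c10 by simp
qed

lemma same_parity_solutions: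
  fixes p l c :: nat
  assumes p: "prime p" "odd p" and l: "prime l" "l \<noteq> p" and c: "c > 1"
    and e1: "p ^ x1 = c + l ^ y1" and e2: "p ^ x2 = c + l ^ (y1 + 2 * k)"
    and y1: "y1 > 0" and k: "k > 0"
  shows "l = 3 \<and> y1 = 1 \<and> p = 13 \<and> c = 10"
  using same_parity_imp_three[OF assms] same_parity_three[of p c x1 x2 k] assms by auto

section \<open>A zero exponent and an even exponent\<close>

lemma power_cong_1_step:
  fixes x :: int and l :: nat
  assumes "int l ^ i dvd x - 1" "i > 0"
  shows "int l ^ (i + 1) dvd x ^ l - 1"
proof -
  have "int l dvd x - 1" using assms by (meson dvd_power dvd_trans)
  then have "[x = 1] (mod int l)" by (simp add: cong_iff_dvd_diff)
  then have "[(\<Sum>j<l. x ^ j) = (\<Sum>j<l. 1 ^ j)] (mod int l)"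
    by (intro cong_sum cong_pow)
  then have "int l dvd (\<Sum>j<l. x ^ j)" by (simp add: cong_dvd_iff)
  then have "int l ^ i * int l dvd (x - 1) * (\<Sum>j<l. x ^ j)" using assms(1) by (rule mult_dvd_mono[rotated])
  then show ?thesis by (simp add: power_diff_1_eq mult.commute)
qed

lemma power_cong_1:
  fixes x :: int and l :: nat
  assumes "int l ^ i dvd x - 1" "i > 0" "l ^ e dvd k"
  shows "int l ^ (e + i) dvd x ^ k - 1"
proof -
  have "int l ^ (e + i) dvd x ^ (l ^ e) - 1"
  proof (induction e)
    case (Suc e)
    then show ?case using power_cong_1_step[of l "e + i" "x ^ (l ^ e)"] assms(2)
      by (simp add: mult.commute flip: power_mult)
  qed (use assms in simp)
  moreover obtain j where "k = l ^ e * j" using assms(3) by (auto elim: dvdE)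
  ultimately show ?thesis
    by (metis dvd_trans power_mult power_diff_1_eq dvd_triv_left)
qed

lemma exact_prime_power:
  fixes k l :: nat
  assumes "k > 0" "prime l"
  obtains e where "l ^ e dvd k" "\<not> l ^ (e + 1) dvd k"
proof -
  have "\<exists>e. l ^ e dvd k \<and> \<not> l ^ Suc e dvd k"
  proof (rule ccontr)
    assume "\<not> ?thesis"
    then have "l ^ e dvd k" for e by (induction e) auto
    then have "l ^ k \<le> k" using assms by (simp add: dvd_imp_le)
    moreover have "k < l ^ k" using prime_ge_2_nat[OF assms(2)] by (meson less_exp less_le_trans power_mono zero_le)
    ultimately show False by simp
  qed
  then show ?thesis using that by auto
qed


text \<open>With \<open>X + Y * sqrt (- c) = (1 + sqrt (- c)) ^ k\<close>, the hypothesis becomes \<open>2 * Y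
* (c * Y - X) = (c + 1) ^ k - 1\<close>. A prime \<open>l\<close> that divides \<open>c\<close> to
a sufficient power occurs in \<open>Y\<close> as often as in \<open>k\<close>, but strictly more
often in \<open>(c + 1) ^ k - 1\<close>. This leaves \<open>c = 2\<close> and \<open>c = 6\<close>
with \<open>k\<close> odd. The value 6 fails modulo 5. For \<open>c = 2\<close> the same
comparison is made relative to \<open>(1 + sqrt (- 2)) ^ 3 = - 5 + sqrt (- 2)\<close>, whose
imaginary part is 1, too.\<close>

lemma qim_eq_1_imp:
  fixes c :: nat
  assumes c: "even c" "c > 0" and k: "k > 0" and im: "qim 1 (int c) (2 * k + 1) = 1"
  shows "c = 2 \<and> k = 1"
proof -
  define X Y where "X = qre 1 (int c) k" and "Y = qim 1 (int c) k"
  have norm: "X\<^sup>2 + int c * Y\<^sup>2 = (int c + 1) ^ k"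
    unfolding X_def Y_def qre_qim_norm by (simp add: add.commute)
  have "qim 1 (int c) (2 * k + 1) = 2 * X * Y + (X\<^sup>2 - int c * Y\<^sup>2)"
    unfolding mult_2 qre_qim_add(2) qre_qim_add(1) by (simp add: qre_qim_add X_def Y_def power2_eq_square)
  then have key: "2 * Y * (int c * Y - X) = (int c + 1) ^ k - 1"
    using im norm by (simp add: power2_eq_square algebra_simps)
  have Xc: "[X = 1] (mod int c)" using qre_qim_cong(1)[of 1 "int c" k] by (simp add: X_def)
  \<comment> \<open>The argument on valuations; the factor 2 on the left-hand side of \<open>key\<close> costs one factor for \<open>l = 2\<close>.\<close>
  have no: False if l: "prime l" "l dvd c" "l = 3 \<Longrightarrow> 9 dvd c"
    and e: "l ^ e dvd k" "\<not> l ^ (e + 1) dvd k"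
    and Q: "int l ^ (e + 1) * (if l = 2 then 2 else 1) dvd (int c + 1) ^ k - 1" for l e
  proof -
    have pl: "prime (int l)" using l by simp
    have nX: "\<not> int l dvd int c * Y - X"
    proof
      assume "int l dvd int c * Y - X"
      then have "int l dvd X" using l(2) by (metis dvd_diff_right_iff dvd_mult2 int_dvd_int_iff)
      moreover have "[X = 1] (mod int l)" by (rule cong_dvd_modulus[OF Xc]) (simp add: l(2))
      ultimately have "int l dvd 1" using cong_dvd_iff by blast
      then show False using pl by auto
    qed
    have "int l ^ (e + 1) dvd Y * (int c * Y - X)"
    proof (cases "l = 2")
      case True
      then have "int l ^ (e + 1) * 2 dvd (Y * (int c * Y - X)) * 2" using Q key by (simp add: mult_ac)
      then show ?thesis using dvd_mult_cancel_right[of "int l ^ (e + 1)" 2 "Y * (int c * Y - X)"] by linarith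
    next
      case False
      then have "odd l" using l(1) primes_dvd_imp_eq[of 2 l] by auto
      then have "coprime (int l) 2" using odd_prime_not_dvd_2[OF l(1)] pl by (simp add: prime_imp_coprime)
      then have "coprime (int l ^ (e + 1)) 2" by (simp only: coprime_power_left_iff) simp
      moreover have "int l ^ (e + 1) dvd 2 * (Y * (int c * Y - X))" using Q key False by (simp add: mult_ac)
      ultimately show ?thesis by (simp add: coprime_dvd_mult_right_iff)
    qed
    moreover have "coprime (int l ^ (e + 1)) (int c * Y - X)" using nX pl by (simp add: prime_imp_coprime)
    ultimately have "int l ^ (e + 1) dvd Y" by (simp add: coprime_dvd_mult_left_iff)
    then have "l ^ (e + 1) dvd k"
      unfolding Y_def using l pl by (intro prime_power_dvd_index[OF l(1)]) auto
    then show False using e by simp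
  qed
  have odd_l: False if l: "prime l" "l dvd c" "l = 3 \<Longrightarrow> 9 dvd c" "l \<noteq> 2" for l
  proof -
    obtain e where e: "l ^ e dvd k" "\<not> l ^ (e + 1) dvd k" using exact_prime_power[OF k l(1)] .
    have "int l ^ (e + 1) dvd (int c + 1) ^ k - 1"
      using l e by (intro power_cong_1) auto
    then show False using no[OF l(1,2,3) e] l(4) by simp
  qed
  obtain e where e: "2 ^ e dvd k" "\<not> 2 ^ (e + 1) dvd k" using exact_prime_power[OF k two_is_prime_nat] .
  have not4: "\<not> 4 dvd c"
  proof
    assume "4 dvd c"
    then have "int 2 ^ 2 dvd (int c + 1) - 1" by auto
    then have "int 2 ^ (e + 2) dvd (int c + 1) ^ k - 1" using e by (intro power_cong_1) auto
    then show False using no[OF two_is_prime_nat c(1) _ e] by simp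
  qed
  have "odd k"
  proof
    assume "even k"
    then obtain h where h: "k = 2 * h" by (auto elim: evenE)
    have "e \<noteq> 0" using e h by (intro notI) simp
    then obtain e' where e': "e = Suc e'" by (cases e) auto
    have "int 2 ^ 3 dvd (int c + 1)\<^sup>2 - 1" using odd_square_8[of "int c + 1"] c by simp
    then have "int 2 ^ (e' + 3) dvd ((int c + 1)\<^sup>2) ^ h - 1" using e h e' by (intro power_cong_1) auto
    then have "int 2 ^ (e + 2) dvd (int c + 1) ^ k - 1" by (simp add: h e' power_mult numeral_3_eq_3)
    then show False using no[OF two_is_prime_nat c(1) _ e] by simp
  qed
  obtain c' where c': "c = 2 * c'" using c by (auto elim: evenE)
  have "odd c'" using not4 c' by auto
  have c26: "c = 2 \<or> c = 6"
  proof (cases "c' = 1")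
    case False
    then obtain l where l: "prime l" "l dvd c'" using prime_factor_nat by blast
    have "l \<noteq> 2" using l \<open>odd c'\<close> by auto
    then have "l = 3" using odd_l[of l] l c' by (metis dvd_mult)
    then obtain d where d: "c' = 3 * d" using l by (auto elim: dvdE)
    have "d = 1"
    proof (rule ccontr)
      assume "d \<noteq> 1"
      then obtain l' where l': "prime l'" "l' dvd d" using prime_factor_nat by blast
      have "l' \<noteq> 2" using l' \<open>odd c'\<close> d by auto
      moreover have "l' dvd c" using l' c' d by simp
      moreover have "9 dvd c" if "l' = 3" using l' c' d that by (auto elim!: dvdE)
      ultimately show False using odd_l[of l'] l' by blast
    qed
    then show ?thesis using c' d by simp
  qed (simp add: c')
  \<comment> \<open>For \<open>c\<close> equal to 2 or 6, the fourth power of \<open>1 + sqrt (- c)\<close> is 1 modulo 4 or modulo 5.\<close>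
  obtain h where h: "k = 2 * h + 1" using \<open>odd k\<close> by (auto elim: oddE)
  have n: "2 * k + 1 = 3 + 4 * h" using h by simp
  define A B where "A = qre 1 (int c) (4 * h)" and "B = qim 1 (int c) (4 * h)"
  show ?thesis
  proof (cases "c = 6")
    case True
    have "qre 1 6 4 = 1" "qim 1 6 4 = - 20" by (simp_all add: eval_nat_numeral)
    then have A: "A = qre 1 2400 h" and B: "B = - 20 * qim 1 2400 h"
      by (simp_all add: A_def B_def True qre_qim_mult)
    have "[A = 1] (mod 2400)" unfolding A using qre_qim_cong(1)[of 1 2400 h] by simp
    then have "[A = 1] (mod 5)" by (rule cong_dvd_modulus) simp
    have "qim 1 6 3 = - 3" "qre 1 6 3 = - 17" by (simp_all add: eval_nat_numeral)
    then have "1 = - 17 * B + - 3 * A" using im unfolding n qre_qim_add by (simp add: A_def B_def True)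
    then have "1 = 340 * qim 1 2400 h - 3 * A" unfolding B by simp
    moreover have "5 dvd A - 1" using \<open>[A = 1] (mod 5)\<close> by (simp only: cong_iff_dvd_diff)
    then obtain t where "A - 1 = 5 * t" by (rule dvdE)
    then have "A = 1 + 5 * t" by linarith
    ultimately have "4 = 340 * qim 1 2400 h - 15 * t" by linarith
    then have "4 = 5 * (68 * qim 1 2400 h - 3 * t)" by simp
    then have "5 dvd (4::int)" by (rule dvdI)
    then show ?thesis by simp
  next
    case False
    then have c2: "c = 2" using c26 by simp
    show ?thesis
    proof (cases "h = 0")
      case False
      define w where "w = qim (-7) 32 h"
      have "qre 1 2 4 = - 7" "qim 1 2 4 = - 4" by (simp_all add: eval_nat_numeral)
      then have B: "B = - 4 * w"
        by (simp add: B_def w_def c2 qre_qim_mult)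
      have "qim 1 2 3 = 1" "qre 1 2 3 = - 5" by (simp_all add: eval_nat_numeral)
      then have "1 = - 5 * B + A" using im unfolding n qre_qim_add by (simp add: A_def B_def c2)
      then have A: "A = 1 + 5 * B" by simp
      have "(3::int) ^ (4 * h) = 81 ^ h" by (simp add: power_mult)
      then have "A\<^sup>2 + 2 * B\<^sup>2 = 81 ^ h" using qre_qim_norm[of 1 2 "4 * h"] by (simp add: A_def B_def c2)
      then have "8 * (w * (54 * w - 5)) = 81 ^ h - 1"
        unfolding A B by (simp add: power2_eq_square algebra_simps)
      obtain e where e: "2 ^ e dvd h" "\<not> 2 ^ (e + 1) dvd h" using exact_prime_power[of h 2] False by auto
      have "int 2 ^ (e + 4) dvd 81 ^ h - 1" using e by (intro power_cong_1) auto
      then have "8 * 2 ^ (e + 1) dvd 8 * (w * (54 * w - 5))"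
        unfolding \<open>8 * (w * (54 * w - 5)) = 81 ^ h - 1\<close> by (simp add: power_add mult.commute)
      then have "2 ^ (e + 1) dvd w * (54 * w - 5)" by (simp only: dvd_mult_cancel_left) simp
      moreover have "coprime (2 ^ (e + 1)) (54 * w - 5)" by simp
      ultimately have "int 2 ^ (e + 1) dvd w" by (simp add: coprime_dvd_mult_left_iff)
      then have "2 ^ (e + 1) dvd h" unfolding w_def by (intro prime_power_dvd_index) auto
      then show ?thesis using e by simp
    qed (use h c2 in simp)
  qed
qed


text \<open>By \<open>exponent_dvd_forms\<close> and the uniqueness of norms, \<open>a\<close> is up to sign
the real part of a power of \<open>1 + sqrt (- c)\<close> with imaginary part 1 or \<open>-
1\<close>. The first possibility is \<open>qim_eq_1_imp\<close>. In the second, \<open>n\<close>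
is \<open>- 1\<close> modulo \<open>c\<close>, hence modulo \<open>p - 1\<close>, which divides
\<open>c = p ^ x0 - 1\<close>. Then \<open>2 ^ (n + 1)\<close> is 1 modulo \<open>p\<close>, but
it is also \<open>4 * 2 ^ (n - 1) = - 4\<close>, so \<open>p\<close> divides 5.\<close>

lemma zero_and_even_plus:
  fixes p c a :: nat
  assumes p: "prime p" "odd p" and c: "even c" "c > 0" and a: "a > 1"
    and e0: "p ^ x0 = c + 1" and e1: "p ^ x1 = c + a\<^sup>2"
  shows "(p = 3 \<and> c = 2 \<and> a = 5) \<or>
    (p = 5 \<and> odd x0 \<and> (\<exists>n. x1 = x0 * n \<and> odd n \<and> c dvd n + 1 \<and> \<bar>qre 1 (int c) n\<bar> = int a \<and> qim 1 (int c) n = - 1))"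
proof -
  have pp: "prime (int p)" using p by simp
  have p1: "p > 1" using p prime_gt_1_nat by blast
  have x0: "x0 > 0" using e0 c by (intro Nat.gr0I) simp
  have E0: "1 + int c = int p ^ x0" using arg_cong[OF e0, of int] by simp
  have E1: "(int a)\<^sup>2 + int c = int p ^ x1" using arg_cong[OF e1, of int] by simp
  have pc: "\<not> int p dvd int c"
  proof
    assume "int p dvd int c"
    moreover have "int p dvd 1 + int c" unfolding E0 using x0 by simp
    ultimately have "int p dvd 1" by (simp add: dvd_add_left_iff)
    then show False using pp by auto
  qed
  have p1': "\<not> int p dvd 1" using p1 by simp
  have "x0 dvd x1"
    using exponent_dvd_forms[of p 1 "int c" x0 "int a" 1 x1] p pc p1' E0 E1 c by simp
  then obtain n where n: "x1 = x0 * n" by (auto elim: dvdE)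
  have "c \<ge> 2" using c by presburger
  then have "p ^ x1 > 1" unfolding e1 by simp
  then have x1: "x1 > 0" by (intro Nat.gr0I) simp
  then have n0: "n > 0" using n by auto
  have "(qre 1 (int c) n)\<^sup>2 + int c * (qim 1 (int c) n)\<^sup>2 = (1\<^sup>2 + int c) ^ n"
    by (rule qre_qim_norm)
  then have nrm: "(qre 1 (int c) n)\<^sup>2 + int c * (qim 1 (int c) n)\<^sup>2 = int p ^ x1"
    by (simp add: E0 n power_mult)
  have d: "int p dvd 1\<^sup>2 + int c" using x0 by (simp add: E0)
  have "(qim 1 (int c) n)\<^sup>2 = 1\<^sup>2"
    using norm_form_unique_odd[OF p _ nrm _ prime_not_dvd_qre_qim(1)[OF p d p1' n0] p1', of "int a"] E1 \<open>c \<ge> 2\<close>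
    by simp
  then have im: "qim 1 (int c) n = 1 \<or> qim 1 (int c) n = - 1" by (simp add: power2_eq_1_iff)
  then have "(qre 1 (int c) n)\<^sup>2 = (int a)\<^sup>2" using nrm E1 by auto
  then have re: "\<bar>qre 1 (int c) n\<bar> = int a" by (auto simp: power2_eq_iff)
  obtain m where m: "n = Suc m" using n0 by (cases n) auto
  have imc: "[qim 1 (int c) n = int n] (mod int c)"
    using qre_qim_cong(2)[of 1 "int c" m] by (simp add: m)
  have "odd n"
  proof -
    have "[qim 1 (int c) n = int n] (mod 2)" by (rule cong_dvd_modulus[OF imc]) (use c in simp)
    then have "2 dvd int n \<longleftrightarrow> 2 dvd qim 1 (int c) n" by (rule cong_dvd_iff[symmetric])
    then show ?thesis using im by auto
  qed
  have "n \<noteq> 1"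
  proof
    assume "n = 1"
    then have "a\<^sup>2 = 1" using e0 e1 n by simp
    then show False using a by simp
  qed
  then have n3: "n \<ge> 3" using \<open>odd n\<close> n0 by (cases "n = 2") auto
  show ?thesis
  proof (cases "qim 1 (int c) n = 1")
    case True
    obtain k where k: "n = 2 * k + 1" using \<open>odd n\<close> by (auto elim: oddE)
    have ck: "c = 2 \<and> k = 1"
      using qim_eq_1_imp[OF c _ True[unfolded k]] n3 k by simp
    have "p dvd 3" using e0 ck x0 by (metis One_nat_def add_2_eq_Suc' add.commute dvd_power numeral_3_eq_3)
    then have p3: "p = 3" using p primes_dvd_imp_eq[of p 3] by simp
    then have "x0 = 1" using e0 ck power_inject_exp[of "3::nat" x0 1] by simp
    then have "a\<^sup>2 = 5\<^sup>2" using e1 p3 n k ck by simp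
    then have "a = 5" by (simp only: power2_eq_iff_nonneg zero_le)
    then show ?thesis using ck p3 by simp
  next
    case False
    then have im1: "qim 1 (int c) n = - 1" using im by simp
    then have "int c dvd - 1 - int n" using imc by (simp add: cong_iff_dvd_diff)
    then have "int c dvd - (1 + int n)" by simp
    then have "int c dvd int (n + 1)" by (simp only: dvd_minus_iff) (simp add: add.commute)
    then have cn: "c dvd n + 1" by (simp only: int_dvd_int_iff)
    have "p - 1 dvd c"
    proof -
      have "[p ^ x0 = 1 ^ x0] (mod (p - 1))"
        by (intro cong_pow) (use p1 in \<open>simp add: cong_altdef_nat\<close>)
      then show ?thesis by (simp add: e0 cong_altdef_nat)
    qed
    then obtain t where t: "n + 1 = (p - 1) * t" using cn by (meson dvdE dvd_trans)
    have "\<not> p dvd 2" using p primes_dvd_imp_eq[of p 2] by auto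
    then have "[(2 ^ (p - 1)) ^ t = 1 ^ t] (mod p)" by (intro cong_pow fermat_theorem p)
    then have "[2 ^ (n + 1) = 1] (mod p)" unfolding t power_mult power_one .
    then have "[int (2 ^ (n + 1)) = int 1] (mod int p)" by (simp only: cong_int_iff)
    then have F: "[2 ^ (n + 1) = (1::int)] (mod int p)" by simp
    have "[qim 1 (int c) n = 2 ^ m] (mod int p)"
      by (rule cong_dvd_modulus[OF qre_qim_cong_norm(2)[of 1 "int c" m, folded m, simplified]])
        (use d in simp)
    then have "[4 * qim 1 (int c) n = 4 * 2 ^ m] (mod int p)" by (rule cong_mult[OF cong_refl])
    also have "4 * 2 ^ m = (2::int) ^ (n + 1)" by (simp add: m)
    also note F
    finally have "int p dvd 5" unfolding im1 by (simp add: cong_iff_dvd_diff)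
    then have "p dvd 5" by (metis int_dvd_int_iff of_nat_numeral)
    then have p5: "p = 5" using p primes_dvd_imp_eq[of p 5] by simp
    have "odd x0"
    proof
      assume "even x0"
      then obtain h where h: "x0 = 2 * h" by (auto elim: evenE)
      \<comment> \<open>Then \<open>c\<close> is a difference of squares, which is too large.\<close>
      define R where "R = p ^ (h * n)"
      have R2: "R\<^sup>2 = c + a\<^sup>2" unfolding e1[symmetric] n h R_def by (simp add: mult_ac flip: power_mult)
      have "a < R" using R2 c by (metis less_add_same_cancel2 power_less_imp_less_base zero_le)
      then obtain d where d: "R = a + d" "d > 0" using less_imp_add_positive by blast
      have "R + a \<le> d * (R + a)" using d by simp
      also have "\<dots> = c" using R2 by (simp add: d(1) power2_eq_square algebra_simps)
      finally have "R < p ^ x0" using e0 by simp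
      moreover have "x0 \<le> h * n" using n3 by (simp add: h mult.commute)
      then have "p ^ x0 \<le> R" unfolding R_def using p1 by (intro power_increasing) auto
      ultimately show False by simp
    qed
    then show ?thesis using p5 n \<open>odd n\<close> cn re im1 by blast
  qed
qed

section \<open>Solutions of opposite sign\<close>

lemma prime_ne_not_dvd:
  fixes p q :: nat
  shows "prime p \<Longrightarrow> prime q \<Longrightarrow> p \<noteq> q \<Longrightarrow> \<not> int p dvd int q"
  using primes_dvd_imp_eq[of p q] by auto

lemma exp_pos_of_eq:
  fixes p q c :: nat
  assumes "p ^ x = c + q ^ y" "prime q" "c > 0"
  shows "x > 0"
proof (rule Nat.gr0I)
  assume "x = 0"
  then have "c + q ^ y = 1" using assms(1) by simp
  moreover have "q ^ y > 0" using assms(2) by (simp add: prime_gt_0_nat)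
  ultimately show False using assms(3) by linarith
qed

text \<open>Modulo \<open>p\<close>, the plus solutions give \<open>q ^ j = 1\<close> with \<open>j\<close>
odd, and the minus solution gives \<open>q ^ y3 = - q ^ y1\<close>. Raising the latter to the
power \<open>j\<close> yields \<open>1 = - 1\<close>.\<close>

lemma opposite_sign_ordered:
  fixes p q c :: nat
  assumes p: "prime p" "odd p" and q: "prime q" "p \<noteq> q" and c: "c > 0"
    and e1: "p ^ x1 = c + q ^ y1" and e2: "p ^ x2 = c + q ^ (y1 + j)" and j: "odd j"
    and e3: "q ^ y3 = c + p ^ x3" "x3 > 0"
  shows False
proof -
  have pp: "prime (int p)" using p by simp
  have x: "x1 > 0" "x2 > 0" using exp_pos_of_eq e1 e2 q c by blast+
  have E: "int c + int q ^ y1 = int p ^ x1" "int c + int q ^ (y1 + j) = int p ^ x2" "int q ^ y3 = int c + int p ^ x3"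
    using arg_cong[OF e1, of int] arg_cong[OF e2, of int] arg_cong[OF e3(1), of int] by simp_all
  have d: "int p dvd int c + int q ^ y1" "int p dvd int c + int q ^ (y1 + j)" "int p dvd int q ^ y3 - int c"
    using x e3(2) by (simp_all add: E)
  have "int p dvd (int c + int q ^ (y1 + j)) - (int c + int q ^ y1)" by (rule dvd_diff[OF d(2,1)])
  also have "\<dots> = int q ^ y1 * (int q ^ j - 1)" by (simp add: power_add algebra_simps)
  finally have "int p dvd int q ^ j - 1"
    using prime_dvd_power[OF pp, of "int q" y1] prime_ne_not_dvd[OF p(1) q] prime_dvd_mult_iff[OF pp] by blast
  then have qj: "[int q ^ j = 1] (mod int p)" by (simp add: cong_iff_dvd_diff)
  have "int p dvd (int c + int q ^ y1) + (int q ^ y3 - int c)" by (rule dvd_add[OF d(1,3)])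
  then have "[int q ^ y3 = - (int q ^ y1)] (mod int p)" by (simp add: cong_iff_dvd_diff add.commute)
  then have "[(int q ^ y3) ^ j = (- (int q ^ y1)) ^ j] (mod int p)" by (rule cong_pow)
  then have "[(int q ^ j) ^ y3 = - ((int q ^ j) ^ y1)] (mod int p)"
    using j by (simp add: mult.commute flip: power_mult)
  moreover have "[(int q ^ j) ^ y3 = 1 ^ y3] (mod int p)" "[- ((int q ^ j) ^ y1) = - (1 ^ y1)] (mod int p)"
    by (intro cong_pow qj cong_minus_minus_iff[THEN iffD2])+
  ultimately have "[1 = - 1] (mod int p)" by (metis cong_sym cong_trans power_one)
  then show False using odd_prime_not_dvd_2[OF p] by (simp add: cong_iff_dvd_diff)
qed

lemma opposite_sign:
  fixes p q c :: nat
  assumes p: "prime p" "odd p" and q: "prime q" "p \<noteq> q" and c: "c > 0"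
    and e1: "p ^ x1 = c + q ^ y1" and e2: "p ^ x2 = c + q ^ y2" and par: "odd (y1 + y2)"
    and e3: "q ^ y3 = c + p ^ x3" "x3 > 0"
  shows False
proof (cases "y1 \<le> y2")
  case True
  then show False using opposite_sign_ordered[OF p q c e1 _ _ e3, of x2 "y2 - y1"] e2 par by simp
next
  case False
  then show False using opposite_sign_ordered[OF p q c e2 _ _ e3, of x1 "y1 - y2"] e1 par by simp
qed

section \<open>A zero exponent and two solutions of the other sign\<close>

lemma odd_geom_sum: "odd (w::int) \<Longrightarrow> odd n \<Longrightarrow> odd (\<Sum>j<n. w ^ j)"
proof -
  assume w: "odd w" and n: "odd n"
  then have "[w = 1] (mod 2)" by (simp add: cong_iff_dvd_diff)
  then have "[(\<Sum>j<n. w ^ j) = (\<Sum>j<n. 1 ^ j)] (mod 2)"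
    by (intro cong_sum cong_pow)
  then show ?thesis using n by (simp add: cong_dvd_iff)
qed

text \<open>The quotient of \<open>w ^ n - 1\<close> by \<open>w - 1\<close> is a sum of an odd number of odd
terms.\<close>

lemma pow2_dvd_odd_power_iff:
  fixes w :: int
  assumes "odd w" "odd n"
  shows "2 ^ a dvd w ^ n - 1 \<longleftrightarrow> 2 ^ a dvd w - 1"
proof -
  have "coprime (2 ^ a) (\<Sum>j<n. w ^ j)" using odd_geom_sum[OF assms] by simp
  then show ?thesis by (simp add: power_diff_1_eq coprime_dvd_mult_left_iff)
qed

text \<open>If two powers of \<open>z\<close> are \<open>- 1\<close>, their exponents contain the same power
of 2, namely half the one in the order of \<open>z\<close>. This is one half of that statement;
the other half follows by symmetry.\<close>

lemma minus_one_power_valuation: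
  fixes p :: nat and z :: int
  assumes p: "prime p" "odd p"
    and "[z ^ (2 ^ s * u) = - 1] (mod int p)" "[z ^ (2 ^ t * v) = - 1] (mod int p)" "odd u" "odd v"
  shows "\<not> s < t"
proof
  assume "s < t"
  have "2 ^ s * u * (2 ^ (t - s) * v) = 2 ^ t * v * u"
    using \<open>s < t\<close> by (simp add: mult_ac flip: power_add)
  then have *: "(z ^ (2 ^ s * u)) ^ (2 ^ (t - s) * v) = (z ^ (2 ^ t * v)) ^ u"
    by (simp only: power_mult[symmetric])
  have "[(z ^ (2 ^ s * u)) ^ (2 ^ (t - s) * v) = (- 1) ^ (2 ^ (t - s) * v)] (mod int p)"
    by (rule cong_pow[OF assms(3)])
  moreover have "[(z ^ (2 ^ t * v)) ^ u = (- 1) ^ u] (mod int p)"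
    by (rule cong_pow[OF assms(4)])
  ultimately have "[(- 1) ^ (2 ^ (t - s) * v) = (- 1) ^ u] (mod int p)"
    unfolding * using cong_sym cong_trans by blast
  moreover have "even (2 ^ (t - s) * v)" using \<open>s < t\<close> by simp
  ultimately have "[1 = - 1] (mod int p)" using \<open>odd u\<close> by simp
  then show False using odd_prime_not_dvd_2[OF p] by (simp add: cong_iff_dvd_diff)
qed

lemma power2_times_odd:
  assumes "k > 0"
  obtains s u :: nat where "k = 2 ^ s * u" "odd u"
proof -
  obtain s where s: "2 ^ s dvd k" "\<not> 2 ^ (s + 1) dvd k" using exact_prime_power[OF assms two_is_prime_nat] .
  then obtain u where "k = 2 ^ s * u" by (auto elim: dvdE)
  moreover from this s(2) have "odd u" by (auto elim!: evenE)
  ultimately show ?thesis using that by blast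
qed

text \<open>Both \<open>q ^ y3\<close> and \<open>q ^ y4\<close> are \<open>- 1\<close> modulo
\<open>p\<close>, so \<open>y3\<close> and \<open>y4\<close> contain the same power of 2. Hence
\<open>q ^ y3 - 1\<close> and \<open>q ^ y4 - 1\<close> are odd multiples of the same number
\<open>w - 1\<close>, and their difference has more factors 2 than \<open>w - 1\<close>, which has
at least as many as \<open>p - 1\<close>. But since \<open>d\<close> is odd, the difference
\<open>p ^ x3 * (p ^ d - 1)\<close> has exactly as many as \<open>p - 1\<close>.\<close>

lemma zero_and_two_minus_ordered:
  fixes p q c :: nat
  assumes p: "prime p" "odd p" and q: "prime q" "odd q" and c: "c > 0"
    and e0: "p ^ x0 = c + 1"
    and e3: "q ^ y3 = c + p ^ x3" and e4: "q ^ y4 = c + p ^ (x3 + d)" and x3: "x3 > 0" and d: "odd d"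
  shows False
proof -
  have y: "y3 > 0" "y4 > 0" using exp_pos_of_eq e3 e4 p c by blast+
  have x0: "x0 > 0" using e0 c by (intro Nat.gr0I) simp
  have E: "int p ^ x0 = int c + 1" "int q ^ y3 = int c + int p ^ x3" "int q ^ y4 = int c + int p ^ (x3 + d)"
    using arg_cong[OF e0, of int] arg_cong[OF e3, of int] arg_cong[OF e4, of int] by simp_all
  obtain s u where su: "y3 = 2 ^ s * u" "odd u" using power2_times_odd[OF y(1)] .
  obtain t v where tv: "y4 = 2 ^ t * v" "odd v" using power2_times_odd[OF y(2)] .
  have "int p dvd int p ^ x0 + int p ^ x3" "int p dvd int p ^ x0 + int p ^ (x3 + d)"
    using x0 x3 by (auto intro!: dvd_add dvd_power)
  then have m: "[int q ^ y3 = - 1] (mod int p)" "[int q ^ y4 = - 1] (mod int p)"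
    unfolding E(2,3) by (simp_all add: E(1) cong_iff_dvd_diff add_ac)
  have st: "s = t"
    using minus_one_power_valuation[OF p, of "int q" s u t v] minus_one_power_valuation[OF p, of "int q" t v s u]
      m su tv by force
  \<comment> \<open>The odd parts \<open>u\<close> and \<open>v\<close> of the exponents do not change the power of 2 in \<open>w ^ u - 1\<close>.\<close>
  define w where "w = int q ^ (2 ^ s)"
  have w: "odd w" using q by (simp add: w_def)
  have Q: "int q ^ y3 = w ^ u" "int q ^ y4 = w ^ v"
    by (simp_all add: w_def su tv st power_mult)
  have p1: "p - 1 > 0" using p prime_gt_1_nat by simp
  obtain a where a: "2 ^ a dvd p - 1" "\<not> 2 ^ (a + 1) dvd p - 1" using exact_prime_power[OF p1 two_is_prime_nat] .
  have ai: "2 ^ a dvd int p - 1" "\<not> 2 ^ (a + 1) dvd int p - 1"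
  proof -
    have "int p - 1 = int (p - 1)" using p1 by simp
    then show "2 ^ a dvd int p - 1" "\<not> 2 ^ (a + 1) dvd int p - 1"
      using a by (metis int_dvd_int_iff of_nat_numeral of_nat_power)+
  qed
  have pd: "int p - 1 dvd int p ^ k - 1" for k by (simp add: power_diff_1_eq)
  have "int p - 1 dvd (int p ^ x0 - 1) + (int p ^ x3 - 1)" by (intro dvd_add pd)
  also have "\<dots> = w ^ u - 1" unfolding Q(1)[symmetric] E by simp
  finally have "2 ^ a dvd w ^ u - 1" using ai(1) dvd_trans by blast
  then have wa: "2 ^ a dvd w - 1" using pow2_dvd_odd_power_iff w su(2) by blast
  have "even ((\<Sum>j<v. w ^ j) - (\<Sum>j<u. w ^ j))" using odd_geom_sum w su(2) tv(2) by simp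
  then have "2 ^ a * 2 dvd (w - 1) * ((\<Sum>j<v. w ^ j) - (\<Sum>j<u. w ^ j))" using wa by (intro mult_dvd_mono)
  also have "\<dots> = (w ^ v - 1) - (w ^ u - 1)" unfolding power_diff_1_eq by (simp add: algebra_simps)
  also have "\<dots> = int p ^ x3 * (int p ^ d - 1)" unfolding Q[symmetric] E by (simp add: power_add algebra_simps)
  finally have "2 ^ (a + 1) dvd int p ^ x3 * (int p ^ d - 1)" by (simp add: mult.commute)
  moreover have "coprime (2 ^ (a + 1)) (int p ^ x3)" using p by simp
  ultimately have "2 ^ (a + 1) dvd int p ^ d - 1" by (simp add: coprime_dvd_mult_right_iff)
  then show False using pow2_dvd_odd_power_iff[of "int p" d "a + 1"] p d ai(2) by simp
qed

lemma zero_and_two_minus: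
  fixes p q c :: nat
  assumes p: "prime p" "odd p" and q: "prime q" "odd q" and c: "c > 0"
    and e0: "p ^ x0 = c + 1"
    and e3: "q ^ y3 = c + p ^ x3" and e4: "q ^ y4 = c + p ^ x4" and x: "x3 > 0" "x4 > 0" and d: "odd (x3 + x4)"
  shows False
proof (cases "x3 \<le> x4")
  case True
  then show False using zero_and_two_minus_ordered[OF p q c e0 e3 _ x(1), of y4 "x4 - x3"] e4 d by simp
next
  case False
  then show False using zero_and_two_minus_ordered[OF p q c e0 e4 _ x(2), of y3 "x3 - x4"] e3 d by simp
qed

section \<open>A zero exponent and an even exponent: excluding a third solution\<close>

lemma odd_power_cong:
  fixes z m :: int
  assumes "[z\<^sup>2 = 1] (mod m)" "odd y"
  shows "[z ^ y = z] (mod m)"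
proof -
  obtain i where i: "y = 2 * i + 1" using assms(2) by (auto elim: oddE)
  have "[(z\<^sup>2) ^ i * z = 1 ^ i * z] (mod m)" by (intro cong_mult cong_pow assms cong_refl)
  moreover have "z ^ y = (z\<^sup>2) ^ i * z" unfolding i power_add power_mult by simp
  ultimately show ?thesis by simp
qed

lemma even_power_cong:
  fixes z m :: int
  assumes "[z\<^sup>2 = 1] (mod m)" "even y"
  shows "[z ^ y = 1] (mod m)"
proof -
  obtain i where i: "y = 2 * i" using assms(2) by (auto elim: evenE)
  have "[(z\<^sup>2) ^ i = 1 ^ i] (mod m)" by (intro cong_pow assms)
  then show ?thesis by (simp add: i power_mult)
qed

lemma square_cong_4: "odd (z::int) \<Longrightarrow> [z\<^sup>2 = 1] (mod 4)"
  using odd_square_8[of z] by (metis cong_iff_dvd_diff dvd_trans dvd_triv_left mult_2_right numeral_Bit0)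

lemma square_cong_3: "\<not> 3 dvd (z::int) \<Longrightarrow> [z\<^sup>2 = 1] (mod 3)"
proof -
  assume "\<not> 3 dvd z"
  then have "3 dvd z - 1 \<or> 3 dvd z + 1" by presburger
  then have "3 dvd (z - 1) * (z + 1)" by auto
  then show ?thesis by (simp add: cong_iff_dvd_diff power2_eq_square algebra_simps)
qed

text \<open>An odd \<open>y\<close> is its own inverse modulo 4, the order of the multiplicative group modulo
5.\<close>

lemma odd_root_mod_5:
  fixes q :: nat
  assumes "\<not> 5 dvd q" "odd y" "[int q ^ y = s] (mod 5)"
  shows "[int q = s ^ y] (mod 5)"
proof -
  have "[q ^ (5 - 1) = 1] (mod 5)" using assms(1) by (intro fermat_theorem) auto
  then have "[int (q ^ 4) = int 1] (mod int 5)" by (simp only: cong_int_iff) simp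
  then have q4: "[int q ^ 4 = 1] (mod 5)" by simp
  obtain k where "y = 2 * k + 1" using assms(2) by (auto elim: oddE)
  then have y: "y * y = 4 * (k * k + k) + 1" by (simp add: algebra_simps)
  have "[(int q ^ 4) ^ (k * k + k) * int q = 1 ^ (k * k + k) * int q] (mod 5)"
    by (intro cong_mult cong_pow q4 cong_refl)
  also have "(int q ^ 4) ^ (k * k + k) * int q = (int q ^ y) ^ y"
    unfolding power_mult[symmetric] y by simp
  finally have "[int q = (int q ^ y) ^ y] (mod 5)" by (simp add: cong_sym)
  also have "[(int q ^ y) ^ y = s ^ y] (mod 5)" by (intro cong_pow assms)
  finally show ?thesis .
qed

lemma four_dvd_5_power: "4 dvd (5::int) ^ x - 1"
  by (simp add: power_diff_1_eq)

text \<open>The residues of the real part when the imaginary part is \<open>- 1\<close> and \<open>p =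
5\<close>. The one modulo 3 comes from \<open>(1 + i) ^ 3 = - 2 + 2 * i\<close> and \<open>(1 + i)
^ 4 = - 4\<close>: for \<open>n\<close> congruent to 3 modulo 4 the real and imaginary parts are
opposite.\<close>

lemma five_case_residues:
  fixes c :: nat
  assumes e0: "5 ^ x0 = c + 1" "odd x0" and n: "c dvd n + 1" and im: "qim 1 (int c) n = - 1"
  shows "[qre 1 (int c) n = 1] (mod 4)" "[qre 1 (int c) n = - 1] (mod 5)" "[qre 1 (int c) n = 1] (mod 3)"
proof -
  have E0: "int c = 5 ^ x0 - 1" using arg_cong[OF e0(1), of int] by simp
  have c4: "4 dvd int c" using power_diff_1_eq[of "5::int" x0] by (simp add: E0)
  show "[qre 1 (int c) n = 1] (mod 4)"
    using cong_dvd_modulus[OF qre_qim_cong(1)[of 1 "int c" n] c4] by simp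
  have "4 dvd n + 1" using c4 n by (metis dvd_trans int_dvd_int_iff of_nat_numeral)
  then have "n = 4 * ((n + 1) div 4 - 1) + 3" by presburger
  then obtain h where h: "n = 3 + 4 * h" by (metis add.commute)
  have x0: "x0 > 0" using e0(2) by (rule odd_pos)
  have five: "5 dvd 1\<^sup>2 + int c" using x0 by (simp add: E0)
  have "Suc (n - 1) = n" using h by simp
  then have "[qre 1 (int c) n = 1 * qim 1 (int c) n] (mod 5)"
    using cong_dvd_modulus[OF qre_qim_cong_norm(1)[of 1 "int c" "n - 1"] five] by (simp only:)
  then show "[qre 1 (int c) n = - 1] (mod 5)" by (simp add: im)
  have "[5 ^ x0 = 5] (mod (3::int))" by (intro odd_power_cong e0) (simp add: cong_iff_dvd_diff)
  then have "3 dvd (5 ^ x0 - 5) + (3::int)" by (simp only: cong_iff_dvd_diff dvd_add dvd_refl)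
  also have "(5 ^ x0 - 5) + 3 = int c - 1" by (simp add: E0)
  finally have "3 dvd int c - 1" .
  then obtain d where "int c - 1 = 3 * d" by (rule dvdE)
  then have d: "int c = 1 + 3 * d" by simp
  define r j where "r = qre 1 (int c) (4 * h)" and "j = qim 1 (int c) (4 * h)"
  have "qim 1 (int c) 4 = 4 - 4 * int c" by (simp add: eval_nat_numeral)
  also have "\<dots> = 3 * (- 4 * d)" unfolding d by simp
  finally have "3 dvd qim 1 (int c) 4" by simp
  then have j: "3 dvd j" unfolding j_def qre_qim_mult by simp
  have b: "qre 1 (int c) 3 = 1 - 3 * int c" "qim 1 (int c) 3 = 3 - int c"
    by (simp_all add: eval_nat_numeral)
  have "qre 1 (int c) n + qim 1 (int c) n = (1 - 3 * int c) * r - int c * (3 - int c) * j + ((1 - 3 * int c) * j + (3 - int c) * r)"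
    unfolding h qre_qim_add b r_def j_def ..
  also have "\<dots> = 3 * (- 4 * d * r) + j * ((1 - 3 * int c) - int c * (3 - int c))"
    unfolding d by (simp add: algebra_simps)
  finally have "3 dvd qre 1 (int c) n + qim 1 (int c) n" using j by simp
  then show "[qre 1 (int c) n = 1] (mod 3)" by (simp add: im cong_iff_dvd_diff)
qed

text \<open>In the case \<open>p = 5\<close> of \<open>zero_and_even_plus\<close>, the odd exponent
\<open>y2\<close> forces \<open>q\<close> to be 1 modulo 5. The real part is \<open>- 1\<close>
modulo 5, so it is \<open>- q ^ m\<close>. As it is also 1 modulo 4, \<open>q\<close> must be 3
modulo 4. But \<open>q ^ y2 - 1\<close> is a difference of two powers of 5, hence divisible by 4.
The case \<open>p = 3\<close> fails modulo 3.\<close>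

lemma zero_and_two_plus:
  fixes p q c :: nat
  assumes p: "prime p" "odd p" and q: "prime q" "odd q" "p \<noteq> q" and c: "c > 0"
    and e0: "p ^ x0 = c + 1" and e1: "p ^ x1 = c + q ^ y1" and y1: "even y1" "y1 > 0"
    and e2: "p ^ x2 = c + q ^ y2" and y2: "odd y2"
  shows False
proof -
  obtain m where m: "y1 = 2 * m" using y1 by (auto elim: evenE)
  have m0: "m > 0" using m y1 by simp
  have "even c" using e0 p by (metis even_plus_one_iff even_power)
  have "q ^ m > 1" using one_less_power[OF prime_gt_1_nat[OF q(1)] m0] .
  have x2: "x2 > 0" using exp_pos_of_eq[OF e2 q(1) c] .
  have x0: "x0 > 0" using e0 c by (intro Nat.gr0I) simp
  have E: "int p ^ x0 = int c + 1" "int p ^ x2 = int c + int q ^ y2"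
    using arg_cong[OF e0, of int] arg_cong[OF e2, of int] by simp_all
  have "p ^ x1 = c + (q ^ m)\<^sup>2" using e1 by (simp add: m power_even_eq)
  from zero_and_even_plus[OF p \<open>even c\<close> c \<open>q ^ m > 1\<close> e0 this]
  consider (three) "p = 3" "c = 2" "q ^ m = 5"
    | (five) n where "p = 5" "odd x0" "c dvd n + 1" "\<bar>qre 1 (int c) n\<bar> = int (q ^ m)" "qim 1 (int c) n = - 1"
    by blast
  then show False
  proof cases
    case three
    have "q dvd 5" using three(3) m0 by (metis dvd_power)
    then have "q = 5" using q primes_dvd_imp_eq[of q 5] by simp
    have "[5 ^ y2 = 5] (mod (3::int))" by (intro odd_power_cong y2) (simp add: cong_iff_dvd_diff)
    then have "3 dvd 5 ^ y2 - (5::int)" by (simp only: cong_iff_dvd_diff)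
    then have "3 dvd (5 ^ y2 - 5) + (6::int)" by (rule dvd_add) simp
    moreover have "3 dvd (2 + 5 ^ y2 :: int)" using E(2) three \<open>q = 5\<close> x2 by (metis dvd_power of_nat_numeral)
    ultimately have "3 dvd (2 + 5 ^ y2) - ((5 ^ y2 - 5) + (6::int))" by (intro dvd_diff)
    then show False by simp
  next
    case five
    have "5 ^ x0 = c + 1" using e0 five by simp
    note R = five_case_residues[OF this five(2,3,5)]
    have D: "int q ^ y2 - 1 = 5 ^ x2 - 5 ^ x0" using E five(1) by simp
    have "[int q ^ y2 = 1] (mod 5)" unfolding cong_iff_dvd_diff D using x0 x2 by (simp add: dvd_diff)
    then have "[int q = 1 ^ y2] (mod 5)"
      using q five p primes_dvd_imp_eq[of 5 q] by (intro odd_root_mod_5 y2) auto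
    then have "[int q ^ m = 1 ^ m] (mod 5)" by (intro cong_pow) simp
    then have q5: "[int q ^ m = 1] (mod 5)" by simp
    have "qre 1 (int c) n \<noteq> int q ^ m"
    proof
      assume "qre 1 (int c) n = int q ^ m"
      then have "[1 = - 1] (mod (5::int))" using q5 R(2) by (metis cong_sym cong_trans)
      then show False by (simp add: cong_iff_dvd_diff)
    qed
    then have "qre 1 (int c) n = - (int q ^ m)" using five(4) by (simp add: abs_if split: if_splits)
    then have qm4: "[- (int q ^ m) = 1] (mod 4)" using R(1) by simp
    have D4: "4 dvd int q ^ y2 - 1"
    proof -
      have "4 dvd (5 ^ x2 - 1) - (5 ^ x0 - 1 :: int)"
        by (rule dvd_diff[OF four_dvd_5_power four_dvd_5_power])
      then show ?thesis by (simp add: D)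
    qed
    have "[int q ^ y2 = int q] (mod 4)" using q by (intro odd_power_cong y2 square_cong_4) simp
    then have "[int q = 1] (mod 4)" using D4 by (metis cong_iff_dvd_diff cong_sym cong_trans)
    then have "[int q ^ m = 1 ^ m] (mod 4)" by (rule cong_pow)
    then have "[- (int q ^ m) = - 1] (mod 4)" by (simp add: cong_minus_minus_iff)
    then have "[1 = - 1] (mod (4::int))" using qm4 by (metis cong_sym cong_trans)
    then show False by (simp add: cong_iff_dvd_diff)
  qed
qed

text \<open>In the case \<open>p = 5\<close> of \<open>zero_and_even_plus\<close>, the minus solution shows
that \<open>y3\<close> is odd and that \<open>q\<close> is \<open>- 1\<close> modulo 3, 1 modulo 4
and \<open>- 1\<close> modulo 5. By its residue modulo 4 the real part is \<open>q ^ m\<close>;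
its residue modulo 3 then makes \<open>m\<close> even, and its residue modulo 5 makes
\<open>m\<close> odd.\<close>

lemma zero_plus_and_minus:
  fixes p q c :: nat
  assumes p: "prime p" "odd p" and q: "prime q" "odd q" "p \<noteq> q" and c: "c > 0"
    and e0: "p ^ x0 = c + 1" and e1: "p ^ x1 = c + q ^ y1" and y1: "y1 > 0"
    and e3: "q ^ y3 = c + p ^ x3" and x3: "x3 > 0"
  shows "p = 3 \<and> q = 5 \<and> c = 2"
proof -
  have "even y1"
  proof (rule ccontr)
    assume "odd y1"
    then show False using opposite_sign[OF p q(1,3) c _ e1 _ e3 x3, of x0 0] e0 by simp
  qed
  then obtain m where m: "y1 = 2 * m" by (auto elim: evenE)
  have m0: "m > 0" using m y1 by simp
  have "even c" using e0 p by (metis even_plus_one_iff even_power)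
  have "q ^ m > 1" using one_less_power[OF prime_gt_1_nat[OF q(1)] m0] .
  have x0: "x0 > 0" using e0 c by (intro Nat.gr0I) simp
  have E: "int p ^ x0 = int c + 1" "int q ^ y3 = int c + int p ^ x3"
    using arg_cong[OF e0, of int] arg_cong[OF e3, of int] by simp_all
  have "p ^ x1 = c + (q ^ m)\<^sup>2" using e1 by (simp add: m power_even_eq)
  from zero_and_even_plus[OF p \<open>even c\<close> c \<open>q ^ m > 1\<close> e0 this]
  consider (three) "p = 3" "c = 2" "q ^ m = 5"
    | (five) n where "p = 5" "odd x0" "c dvd n + 1" "\<bar>qre 1 (int c) n\<bar> = int (q ^ m)" "qim 1 (int c) n = - 1"
    by blast
  then show ?thesis
  proof cases
    case three
    have "q dvd 5" using three(3) m0 by (metis dvd_power)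
    then have "q = 5" using q primes_dvd_imp_eq[of q 5] by simp
    then show ?thesis using three by simp
  next
    case five
    have "5 ^ x0 = c + 1" using e0 five by simp
    note R = five_case_residues[OF this five(2,3,5)]
    have sgn: "qre 1 (int c) n = int q ^ m \<or> qre 1 (int c) n = - (int q ^ m)"
      using five(4) by (simp add: abs_if split: if_splits)
    have D: "int q ^ y3 + 1 = 5 ^ x0 + 5 ^ x3" using E five(1) by simp
    have q3: "\<not> 3 dvd int q"
    proof
      assume "3 dvd int q"
      then have "3 dvd qre 1 (int c) n" using sgn m0 by (auto intro: dvd_trans dvd_power)
      then have "3 dvd (1::int)" using R(3) cong_dvd_iff by blast
      then show False by simp
    qed
    have f3: "[(5::int)\<^sup>2 = 1] (mod 3)" by (simp add: cong_iff_dvd_diff)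
    have "[5 ^ x0 = 5] (mod (3::int))" by (rule odd_power_cong[OF f3 five(2)])
    then have a0: "3 dvd 5 ^ x0 - (5::int)" by (simp only: cong_iff_dvd_diff)
    have "even x3"
    proof (rule ccontr)
      assume "odd x3"
      then have "[5 ^ x3 = 5] (mod (3::int))" by (rule odd_power_cong[OF f3])
      then have *: "3 dvd 5 ^ x3 - (5::int)" by (simp only: cong_iff_dvd_diff)
      have "3 dvd (5 ^ x3 - 5) + (5 ^ x0 - 5) + (9 :: int)" by (intro dvd_add a0 *) simp
      also have "\<dots> = int q ^ y3" using D by simp
      finally have "3 dvd int q" by (rule prime_dvd_power[rotated]) simp
      then show False using q3 by simp
    qed
    then have "[5 ^ x3 = 1] (mod (3::int))" by (rule even_power_cong[OF f3])
    then have *: "3 dvd 5 ^ x3 - (1::int)" by (simp only: cong_iff_dvd_diff)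
    have "3 dvd (5 ^ x3 - 1) + (5 ^ x0 - 5) + (6 :: int)" by (intro dvd_add a0 *) simp
    also have "\<dots> = int q ^ y3 - (- 1)" using D by simp
    finally have qy3: "[int q ^ y3 = - 1] (mod 3)" by (simp only: cong_iff_dvd_diff)
    have "odd y3"
    proof
      assume "even y3"
      then have "[int q ^ y3 = 1] (mod 3)" by (rule even_power_cong[OF square_cong_3[OF q3]])
      then have "[1 = - 1] (mod (3::int))" using qy3 by (metis cong_sym cong_trans)
      then show False by (simp add: cong_iff_dvd_diff)
    qed
    have "[int q ^ y3 = int q] (mod 3)" by (rule odd_power_cong[OF square_cong_3[OF q3] \<open>odd y3\<close>])
    then have qm3: "[int q = - 1] (mod 3)" using qy3 by (metis cong_sym cong_trans)
    have "4 dvd (5 ^ x0 - 1) + (5 ^ x3 - 1 :: int)"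
      by (rule dvd_add[OF four_dvd_5_power four_dvd_5_power])
    also have "\<dots> = int q ^ y3 - 1" using D by simp
    finally have "[int q ^ y3 = 1] (mod 4)" by (simp only: cong_iff_dvd_diff)
    moreover have "[int q ^ y3 = int q] (mod 4)" using q by (intro odd_power_cong \<open>odd y3\<close> square_cong_4) simp
    ultimately have "[int q = 1] (mod 4)" by (metis cong_sym cong_trans)
    then have "[int q ^ m = 1 ^ m] (mod 4)" by (rule cong_pow)
    then have q4: "[- (int q ^ m) = - 1] (mod 4)" by (simp add: cong_minus_minus_iff)
    have "qre 1 (int c) n \<noteq> - (int q ^ m)"
    proof
      assume "qre 1 (int c) n = - (int q ^ m)"
      then have "[1 = - 1] (mod (4::int))" using q4 R(1) by (metis cong_sym cong_trans)
      then show False by (simp add: cong_iff_dvd_diff)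
    qed
    then have re: "qre 1 (int c) n = int q ^ m" using sgn by simp
    have "even m"
    proof (rule ccontr)
      assume "odd m"
      then have "[int q ^ m = (- 1)] (mod 3)" using cong_pow[OF qm3, of m] by simp
      then have "[1 = - 1] (mod (3::int))" using R(3) re by (metis cong_sym cong_trans)
      then show False by (simp add: cong_iff_dvd_diff)
    qed
    have "5 dvd 5 ^ x0 + (5 ^ x3 :: int)" using x0 x3 by (simp add: dvd_add)
    then have "[int q ^ y3 = - 1] (mod 5)" unfolding cong_iff_dvd_diff using D by simp
    then have "[int q = (- 1) ^ y3] (mod 5)"
      using q five p primes_dvd_imp_eq[of 5 q] by (intro odd_root_mod_5 \<open>odd y3\<close>) auto
    then have "[int q ^ m = ((- 1) ^ y3) ^ m] (mod 5)" by (rule cong_pow)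
    then have "[int q ^ m = 1] (mod 5)" using \<open>odd y3\<close> \<open>even m\<close> by simp
    then have "[1 = - 1] (mod (5::int))" using R(2) re by (metis cong_sym cong_trans)
    then show ?thesis by (simp add: cong_iff_dvd_diff)
  qed
qed


section \<open>Counting solutions\<close>

lemma mem_solutions_iff:
  "c > 0 \<Longrightarrow> (x, y) \<in> solutions p q c \<longleftrightarrow> p ^ x = c + q ^ y \<or> q ^ y = c + p ^ x"
proof -
  assume "c > 0"
  have "\<bar>int p ^ x - int q ^ y\<bar> = int c \<longleftrightarrow> int (p ^ x) = int (c + q ^ y) \<or> int (q ^ y) = int (c + p ^ x)"
    by (simp add: abs_if; linarith)
  then show ?thesis by (simp only: of_nat_eq_iff solutions_def mem_Collect_eq prod.case)
qed

lemma card_le_2_if_no_three: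
  assumes "\<And>a b d. a \<in> S \<Longrightarrow> b \<in> S \<Longrightarrow> d \<in> S \<Longrightarrow> a \<noteq> b \<Longrightarrow> a \<noteq> d \<Longrightarrow> b \<noteq> d \<Longrightarrow> False"
  shows "finite S \<and> card S \<le> 2"
proof (rule ccontr)
  assume "\<not> (finite S \<and> card S \<le> 2)"
  then obtain T where T: "T \<subseteq> S" "card T = 3"
    by (metis infinite_arbitrarily_large not_less_eq_eq numeral_3_eq_3 numeral_2_eq_2 obtain_subset_with_card_n)
  then obtain a b d where "T = {a, b, d}" "a \<noteq> b" "a \<noteq> d" "b \<noteq> d"
    by (metis card_3_iff)
  then show False using assms[of a b d] T by blast
qed

text \<open>Within one kind of solutions either exponent determines the other, so the solutions can be ordered
by one exponent and three of them split into the four cases of the hypotheses.\<close>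

lemma card_solutions_le_2:
  fixes p q c :: nat
  assumes pq: "p > 1" "q > 1" and c: "c > 0"
    and PPP: "\<And>x1 y1 x2 y2 x3 y3. p ^ x1 = c + q ^ y1 \<Longrightarrow> p ^ x2 = c + q ^ y2 \<Longrightarrow> p ^ x3 = c + q ^ y3 \<Longrightarrow>
      y1 < y2 \<Longrightarrow> y2 < y3 \<Longrightarrow> False"
    and MMM: "\<And>x1 y1 x2 y2 x3 y3. q ^ y1 = c + p ^ x1 \<Longrightarrow> q ^ y2 = c + p ^ x2 \<Longrightarrow> q ^ y3 = c + p ^ x3 \<Longrightarrow>
      x1 < x2 \<Longrightarrow> x2 < x3 \<Longrightarrow> False"
    and PPM: "\<And>x1 y1 x2 y2 x3 y3. p ^ x1 = c + q ^ y1 \<Longrightarrow> p ^ x2 = c + q ^ y2 \<Longrightarrow> q ^ y3 = c + p ^ x3 \<Longrightarrow>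
      y1 < y2 \<Longrightarrow> False"
    and MMP: "\<And>x1 y1 x2 y2 x3 y3. q ^ y1 = c + p ^ x1 \<Longrightarrow> q ^ y2 = c + p ^ x2 \<Longrightarrow> p ^ x3 = c + q ^ y3 \<Longrightarrow>
      x1 < x2 \<Longrightarrow> False"
  shows "finite (solutions p q c) \<and> card (solutions p q c) \<le> 2"
proof (rule card_le_2_if_no_three)
  fix a b d :: "nat \<times> nat"
  assume m: "a \<in> solutions p q c" "b \<in> solutions p q c" "d \<in> solutions p q c" and ne: "a \<noteq> b" "a \<noteq> d" "b \<noteq> d"
  define P where "P z \<longleftrightarrow> p ^ fst z = c + q ^ snd z" for z
  define N where "N z \<longleftrightarrow> q ^ snd z = c + p ^ fst z" for z
  have PN: "P z \<or> N z" if "z \<in> solutions p q c" for z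
    using that mem_solutions_iff[OF c, of "fst z" "snd z" p q] by (simp add: P_def N_def)
  have Pd: "snd z \<noteq> snd z'" if "P z" "P z'" "z \<noteq> z'" for z z'
  proof
    assume "snd z = snd z'"
    then have "p ^ fst z = p ^ fst z'" using that by (simp add: P_def)
    then have "fst z = fst z'" using pq by (simp only: power_inject_exp)
    then show False using \<open>snd z = snd z'\<close> that(3) by (simp add: prod_eq_iff)
  qed
  have Nd: "fst z \<noteq> fst z'" if "N z" "N z'" "z \<noteq> z'" for z z'
  proof
    assume "fst z = fst z'"
    then have "q ^ snd z = q ^ snd z'" using that by (simp add: N_def)
    then have "snd z = snd z'" using pq by (simp only: power_inject_exp)
    then show False using \<open>fst z = fst z'\<close> that(3) by (simp add: prod_eq_iff)
  qed
  have 1: False if "P u" "P v" "P w" "snd u < snd v" "snd v < snd w" for u v w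
    using PPP that unfolding P_def by blast
  have 2: False if "N u" "N v" "N w" "fst u < fst v" "fst v < fst w" for u v w
    using MMM that unfolding N_def by blast
  have 3: False if "P u" "P v" "N w" "u \<noteq> v" for u v w
    using PPM[of "fst u" "snd u" "fst v" "snd v" "snd w" "fst w"] PPM[of "fst v" "snd v" "fst u" "snd u" "snd w" "fst w"]
      that Pd[of u v] unfolding P_def N_def by linarith
  have 4: False if "N u" "N v" "P w" "u \<noteq> v" for u v w
    using MMP[of "snd u" "fst u" "snd v" "fst v" "fst w" "snd w"] MMP[of "snd v" "fst v" "snd u" "fst u" "fst w" "snd w"]
      that Nd[of u v] unfolding P_def N_def by linarith
  consider "P a" "P b" "P d" | "N a" "N b" "N d"
    using PN[OF m(1)] PN[OF m(2)] PN[OF m(3)] 3 4 ne by metis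
  then show False
  proof cases
    case 1
    then show False using Pd[of a b] Pd[of a d] Pd[of b d] ne \<open>\<And>w v u. \<lbrakk>P u; P v; P w; snd u < snd v; snd v < snd w\<rbrakk> \<Longrightarrow> False\<close>
      by (meson nat_neq_iff)
  next
    case 2
    then show False using Nd[of a b] Nd[of a d] Nd[of b d] ne \<open>\<And>w v u. \<lbrakk>N u; N v; N w; fst u < fst v; fst v < fst w\<rbrakk> \<Longrightarrow> False\<close>
      by (meson nat_neq_iff)
  qed
qed

section \<open>Two odd primes\<close>

lemma even_if_odd_bases:
  fixes p q c :: nat
  assumes "odd p" "odd q" "p ^ x = c + q ^ y"
  shows "even c"
  using assms by (metis even_add even_power)

lemma thirteen_mod_4: "13 ^ x = 10 + (3::nat) ^ y \<Longrightarrow> odd y"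
proof (rule ccontr)
  assume e: "13 ^ x = 10 + (3::nat) ^ y" and "\<not> odd y"
  have "[3 ^ y = 1] (mod (4::int))"
    by (rule even_power_cong[OF square_cong_4]) (use \<open>\<not> odd y\<close> in simp_all)
  then have "4 dvd 3 ^ y - (1::int)" by (simp only: cong_iff_dvd_diff)
  moreover have "13 ^ x = 10 + (3::int) ^ y" using arg_cong[OF e, of int] by simp
  moreover have "4 dvd 13 ^ x - (1::int)" using power_diff_1_eq[of "13::int" x] by simp
  ultimately show False by presburger
qed

text \<open>If all three exponents \<open>y\<close> are positive, two have the same parity. Otherwise
\<open>y1 = 0\<close>, and the other two have different parity, so that one of them is even and
the other is odd.\<close>

lemma no_three_plus_odd:
  fixes p q c :: nat
  assumes p: "prime p" "odd p" and q: "prime q" "odd q" "p \<noteq> q" and c: "c > 1"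
    and e: "p ^ x1 = c + q ^ y1" "p ^ x2 = c + q ^ y2" "p ^ x3 = c + q ^ y3" and y: "y1 < y2" "y2 < y3"
  shows False
proof -
  have c0: "c > 0" using c by simp
  have same: "q = 3 \<and> v = 1 \<and> p = 13 \<and> c = 10"
    if "p ^ u = c + q ^ v" "p ^ u' = c + q ^ v'" "0 < v" "v < v'" "even (v + v')" for u v u' v'
  proof -
    define k where "k = (v' - v) div 2"
    have "v' = v + 2 * k" "k > 0" using that unfolding k_def by presburger+
    then show ?thesis using same_parity_solutions[OF p q(1) q(3)[symmetric] c, of u v u' k] that by simp
  qed
  have "odd (y2 + y3)"
  proof (rule ccontr)
    assume "\<not> odd (y2 + y3)"
    then have s: "q = 3" "y2 = 1" "p = 13" "c = 10" using same[OF e(2,3)] y by auto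
    then have "13 ^ x1 = (11::nat)" using e(1) y by simp
    moreover have "x1 > 0" using exp_pos_of_eq[OF e(1) q(1) c0] .
    ultimately have "13 dvd (11::nat)" by (metis dvd_power)
    then show False by simp
  qed
  then have par: "even (y1 + y2) \<or> even (y1 + y3)" by presburger
  show False
  proof (cases "y1 = 0")
    case True
    then have e0: "p ^ x1 = c + 1" using e(1) by simp
    show False
    proof (cases "even y2")
      case True
      then show False using zero_and_two_plus[OF p q c0 e0 e(2) _ _ e(3)] y \<open>odd (y2 + y3)\<close> by simp
    next
      case False
      then show False using zero_and_two_plus[OF p q c0 e0 e(3) _ _ e(2)] y \<open>odd (y2 + y3)\<close> by simp
    qed
  next
    case False
    then have "q = 3 \<and> y1 = 1 \<and> p = 13 \<and> c = 10"
      using par same[OF e(1,2)] same[OF e(1,3)] y by auto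
    then have "odd y2" "odd y3" using e thirteen_mod_4 by auto
    then show False using \<open>odd (y2 + y3)\<close> by simp
  qed
qed

text \<open>If the zero exponent is absent, \<open>opposite_sign\<close> and
\<open>same_parity_solutions\<close> apply. It can occur in a plus solution, with the other one
even (\<open>zero_plus_and_minus\<close>), or in the minus solution; then the roles of the primes
are exchanged in \<open>zero_and_two_minus\<close>.\<close>

lemma two_plus_one_minus_odd:
  fixes p q c :: nat
  assumes p: "prime p" "odd p" and q: "prime q" "odd q" "p \<noteq> q" and c: "c > 1"
    and e: "p ^ x1 = c + q ^ y1" "p ^ x2 = c + q ^ y2" "q ^ y3 = c + p ^ x3" and y: "y1 < y2"
  shows "p = 3 \<and> q = 5 \<and> c = 2"
proof -
  have c0: "c > 0" using c by simp
  have y3: "y3 > 0" using exp_pos_of_eq[OF e(3) p(1) c0] .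
  have same: "q = 3 \<and> y1 = 1 \<and> p = 13 \<and> c = 10" if "y1 > 0" "even (y1 + y2)"
  proof -
    define k where "k = (y2 - y1) div 2"
    have "y2 = y1 + 2 * k" "k > 0" using that y unfolding k_def by presburger+
    then show ?thesis using same_parity_solutions[OF p q(1) q(3)[symmetric] c, of x1 y1 x2 k] that e by simp
  qed
  show ?thesis
  proof (cases "x3 = 0")
    case False
    then have x3: "x3 > 0" by simp
    show ?thesis
    proof (cases "even (y1 + y2)")
      case False
      then show ?thesis using opposite_sign[OF p q(1,3) c0 e(1,2) _ e(3) x3] by simp
    next
      case True
      show ?thesis
      proof (cases "y1 = 0")
        case True
        then show ?thesis using zero_plus_and_minus[OF p q c0 _ e(2) _ e(3) x3] e(1) y by simp
      next
        case False
        then have s: "q = 3" "p = 13" "c = 10" using same True by auto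
        \<comment> \<open>A power of 3 is 1, 3 or 9 modulo 13, never 10.\<close>
        obtain i r where ir: "y3 = 3 * i + r" "r < 3" by (metis mod_less_divisor mult_div_mod_eq zero_less_numeral)
        have "[27 ^ i * 3 ^ r = 1 ^ i * 3 ^ r] (mod (13::nat))"
          by (intro cong_mult cong_pow) (simp_all add: cong_def)
        moreover have "[10 + 13 ^ x3 = 10 + 0] (mod (13::nat))" using x3
          by (intro cong_add) (simp_all add: cong_0_iff)
        moreover have "27 ^ i * 3 ^ r = 10 + (13::nat) ^ x3" using e(3) s by (simp add: ir power_add power_mult)
        ultimately have "[3 ^ r = 10] (mod (13::nat))" by (simp add: cong_def)
        moreover have "r = 0 \<or> r = 1 \<or> r = 2" using ir by auto
        ultimately show ?thesis by (auto simp: cong_def)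
      qed
    qed
  next
    case True
    then have e0: "q ^ y3 = c + 1" using e(3) by simp
    have "y1 \<noteq> 0"
    proof
      assume "y1 = 0"
      then have "p ^ x1 = q ^ y3" using e0 e(1) by simp
      then have "p dvd q ^ y3" using exp_pos_of_eq[OF e(1) q(1) c0] by (metis dvd_power)
      then show False using p q primes_dvd_imp_eq prime_dvd_power by blast
    qed
    show ?thesis
    proof (cases "even (y1 + y2)")
      case False
      then show ?thesis using zero_and_two_minus[OF q(1,2) p c0 e0 e(1,2)] \<open>y1 \<noteq> 0\<close> y by simp
    next
      case True
      then have s: "q = 3" "p = 13" "c = 10" using same \<open>y1 \<noteq> 0\<close> by auto
      then have "3 ^ y3 = (11::nat)" using e0 by simp
      then have "3 dvd (11::nat)" using y3 by (metis dvd_power)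
      then show ?thesis by simp
    qed
  qed
qed

lemma odd_primes_case:
  fixes p q c :: nat
  assumes p: "prime p" "odd p" and q: "prime q" "odd q" "p \<noteq> q" and c: "c > 0"
    and ex: "(p, q, c) \<noteq> (3, 5, 2)" "(q, p, c) \<noteq> (3, 5, 2)"
  shows "finite (solutions p q c) \<and> card (solutions p q c) \<le> 2"
proof (rule card_solutions_le_2[OF prime_gt_1_nat[OF p(1)] prime_gt_1_nat[OF q(1)] c])
  have P: "c > 1" if "p ^ x = c + q ^ y" for x y using even_if_odd_bases[OF p(2) q(2) that] c by (cases "c = 1") auto
  have M: "c > 1" if "q ^ y = c + p ^ x" for x y using even_if_odd_bases[OF q(2) p(2) that] c by (cases "c = 1") auto
  note q' = q(1,2) and p' = p q(3)[symmetric]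
  show False if "p ^ x1 = c + q ^ y1" "p ^ x2 = c + q ^ y2" "p ^ x3 = c + q ^ y3" "y1 < y2" "y2 < y3" for x1 y1 x2 y2 x3 y3
    using no_three_plus_odd[OF p q P that] that by blast
  show False if "q ^ y1 = c + p ^ x1" "q ^ y2 = c + p ^ x2" "q ^ y3 = c + p ^ x3" "x1 < x2" "x2 < x3" for x1 y1 x2 y2 x3 y3
    using no_three_plus_odd[OF q' p' M that] that by blast
  show False if "p ^ x1 = c + q ^ y1" "p ^ x2 = c + q ^ y2" "q ^ y3 = c + p ^ x3" "y1 < y2" for x1 y1 x2 y2 x3 y3
    using two_plus_one_minus_odd[OF p q P[OF that(1)] that] ex by simp
  show False if "q ^ y1 = c + p ^ x1" "q ^ y2 = c + p ^ x2" "p ^ x3 = c + q ^ y3" "x1 < x2" for x1 y1 x2 y2 x3 y3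
    using two_plus_one_minus_odd[OF q' p' M[OF that(1)] that] ex by simp
qed

section \<open>Lucas sequences and norms that are powers of 2\<close>

text \<open>If \<open>w = (A + sqrt (A\<^sup>2 - 4 * R)) / 2\<close>, then \<open>w ^ n\<close> is half of
\<open>V + lucas A R n * sqrt (A\<^sup>2 - 4 * R)\<close> with \<open>V = 2 * lucas A R (n + 1) -
A * lucas A R n\<close>. The half-integral elements are needed when the norm \<open>R\<close> is a
power of 2 and \<open>A\<close> is odd.\<close>

fun lucas :: "int \<Rightarrow> int \<Rightarrow> nat \<Rightarrow> int" where
  "lucas A R 0 = 0"
| "lucas A R (Suc 0) = 1"
| "lucas A R (Suc (Suc n)) = A * lucas A R (Suc n) - R * lucas A R n"

text \<open>The norm of \<open>w ^ n\<close>, times 4.\<close>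

lemma lucas_norm:
  "(2 * lucas A R (Suc n) - A * lucas A R n)\<^sup>2 + (4 * R - A\<^sup>2) * (lucas A R n)\<^sup>2 = 4 * R ^ n"
proof -
  have "(lucas A R (Suc n))\<^sup>2 - A * lucas A R (Suc n) * lucas A R n + R * (lucas A R n)\<^sup>2 = R ^ n"
  proof (induction n)
    case (Suc n)
    have "(lucas A R (Suc (Suc n)))\<^sup>2 - A * lucas A R (Suc (Suc n)) * lucas A R (Suc n) + R * (lucas A R (Suc n))\<^sup>2
      = R * ((lucas A R (Suc n))\<^sup>2 - A * lucas A R (Suc n) * lucas A R n + R * (lucas A R n)\<^sup>2)"
      by (simp add: power2_eq_square algebra_simps)
    then show ?case by (simp only: Suc power_Suc)
  qed simp
  then have "4 * R ^ n = 4 * ((lucas A R (Suc n))\<^sup>2 - A * lucas A R (Suc n) * lucas A R n + R * (lucas A R n)\<^sup>2)"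
    by simp
  then show ?thesis by (simp add: power2_eq_square algebra_simps)
qed

lemma lucas_odd:
  assumes "odd A" "even R"
  shows "odd (lucas A R (Suc n))"
proof (induction n)
  case (Suc n)
  then show ?case using assms by simp
qed simp

text \<open>Doubling \<open>w\<close> leads back to \<open>A + sqrt (- M)\<close>, so that lifting the
exponent applies.\<close>

lemma qim_eq_lucas:
  assumes "A\<^sup>2 + M = 4 * R"
  shows "2 * qim A M n = 2 ^ n * lucas A R n"
proof (induction n rule: less_induct)
  case (less n)
  consider "n = 0" | "n = 1" | k where "n = Suc (Suc k)"
    by (metis One_nat_def not0_implies_Suc)
  then show ?case
  proof cases
    case 3
    have "qim A M (Suc (Suc k)) = 2 * A * qim A M (Suc k) - (A\<^sup>2 + M) * qim A M k"
      by (simp add: power2_eq_square algebra_simps)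
    then have "2 * qim A M n = 2 * A * (2 * qim A M (Suc k)) - (4 * R) * (2 * qim A M k)"
      by (simp add: 3 assms)
    also have "\<dots> = 2 * A * (2 ^ Suc k * lucas A R (Suc k)) - (4 * R) * (2 ^ k * lucas A R k)"
      using less[of "Suc k"] less[of k] 3 by simp
    also have "\<dots> = 2 ^ n * lucas A R n" by (simp add: 3 algebra_simps)
    finally show ?thesis .
  qed simp_all
qed

lemma lucas_cong: "[lucas A R (Suc n) = A ^ n] (mod R)"
proof (induction n)
  case (Suc n)
  have "[A * lucas A R (Suc n) - R * lucas A R n = A * A ^ n - 0] (mod R)"
    by (intro cong_diff cong_mult Suc cong_refl) (simp add: cong_0_iff)
  then show ?case by simp
qed simp

lemma lucas_one_cong:
  assumes "even Q"
  shows "2 * Q dvd lucas 1 Q (n + 2) - (1 - int n * Q)"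
proof (induction n rule: less_induct)
  case (less n)
  have Q: "2 * Q dvd Q * Q" using assms by simp
  consider "n = 0" | "n = 1" | k where "n = Suc (Suc k)"
    by (metis One_nat_def not0_implies_Suc)
  then show ?case
  proof cases
    case 3
    obtain s where s: "lucas 1 Q (Suc k + 2) = (1 - int (Suc k) * Q) + 2 * Q * s"
      using less[of "Suc k"] 3 by (metis dvdE add.commute diff_add_cancel lessI)
    obtain t where t: "lucas 1 Q (k + 2) = (1 - int k * Q) + 2 * Q * t"
      using less[of k] 3 by (metis dvdE add.commute diff_add_cancel lessI less_Suc_eq)
    have "lucas 1 Q (n + 2) = lucas 1 Q (Suc k + 2) - Q * lucas 1 Q (k + 2)" by (simp add: 3)
    then have "lucas 1 Q (n + 2) - (1 - int n * Q) = 2 * Q * (s - Q * t) + Q * Q * int k"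
      unfolding s t by (simp add: 3 algebra_simps)
    then show ?thesis using Q by (simp add: dvd_add)
  qed (simp_all add: numeral_2_eq_2 numeral_3_eq_3)
qed

text \<open>The elements \<open>(A + sqrt (- M)) / 2\<close> and \<open>(B + w * sqrt (- M)) / 2\<close> have
norms \<open>2 ^ i\<close> and \<open>2 ^ j\<close>. Raised to the powers \<open>j\<close> and
\<open>i\<close> they have the same norm.\<close>

lemma lucas_norm_unique:
  fixes A B :: int
  assumes "odd A" "odd B" and R: "A\<^sup>2 + M = 2 ^ (i + 2)" "B\<^sup>2 + M * w\<^sup>2 = 2 ^ (j + 2)"
    and M: "M \<ge> 1" and w: "odd w" and ij: "i > 0" "j > 0"
  shows "(lucas A (2 ^ i) j)\<^sup>2 = (w * lucas B (2 ^ j) i)\<^sup>2"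
proof (rule norm_form_unique_two[OF M, where s = "i * j + 2"])
  obtain i' j' where ij': "i = Suc i'" "j = Suc j'" using ij by (meson gr0_implies_Suc)
  have M': "4 * 2 ^ i - A\<^sup>2 = M" "4 * 2 ^ j - B\<^sup>2 = M * w\<^sup>2" using R by (simp_all add: power_add)
  show "(2 * lucas A (2 ^ i) (Suc j) - A * lucas A (2 ^ i) j)\<^sup>2 + M * (lucas A (2 ^ i) j)\<^sup>2 = 2 ^ (i * j + 2)"
    using lucas_norm[of A "2 ^ i" j] unfolding M' by (simp add: power_add flip: power_mult)
  show "(2 * lucas B (2 ^ j) (Suc i) - B * lucas B (2 ^ j) i)\<^sup>2 + M * (w * lucas B (2 ^ j) i)\<^sup>2 = 2 ^ (i * j + 2)"
    using lucas_norm[of B "2 ^ j" i] unfolding M'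
    by (simp add: power_add power_mult_distrib mult.assoc mult.commute[of i j] flip: power_mult)
  have l: "odd (lucas A (2 ^ i) j)" "odd (lucas B (2 ^ j) i)"
    unfolding ij' using assms(1,2) by (intro lucas_odd; simp)+
  then show "odd (lucas A (2 ^ i) j)" "odd (w * lucas B (2 ^ j) i)"
    "odd (2 * lucas A (2 ^ i) (Suc j) - A * lucas A (2 ^ i) j)"
    "odd (2 * lucas B (2 ^ j) (Suc i) - B * lucas B (2 ^ j) i)"
    using assms(1,2) w by simp_all
qed

section \<open>Two solutions above a power of 2\<close>

text \<open>The analogue of \<open>prime_power_dvd_exponent\<close> for the norm \<open>2 ^ x\<close>. The
elements are divided by 4 because \<open>c - q ^ y\<close> is twice an odd number: with \<open>A =
(c - q ^ y) / 2\<close> and \<open>M = c * q ^ y\<close>, the norm of \<open>(A + sqrt (- M)) /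
2\<close> is \<open>2 ^ (2 * x - 4)\<close>.\<close>

lemma prime_power_dvd_exponent_two:
  fixes q c :: nat
  assumes q: "prime q" "odd q" and c: "c > 0"
    and e1: "2 ^ x1 = c + q ^ y1" and e2: "2 ^ x2 = c + q ^ (y1 + 2 * k)"
    and x: "x1 \<ge> 3" "x2 \<ge> 3" and y1: "y1 > 0" and three: "q = 3 \<Longrightarrow> y1 > 1"
  shows "q ^ k dvd x2 - 2"
proof -
  have pq: "prime (int q)" using q by simp
  define z where "z = int q ^ k"
  define M where "M = int c * int q ^ y1"
  define A B where "A = 2 ^ (x1 - 1) - int q ^ y1" and "B = 2 ^ (x2 - 1) - int q ^ (y1 + 2 * k)"
  define i j where "i = 2 * x1 - 4" and "j = 2 * x2 - 4"
  have E: "int c = 2 ^ x1 - int q ^ y1" "int c = 2 ^ x2 - int q ^ (y1 + 2 * k)"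
    using arg_cong[OF e1, of int] arg_cong[OF e2, of int] by simp_all
  have sq: "(2 ^ (m - 1) - w)\<^sup>2 + (2 ^ m - w) * w = 2 ^ (2 * m - 4 + 2)" if "m \<ge> 3" for m and w :: int
  proof -
    define h where "h = m - 3"
    have h: "m = h + 3" using that by (simp add: h_def)
    define t where "t = (2::int) ^ h"
    have "2 * m - 4 + 2 = 2 * h + 4" using h by simp
    then have "(2::int) ^ (2 * m - 4 + 2) = 16 * t\<^sup>2" by (simp only: power_add t_def power_even_eq) simp
    moreover have "(2::int) ^ (m - 1) = 4 * t" "(2::int) ^ m = 8 * t" using h by (simp_all add: t_def power_add)
    ultimately show ?thesis by (simp add: power2_eq_square algebra_simps)
  qed
  have R1: "A\<^sup>2 + M = 2 ^ (i + 2)"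
    unfolding A_def M_def E(1) i_def by (rule sq[OF x(1)])
  have "M * z\<^sup>2 = int c * int q ^ (y1 + 2 * k)"
    by (simp add: M_def z_def power_add power_even_eq)
  then have R2: "B\<^sup>2 + M * z\<^sup>2 = 2 ^ (j + 2)"
    unfolding B_def j_def by (simp only: E(2)) (rule sq[OF x(2)])
  have odd: "odd A" "odd B" "odd z" using q x by (simp_all add: A_def B_def z_def)
  have "M \<ge> 1" using c q prime_gt_0_nat[OF q(1)] by (simp add: M_def int_one_le_iff_zero_less)
  moreover have "i > 0" "j > 0" using x by (simp_all add: i_def j_def)
  ultimately have "(lucas A (2 ^ i) j)\<^sup>2 = (z * lucas B (2 ^ j) i)\<^sup>2"
    by (rule lucas_norm_unique[OF odd(1,2) R1 R2 _ odd(3)])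
  then have "z dvd lucas A (2 ^ i) j" by (auto simp: power2_eq_iff)
  moreover have "2 * qim A M j = 2 ^ j * lucas A (2 ^ i) j"
    by (rule qim_eq_lucas) (simp add: R1 power_add)
  ultimately have "z dvd 2 * qim A M j" by simp
  then have "int q ^ k dvd qim A M j"
    using odd(3) by (simp add: z_def coprime_dvd_mult_right_iff)
  moreover have "\<not> int q dvd A"
  proof
    assume "int q dvd A"
    then have "int q dvd A + int q ^ y1" using y1 by (intro dvd_add) auto
    then have "int q dvd 2 ^ (x1 - 1)" by (simp add: A_def)
    then have "int q dvd 2" by (rule prime_dvd_power[OF pq])
    then show False using odd_prime_not_dvd_2[OF q] by simp
  qed
  moreover have "int q dvd M" using y1 by (simp add: M_def)
  moreover have "9 dvd M" if "q = 3"
  proof -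
    have "(3::int) ^ 2 dvd 3 ^ y1" using three[OF that] by (intro le_imp_power_dvd) simp
    then show ?thesis by (simp add: M_def that)
  qed
  ultimately have "q ^ k dvd j" using prime_power_dvd_index[OF q(1)] by blast
  then have "q ^ k dvd 2 * (x2 - 2)" by (simp add: j_def diff_mult_distrib2)
  then show ?thesis using q by (simp add: coprime_dvd_mult_right_iff)
qed

lemma cubic_le_power2:
  "x \<ge> 9 \<Longrightarrow> (x + 1) * x\<^sup>2 \<le> (2::nat) ^ (x + 1)"
proof (induction x rule: dec_induct)
  case (step x)
  have "9 * x \<le> x * x" "9 * (x * x) \<le> x * (x * x)"
    using mult_le_mono1[OF step.hyps(1), of x] mult_le_mono1[OF step.hyps(1), of "x * x"] by simp_all
  moreover have "(Suc x + 1) * (Suc x)\<^sup>2 = x * (x * x) + 4 * (x * x) + 5 * x + 2"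
    "2 * ((x + 1) * x\<^sup>2) = 2 * (x * (x * x)) + 2 * (x * x)"
    by (simp_all add: power2_eq_square algebra_simps)
  ultimately have "(Suc x + 1) * (Suc x)\<^sup>2 \<le> 2 * ((x + 1) * x\<^sup>2)"
    using step.hyps by linarith
  also have "\<dots> \<le> 2 * 2 ^ (x + 1)" using step.IH by simp
  finally show ?case by simp
qed (simp add: power2_eq_square)

text \<open>One of the even numbers \<open>w - 1\<close> and \<open>w + 1\<close> is divisible by 2 only once.\<close>

lemma two_power_dvd_square:
  fixes w :: int
  assumes "odd w" "2 ^ (s + 1) dvd w\<^sup>2 - 1"
  shows "2 ^ s dvd w - 1 \<or> 2 ^ s dvd w + 1"
proof -
  obtain u where u: "w = 2 * u + 1" using assms(1) by (auto elim: oddE)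
  have w: "w\<^sup>2 - 1 = 2 * (2 * (u * (u + 1)))" unfolding u by (simp add: power2_eq_square algebra_simps)
  have "2 * 2 ^ s dvd 2 * (2 * (u * (u + 1)))" using assms(2) unfolding w by (simp only: power_add power_one_right mult.commute)
  then have *: "2 ^ s dvd 2 * (u * (u + 1))" by (simp only: dvd_mult_cancel_left) simp
  show ?thesis
  proof (cases "even u")
    case True
    then have "coprime (2 ^ s) (u + 1)" by simp
    then have "2 ^ s dvd 2 * u" using * by (simp add: coprime_dvd_mult_left_iff flip: mult.assoc)
    then show ?thesis by (simp add: u)
  next
    case False
    then have "coprime (2 ^ s) u" by simp
    then have "2 ^ s dvd 2 * (u + 1)" using * by (metis coprime_dvd_mult_right_iff mult.left_commute)
    then show ?thesis by (simp add: u algebra_simps)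
  qed
qed

text \<open>The exponents \<open>y1\<close> and \<open>y2\<close> have the same parity: otherwise \<open>2 ^
x1\<close> divides \<open>q - 1\<close>, although it exceeds \<open>q ^ y1\<close>. With \<open>w
= q ^ k\<close> dividing \<open>x2 - 2\<close>, the size of \<open>2 ^ x2\<close> forces
\<open>w\<close> to be 3, 5 or 7, and these are inspected.\<close>

lemma two_plus_power2:
  fixes q c :: nat
  assumes q: "prime q" "odd q" and c: "c > 1"
    and e1: "2 ^ x1 = c + q ^ y1" and e2: "2 ^ x2 = c + q ^ y2" and y: "0 < y1" "y1 < y2"
  shows "(q = 3 \<and> y1 = 1) \<or> (q = 5 \<and> c = 3)"
proof (rule ccontr)
  assume neg: "\<not> ?thesis"
  have q3: "q \<ge> 3" using q prime_ge_2_nat[OF q(1)] by (cases "q = 2") auto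
  have qy: "q ^ y1 \<ge> q" using y q3 by (simp add: self_le_power)
  have "q ^ y1 < q ^ y2" using y q3 by simp
  then have "(2::nat) ^ x1 < 2 ^ x2" using e1 e2 by linarith
  then have x12: "x1 < x2" by simp
  have "(2::nat) ^ x1 > 2 ^ 2" using e1 c qy q3 by simp
  then have "x1 > 2" using power_less_imp_less_exp[of "2::nat" 2 x1] by simp
  then have x: "x1 \<ge> 3" "x2 \<ge> 3" using x12 by simp_all
  have E: "2 ^ x1 = int c + int q ^ y1" "2 ^ x2 = int c + int q ^ y2"
    using arg_cong[OF e1, of int] arg_cong[OF e2, of int] by simp_all
  define g where "g = y2 - y1"
  have g: "y2 = y1 + g" using y by (simp add: g_def)
  have "(2::int) ^ x1 dvd 2 ^ x2 - 2 ^ x1" using x12 by (intro dvd_diff le_imp_power_dvd) auto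
  also have "(2::int) ^ x2 - 2 ^ x1 = int q ^ y1 * (int q ^ g - 1)"
    unfolding E g by (simp add: power_add algebra_simps)
  finally have "(2::int) ^ x1 dvd int q ^ y1 * (int q ^ g - 1)" .
  moreover have "coprime ((2::int) ^ x1) (int q ^ y1)" using q by simp
  ultimately have dv: "2 ^ x1 dvd int q ^ g - 1" by (simp add: coprime_dvd_mult_right_iff)
  have "even g"
  proof (rule ccontr)
    assume "odd g"
    then have "2 ^ x1 dvd int q - 1" using dv pow2_dvd_odd_power_iff[of "int q" g x1] q by simp
    then have "2 ^ x1 \<le> int q - 1" using q3 by (intro zdvd_imp_le) auto
    moreover have "int q \<le> int q ^ y1" using qy by (metis of_nat_le_iff of_nat_power)
    ultimately show False using E(1) by linarith
  qed
  then obtain k where k: "g = 2 * k" by (auto elim: evenE)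
  have k0: "k > 0" using k g y by simp
  define w where "w = q ^ k"
  have "q ^ k dvd x2 - 2"
    using prime_power_dvd_exponent_two[OF q _ e1 _ x y(1), of k] e2 c neg y unfolding g k by linarith
  then have wx: "w + 2 \<le> x2" using x unfolding w_def by (auto dest!: dvd_imp_le)
  have w3: "w \<ge> 3" "odd w" using q3 k0 q self_le_power[of q k] by (auto simp: w_def)
  have dv2: "2 ^ x1 dvd (int w)\<^sup>2 - 1" using dv by (simp add: k w_def power_even_eq)
  have "2 ^ x1 \<le> 2 * (int w + 1)"
  proof -
    define s where "s = x1 - 1"
    have s: "x1 = s + 1" using x by (simp add: s_def)
    have "2 ^ s dvd int w - 1 \<or> 2 ^ s dvd int w + 1"
      using two_power_dvd_square[of "int w" s] dv2 w3 by (simp add: s)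
    moreover have "int w - 1 > 0" using w3 by simp
    ultimately have "2 ^ s \<le> int w + 1" using zdvd_imp_le[of "2 ^ s" "int w - 1"] zdvd_imp_le[of "2 ^ s" "int w + 1"] by linarith
    then show ?thesis by (simp add: s)
  qed
  then have "int (2 ^ x1) \<le> int (2 * (w + 1))" by simp
  then have x1le: "2 ^ x1 \<le> 2 * (w + 1)" by (simp only: of_nat_le_iff)
  have "c * 1 < c * w\<^sup>2" using c w3 one_less_power[of w 2] by (intro mult_strict_left_mono) linarith+
  moreover have "q ^ y2 = q ^ y1 * w\<^sup>2" by (simp add: g k w_def power_add power_even_eq)
  ultimately have "2 ^ x2 < 2 ^ x1 * w\<^sup>2"
    unfolding e1 e2 by (simp add: algebra_simps)
  also have "\<dots> \<le> 2 * (w + 1) * w\<^sup>2" using x1le by (intro mult_right_mono) auto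
  finally have b: "2 ^ x2 < 2 * (w + 1) * w\<^sup>2" .
  have "2 ^ (w + 2) \<le> (2::nat) ^ x2" using wx by (intro power_increasing) auto
  then have "2 ^ (w + 1) < (w + 1) * w\<^sup>2" using b by simp
  then have "\<not> w \<ge> 9" using cubic_le_power2[of w] by linarith
  then have "w = 3 \<or> w = 5 \<or> w = 7" using w3 by presburger
  moreover from this have "prime w" by auto
  moreover have "q dvd w" using k0 by (simp add: w_def)
  ultimately have qw: "q = w" "w = 3 \<or> w = 5 \<or> w = 7" using q primes_dvd_imp_eq by blast+
  have "k = 1" using qw(1) q3 power_inject_exp[of q k 1] by (simp add: w_def)
  have "2 ^ x1 dvd q\<^sup>2 - 1"
  proof -
    have "int (2 ^ x1) dvd int (q\<^sup>2 - 1)" using dv2 qw(1) q3 by (simp add: of_nat_diff)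
    then show ?thesis by (simp only: int_dvd_int_iff)
  qed
  have cases: "x1 = 3 \<or> x1 = 4 \<or> x1 \<ge> 5" using x by linarith
  have big: "2 ^ 5 dvd (2::nat) ^ x1" if "x1 \<ge> 5" using that by (rule le_imp_power_dvd)
  consider "q = 3" | "q = 5" | "q = 7" using qw by blast
  then show False
  proof cases
    case 1
    have "2 ^ x1 \<le> (8::nat)" using \<open>2 ^ x1 dvd q\<^sup>2 - 1\<close> 1 by (auto dest: dvd_imp_le)
    moreover have "(3::nat) ^ 2 \<le> 3 ^ y1" using neg 1 y by (intro power_increasing) auto
    ultimately show False using e1 1 by simp
  next
    case 2
    then have "x1 = 3" using cases big dvd_trans[OF big] \<open>2 ^ x1 dvd q\<^sup>2 - 1\<close> by fastforce
    then have l: "c + 5 ^ y1 = 8" using e1 2 by simp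
    have "y1 = 1"
    proof (rule ccontr)
      assume "y1 \<noteq> 1"
      then have "(5::nat) ^ 2 \<le> 5 ^ y1" using y by (intro power_increasing) auto
      then show False using l by simp
    qed
    then show False using neg l 2 by simp
  next
    case 3
    have "x1 \<noteq> 3" using e1 3 c qy by auto
    then have "x1 = 4" using cases dvd_trans[OF big] \<open>2 ^ x1 dvd q\<^sup>2 - 1\<close> 3 by fastforce
    then have l: "c + 7 ^ y1 = 16" using e1 3 by simp
    have "y1 = 1"
    proof (rule ccontr)
      assume "y1 \<noteq> 1"
      then have "(7::nat) ^ 2 \<le> 7 ^ y1" using y by (intro power_increasing) auto
      then show False using l by simp
    qed
    then have "2 ^ x2 = (352::nat)" using l e2 3 g k \<open>k = 1\<close> by simp
    then have "2 ^ 8 < (2::nat) ^ x2" "(2::nat) ^ x2 < 2 ^ 9" by simp_all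
    then have "8 < x2" "x2 < 9"
      using power_less_imp_less_exp[of "2::nat" 8 x2] power_less_imp_less_exp[of "2::nat" x2 9] by simp_all
    then show False by simp
  qed
qed


section \<open>Prime powers next to a power of 2\<close>

lemma unit_odd_dvd_power2:
  fixes S :: int
  assumes "odd S" "S dvd 2 ^ x"
  shows "S = 1 \<or> S = - 1"
proof -
  have "coprime S (2 ^ x)" using assms(1) by (simp add: coprime_commute)
  then have "is_unit S" using assms(2) by (meson coprime_common_divisor dvd_refl)
  then show ?thesis by (auto simp: zdvd1_eq)
qed

text \<open>An even \<open>y\<close> fails modulo 4. For an odd \<open>y\<close> above 1, \<open>(q ^ y + 1) /
(q + 1)\<close> would be an odd divisor, greater than 1, of a power of 2.\<close>

lemma power_plus_1_eq_power2:
  fixes q :: nat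
  assumes q: "odd q" "q > 1" and y: "y > 0" and eq: "q ^ y + 1 = 2 ^ x"
  shows "y = 1"
proof -
  have E: "int q ^ y + 1 = 2 ^ x" using arg_cong[OF eq, of int] by simp
  have "odd y"
  proof (rule ccontr)
    assume "\<not> odd y"
    then have "[int q ^ y = 1] (mod 4)" using q by (intro even_power_cong[OF square_cong_4]) simp_all
    then have "4 dvd int q ^ y - 1" by (simp only: cong_iff_dvd_diff)
    then have n4: "\<not> 4 dvd (2::int) ^ x" unfolding E[symmetric] by presburger
    have "x < 2"
    proof (rule ccontr)
      assume "\<not> x < 2"
      then have "(2::int) ^ 2 dvd 2 ^ x" by (intro le_imp_power_dvd) simp
      then show False using n4 by simp
    qed
    then have "(2::nat) ^ x \<le> 2 ^ 1" by (intro power_increasing) simp_all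
    moreover have "q ^ y > 1" using one_less_power[OF q(2) y] .
    ultimately show False using eq by simp
  qed
  \<comment> \<open>\<open>S\<close> is the quotient \<open>(q ^ y + 1) / (q + 1)\<close>.\<close>
  define S where "S = (\<Sum>j<y. (- int q) ^ j)"
  have "odd S" unfolding S_def using q \<open>odd y\<close> by (intro odd_geom_sum) simp_all
  have "(- int q) ^ y - 1 = (- int q - 1) * S" unfolding S_def by (rule power_diff_1_eq)
  then have S: "int q ^ y + 1 = (int q + 1) * S" using \<open>odd y\<close> by (simp add: algebra_simps)
  then have "S dvd 2 ^ x" unfolding E[symmetric] by simp
  then have "S = 1 \<or> S = - 1" by (rule unit_odd_dvd_power2[OF \<open>odd S\<close>])
  moreover have "S \<noteq> - 1"
  proof
    assume "S = - 1"
    then have "int q ^ y + 1 + (int q + 1) = 0" using S by simp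
    moreover have "int q ^ y \<ge> 0" by simp
    ultimately show False by linarith
  qed
  ultimately have "int (q ^ y) = int (q ^ 1)" using S by simp
  then have "q ^ y = q ^ 1" by (simp only: of_nat_eq_iff)
  then show ?thesis using power_inject_exp[OF q(2)] by blast
qed

text \<open>For \<open>y\<close> odd, \<open>(q ^ y - 1) / (q - 1)\<close> is an odd divisor of a power of 2.
For \<open>y\<close> even, \<open>q ^ y - 1\<close> is a product of two consecutive even numbers,
which are powers of 2 only for 2 and 4.\<close>

lemma power_eq_power2_plus_1:
  fixes q :: nat
  assumes q: "odd q" "q > 1" and x: "x > 0" and eq: "q ^ y = 2 ^ x + 1"
  shows "y = 1 \<or> (q = 3 \<and> x = 3)"
proof -
  have E: "int q ^ y - 1 = 2 ^ x" using arg_cong[OF eq, of int] by simp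
  show ?thesis
  proof (cases "odd y")
    case True
    define S where "S = (\<Sum>j<y. (int q) ^ j)"
    have "odd S" unfolding S_def using q True by (intro odd_geom_sum) simp_all
    have S: "int q ^ y - 1 = (int q - 1) * S" unfolding S_def by (rule power_diff_1_eq)
    then have "S dvd 2 ^ x" unfolding E[symmetric] by simp
    then have "S = 1 \<or> S = - 1" by (rule unit_odd_dvd_power2[OF \<open>odd S\<close>])
    moreover have "S \<ge> 0" unfolding S_def by (intro sum_nonneg) simp
    ultimately have "int (q ^ y) = int (q ^ 1)" using S by simp
    then have "q ^ y = q ^ 1" by (simp only: of_nat_eq_iff)
    then show ?thesis using power_inject_exp[OF q(2)] by blast
  next
    case False
    then obtain s where s: "y = 2 * s" by (auto elim: evenE)
    have "s \<noteq> 0" using eq s by (intro notI) simp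
    have qs: "q ^ s > 1" using one_less_power[OF q(2)] \<open>s \<noteq> 0\<close> by simp
    have "odd (q ^ s)" using q by simp
    then obtain t where t: "q ^ s = 2 * t + 1" by (rule oddE)
    have t0: "t > 0" using t qs by simp
    have "(q ^ s)\<^sup>2 = 2 ^ x + 1" using eq by (simp add: s power_even_eq)
    then have p: "4 * (t * (t + 1)) = 2 ^ x" unfolding t by (simp add: power2_eq_square algebra_simps)
    have "t = 1"
    proof (cases "odd t")
      case True
      have "t dvd 2 ^ x" unfolding p[symmetric] by simp
      then have "int t dvd 2 ^ x" by (metis int_dvd_int_iff of_nat_numeral of_nat_power)
      then have "int t = 1 \<or> int t = - 1" using True by (intro unit_odd_dvd_power2) simp
      then show ?thesis by auto
    next
      case False
      have "t + 1 dvd 2 ^ x" unfolding p[symmetric] by (intro dvd_mult dvd_refl)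
      then have "int (t + 1) dvd 2 ^ x" by (metis int_dvd_int_iff of_nat_numeral of_nat_power)
      then have "int (t + 1) = 1 \<or> int (t + 1) = - 1" using False by (intro unit_odd_dvd_power2) simp
      then show ?thesis using t0 by auto
    qed
    then have q3: "q ^ s = 3" and "2 ^ x = (2::nat) ^ 3" using t p by simp_all
    then have "x = 3" using power_inject_exp[of "2::nat" x 3] by simp
    have "q dvd 3" using q3 \<open>s \<noteq> 0\<close> by (metis dvd_power neq0_conv)
    then have "q \<le> 3" by (rule dvd_imp_le) simp
    then have "q = 3" using q by (cases "q = 2") auto
    then show ?thesis using \<open>x = 3\<close> by simp
  qed
qed

text \<open>An odd factor \<open>u\<close> of \<open>m\<close> above 1 would make \<open>2 ^ (m / u) +
1\<close> a proper divisor of \<open>F\<close>.\<close>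

lemma fermat_prime_of_prime:
  assumes "prime F" "F = 2 ^ m + 1" "m > 0"
  shows "fermat_prime F"
proof -
  obtain s u where su: "m = 2 ^ s * u" "odd u" using power2_times_odd[OF assms(3)] .
  define z where "z = (2::int) ^ (2 ^ s)"
  have z: "z > 1" unfolding z_def by (rule one_less_power) simp_all
  have F: "int F = z ^ u + 1" by (simp add: assms(2) su z_def power_mult)
  have "- z - 1 dvd (- z) ^ u - 1" unfolding power_diff_1_eq by simp
  also have "(- z) ^ u - 1 = - int F" using su(2) by (simp add: F)
  finally have "- (z + 1) dvd - int F" by simp
  then have d: "z + 1 dvd int F" by (simp only: minus_dvd_iff dvd_minus_iff)
  moreover have "z + 1 = int (2 ^ (2 ^ s) + 1)" by (simp add: z_def)
  ultimately have "2 ^ (2 ^ s) + 1 dvd F" by (metis int_dvd_int_iff)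
  then have "2 ^ (2 ^ s) + 1 = F" using assms(1) by (auto simp: prime_nat_iff)
  then show ?thesis unfolding fermat_prime_def using assms(1) by blast
qed

lemma power2_mod_3: "[(2::int) ^ x = (if even x then 1 else 2)] (mod 3)"
proof -
  have "[(2::int)\<^sup>2 = 1] (mod 3)" by (simp add: cong_iff_dvd_diff)
  then show ?thesis using even_power_cong odd_power_cong by auto
qed

lemma power2_mod_4: "x \<ge> 2 \<Longrightarrow> 4 dvd (2::int) ^ x"
  using le_imp_power_dvd[of 2 x "2::int"] by simp

section \<open>Combinations of solutions for the prime 2\<close>

text \<open>\<open>3 ^ y3 + 3\<close> is 4 or 6 modulo 8, so \<open>2 ^ x3\<close> is 4 and \<open>3 ^ y3 = 2
^ x1 + 1\<close>.\<close>

lemma two_plus_one_minus_power2_3: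
  assumes c: "c > 1" "odd c" and e1: "2 ^ x1 = c + 3" and e3: "3 ^ y3 = c + (2::nat) ^ x3"
  shows "c = 5"
proof -
  have "(2::nat) ^ x1 > 2 ^ 2" using e1 c by simp
  then have "x1 > 2" using power_less_imp_less_exp[of "2::nat" 2 x1] by simp
  then have "(2::nat) ^ 3 dvd 2 ^ x1" by (intro le_imp_power_dvd) simp
  then have d8: "8 dvd (2::nat) ^ x1" by simp
  have eq: "3 ^ y3 + 3 = 2 ^ x1 + (2::nat) ^ x3" using e1 e3 by simp
  have m: "(3::nat) ^ y3 mod 8 = 1 \<or> (3::nat) ^ y3 mod 8 = 3"
  proof (induction y3)
    case (Suc y)
    have "(3::nat) ^ Suc y mod 8 = 3 * (3 ^ y mod 8) mod 8" by (simp add: mod_mult_right_eq)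
    then show ?case using Suc by auto
  qed simp
  have "((3::nat) ^ y3 + 3) mod 8 = (3 ^ y3 mod 8 + 3) mod 8" by (simp only: mod_add_left_eq)
  moreover have "(2 ^ x1 + (2::nat) ^ x3) mod 8 = 2 ^ x3 mod 8" using d8 by (auto elim!: dvdE)
  ultimately have m8: "(2::nat) ^ x3 mod 8 = 4 \<or> (2::nat) ^ x3 mod 8 = 6" using m eq by auto
  consider "x3 = 0" | "x3 = 1" | "x3 = 2" | "x3 \<ge> 3" by linarith
  then show ?thesis
  proof cases
    case 1
    have "even ((3::nat) ^ y3)" unfolding e3 using 1 c by simp
    then show ?thesis by simp
  next
    case 2
    then show ?thesis using m8 by simp
  next
    case 3
    then have "3 ^ y3 = (2::nat) ^ x1 + 1" using eq by simp
    then have "y3 = 1 \<or> x1 = 3" using power_eq_power2_plus_1[of 3 x1 y3] \<open>x1 > 2\<close> by simp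
    moreover have "y3 \<noteq> 1" using \<open>3 ^ y3 = (2::nat) ^ x1 + 1\<close> \<open>(2::nat) ^ x1 > 2 ^ 2\<close> by auto
    ultimately show ?thesis using e1 by simp
  next
    case 4
    then have "(2::nat) ^ 3 dvd 2 ^ x3" by (intro le_imp_power_dvd) simp
    then have "8 dvd (2::nat) ^ x3" by simp
    then show ?thesis using m8 by (simp add: dvd_eq_mod_eq_0)
  qed
qed

text \<open>A comparison modulo 3 and 4. If \<open>x0\<close> is even, 3 divides \<open>c\<close>; then
\<open>q\<close> is \<open>- 1\<close> modulo 3 by \<open>e4\<close>, \<open>y3\<close> is even,
and \<open>e3\<close> fails modulo 4. If \<open>x0\<close> is odd, 3 divides \<open>q ^ y4\<close>
but not \<open>q ^ y3\<close>.\<close>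

lemma zero_and_two_minus_power2:
  fixes q c :: nat
  assumes q: "prime q" "odd q" and c: "c > 1" and e0: "2 ^ x0 = c + 1"
    and e3: "q ^ y3 = c + 2 ^ x3" and e4: "q ^ y4 = c + 2 ^ x4" and x: "even x3" "odd x4" "x3 > 0"
  shows False
proof -
  have y: "y3 > 0" "y4 > 0" using exp_pos_of_eq e3 e4 two_is_prime_nat c by (metis less_trans zero_less_one)+
  have "(2::nat) ^ x0 > 2 ^ 1" using e0 c by simp
  then have x0: "x0 \<ge> 2" using power_less_imp_less_exp[of "2::nat" 1 x0] by simp
  have E: "int q ^ y3 = 2 ^ x0 + 2 ^ x3 - 1" "int q ^ y4 = 2 ^ x0 + 2 ^ x4 - 1"
    using arg_cong[OF e0, of int] arg_cong[OF e3, of int] arg_cong[OF e4, of int] by simp_all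
  have d: "3 dvd (2::int) ^ x3 - 1" "3 dvd (2::int) ^ x4 - 2"
    using power2_mod_3[of x3] power2_mod_3[of x4] x by (simp_all add: cong_iff_dvd_diff)
  have p3: "prime (3::int)" by simp
  show False
  proof (cases "even x0")
    case True
    have d0: "3 dvd (2::int) ^ x0 - 1" using power2_mod_3[of x0] True by (simp add: cong_iff_dvd_diff)
    have r: "3 dvd int q ^ y3 - 1" "3 dvd int q ^ y4 + 1" using d d0 unfolding E by presburger+
    have q3: "\<not> 3 dvd int q"
    proof
      assume "3 dvd int q"
      then have "3 dvd int q ^ y3" using y by (meson dvd_power dvd_trans)
      then show False using r(1) by presburger
    qed
    have "even y3"
    proof (rule ccontr)
      assume "\<not> even y3"
      then have "[int q ^ y3 = int q] (mod 3)" by (intro odd_power_cong square_cong_3 q3) simp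
      then have "3 dvd int q ^ y3 - int q" by (simp only: cong_iff_dvd_diff)
      then have "3 dvd int q - 1" using r(1) by presburger
      then have "[int q = 1] (mod 3)" by (simp only: cong_iff_dvd_diff)
      then have "[int q ^ y4 = 1 ^ y4] (mod 3)" by (rule cong_pow)
      then have "3 dvd int q ^ y4 - 1" by (simp only: cong_iff_dvd_diff power_one)
      then show False using r(2) by presburger
    qed
    then have "[int q ^ y3 = 1] (mod 4)" using q by (intro even_power_cong[OF square_cong_4]) simp_all
    then have "4 dvd int q ^ y3 - 1" by (simp only: cong_iff_dvd_diff)
    moreover have "x3 \<ge> 2" using x by (cases "x3 = 1") auto
    ultimately show False using power2_mod_4[OF x0] power2_mod_4[of x3] unfolding E by presburger
  next
    case False
    have d0: "3 dvd (2::int) ^ x0 - 2" using power2_mod_3[of x0] False by (simp add: cong_iff_dvd_diff)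
    then have "3 dvd int q ^ y4" using d unfolding E by presburger
    then have "3 dvd int q" by (rule prime_dvd_power[OF p3])
    then have "3 dvd int q ^ y3" using y by (meson dvd_power dvd_trans)
    then show False using d d0 unfolding E by presburger
  qed
qed

text \<open>Since \<open>y1\<close> is odd, \<open>2 ^ x0\<close> divides \<open>q - 1\<close>. So \<open>q ^
y3\<close> is 1 modulo 4, which forces \<open>x3 = 1\<close> and \<open>q ^ y3 = 2 ^ x0 +
1\<close>, a number that is at most \<open>q\<close>.\<close>

lemma zero_plus_minus_power2_odd:
  fixes q c :: nat
  assumes q: "prime q" "odd q" and c: "c > 1" and e0: "2 ^ x0 = c + 1"
    and e1: "2 ^ x1 = c + q ^ y1" and y1: "odd y1"
    and e3: "q ^ y3 = c + 2 ^ x3"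
  shows "fermat_prime q \<and> c = q - 2"
proof -
  have "(2::nat) ^ x0 > 2 ^ 1" using e0 c by simp
  then have x0: "x0 \<ge> 2" using power_less_imp_less_exp[of "2::nat" 1 x0] by simp
  have y3: "y3 > 0" using exp_pos_of_eq[OF e3 two_is_prime_nat] c by simp
  have q1: "q > 1" by (rule prime_gt_1_nat[OF q(1)])
  have qy: "q ^ y1 > 1" using one_less_power[OF q1 odd_pos[OF y1]] .
  have E: "2 ^ x0 = int c + 1" "2 ^ x1 = int c + int q ^ y1" "int q ^ y3 = int c + 2 ^ x3"
    using arg_cong[OF e0, of int] arg_cong[OF e1, of int] arg_cong[OF e3, of int] by simp_all
  have "(2::nat) ^ x0 < 2 ^ x1" using e0 e1 qy by simp
  then have "x0 < x1" by simp
  then have "(2::int) ^ x0 dvd 2 ^ x1 - 2 ^ x0" by (intro dvd_diff le_imp_power_dvd) auto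
  also have "(2::int) ^ x1 - 2 ^ x0 = int q ^ y1 - 1" unfolding E by simp
  finally have dq: "2 ^ x0 dvd int q - 1" using pow2_dvd_odd_power_iff[of "int q" y1 x0] q y1 by simp
  then have le: "2 ^ x0 \<le> int q - 1" using q1 by (intro zdvd_imp_le) auto
  have "4 dvd int q - 1" using power2_mod_4[OF x0] dq by (rule dvd_trans)
  then have "[int q = 1] (mod 4)" by (simp only: cong_iff_dvd_diff)
  then have "[int q ^ y3 = 1 ^ y3] (mod 4)" by (rule cong_pow)
  then have "4 dvd int q ^ y3 - 1" by (simp only: cong_iff_dvd_diff power_one)
  also have "int q ^ y3 - 1 = 2 ^ x0 + (2 ^ x3 - 2)" unfolding E by simp
  finally have d4: "4 dvd (2::int) ^ x3 - 2" using power2_mod_4[OF x0] by (simp only: dvd_add_right_iff)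
  have "x3 = 1"
  proof -
    have "\<not> x3 \<ge> 2"
    proof
      assume "x3 \<ge> 2"
      then have "4 dvd (2::int) ^ x3 - (2 ^ x3 - 2)" by (rule dvd_diff[OF power2_mod_4 d4])
      then show False by simp
    qed
    moreover have "x3 \<noteq> 0" using d4 by (intro notI) simp
    ultimately show ?thesis by simp
  qed
  then have "int (q ^ y3) \<le> int (q ^ 1)" using E le by simp
  then have "q ^ y3 \<le> q ^ 1" by (simp only: of_nat_le_iff)
  then have "y3 = 1" using y3 power_le_imp_le_exp[OF q1, of y3 1] by simp
  then have "q = 2 ^ x0 + 1" using e3 e0 \<open>x3 = 1\<close> by simp
  then show ?thesis using fermat_prime_of_prime[OF q(1), of x0] x0 e0 by simp
qed

text \<open>Here \<open>m = 1\<close>, so \<open>q\<close> is the Mersenne number \<open>2 ^ (x0 - 1) -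
1\<close> and \<open>q\<close> divides \<open>2 ^ x3 + 1\<close>, a number not exceeding \<open>q
+ 2\<close>. Thus \<open>2 ^ x3 + 2 = 2 ^ (x0 - 1)\<close>, which fails modulo 4.\<close>

lemma mersenne_contradiction:
  fixes q c :: nat
  assumes q: "odd q" "q > 1" and x0: "x0 \<ge> 4" and m: "m > 0" and qm: "q ^ m + 1 = 2 ^ (x0 - 1)"
    and y3: "y3 > 0" and e3: "q ^ y3 + 1 = 2 ^ x0 + 2 ^ x3" and x3: "2 \<le> x3" "x3 < x0"
  shows False
proof -
  have "m = 1" by (rule power_plus_1_eq_power2[OF q m qm])
  then have Q: "q + 1 = 2 ^ (x0 - 1)" using qm by simp
  moreover have "(2::nat) ^ x0 = 2 * 2 ^ (x0 - 1)" using x0 by (cases x0) auto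
  ultimately have e: "q ^ y3 = 2 * q + (1 + 2 ^ x3)" using e3 by simp
  have "(2::nat) ^ x3 \<le> 2 ^ (x0 - 1)" using x3 by (intro power_increasing) auto
  then have le: "1 + 2 ^ x3 \<le> q + 2" using Q by simp
  have "q dvd 2 * q + (1 + 2 ^ x3)" unfolding e[symmetric] using y3 by simp
  then have "q dvd 1 + 2 ^ x3" by (simp only: dvd_add_right_iff dvd_triv_right)
  then obtain r where r: "1 + 2 ^ x3 = q * r" by (rule dvdE)
  have "(2::nat) ^ 3 \<le> 2 ^ (x0 - 1)" using x0 by (intro power_increasing) auto
  then have q7: "q \<ge> 7" using Q by simp
  have "r < 2"
  proof (rule ccontr)
    assume "\<not> r < 2"
    then have "q * 2 \<le> q * r" by (intro mult_left_mono) auto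
    then show False using r le q7 by linarith
  qed
  moreover have "r \<noteq> 0" using r by (intro notI) simp
  ultimately have "r = 1" by simp
  then have "2 ^ x3 + 2 = (2::nat) ^ (x0 - 1)" using r Q by simp
  moreover have "(2::nat) ^ 2 dvd 2 ^ x3" "(2::nat) ^ 2 dvd 2 ^ (x0 - 1)" using x0 x3 by (intro le_imp_power_dvd; simp)+
  ultimately have "4 dvd (2::nat) ^ x3 + 2" "4 dvd (2::nat) ^ x3" by simp_all
  then have "4 dvd (2::nat)" by (simp only: dvd_add_right_iff)
  then show False by simp
qed

text \<open>Modulo 3, the exponents \<open>x0\<close> and \<open>x1\<close> have the same parity. If both are
even, \<open>c\<close> is a difference of two squares, which leads to \<open>q ^ m = 2 ^ (x0 - 1)
- 1\<close>. If both are odd, the elements \<open>(1 + sqrt (- c)) / 2\<close> and \<open>(q ^ m +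
sqrt (- c)) / 2\<close>, of norms \<open>Q = 2 ^ (x0 - 2)\<close> and \<open>2 ^ (x1 - 2)\<close>,
have powers with the same imaginary part up to sign. Modulo \<open>2 * Q\<close> the first
imaginary part is \<open>1 - Q\<close> and the second is 1.\<close>

lemma zero_plus_minus_power2_even:
  fixes q c :: nat
  assumes q: "prime q" "odd q" and e0: "2 ^ x0 = c + 1" and x0: "x0 \<ge> 4"
    and e1: "2 ^ x1 = c + q ^ (2 * m)" and m: "m > 0"
    and e3: "q ^ y3 = c + 2 ^ x3" and x3: "2 \<le> x3" "x3 < x0" and d3: "2 ^ x3 dvd int q + 1"
  shows False
proof -
  have p3: "prime (3::int)" by simp
  have q1: "q > 1" by (rule prime_gt_1_nat[OF q(1)])
  have "(2::nat) ^ x0 \<ge> 2 ^ 4" using x0 by (intro power_increasing) auto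
  then have c: "c \<ge> 15" using e0 by simp
  have y3: "y3 > 0" using exp_pos_of_eq[OF e3 two_is_prime_nat] c by simp
  have qm: "q ^ m > 1" using one_less_power[OF q1 m] .
  have qm2: "q ^ (2 * m) > 1" using one_less_power[OF q1, of "2 * m"] m by simp
  define a where "a = int q ^ m"
  have "int (q ^ m) > int 1" using qm by (simp only: of_nat_less_iff)
  then have a: "odd a" "a > 1" using q by (simp_all add: a_def)
  have E: "int c = 2 ^ x0 - 1" "2 ^ x1 = int c + a\<^sup>2" "int q ^ y3 + 1 = 2 ^ x0 + 2 ^ x3"
    using arg_cong[OF e0, of int] arg_cong[OF e1, of int] arg_cong[OF e3, of int] by (simp_all add: a_def power_even_eq)
  have "(2::nat) ^ x0 < 2 ^ x1" using e0 e1 qm2 by simp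
  then have x01: "x0 < x1" by simp
  have "q \<noteq> 3"
  proof
    assume q3: "q = 3"
    have "(2::int) ^ x3 \<le> 4" using d3 q3 by (auto dest: zdvd_imp_le)
    then have "(2::int) ^ x3 \<le> 2 ^ 2" by simp
    then have "x3 \<le> 2" using power_le_imp_le_exp[of "2::int" x3 2] by simp
    then have "3 ^ y3 = 2 ^ x0 + (3::int)" using E(3) x3 q3 by simp
    moreover have "3 dvd (3::int) ^ y3" using y3 by simp
    ultimately have "3 dvd 2 ^ x0 + (3::int)" by simp
    then have "3 dvd (2::int) ^ x0" by (simp only: dvd_add_left_iff dvd_refl)
    then have "3 dvd (2::int)" by (rule prime_dvd_power[OF p3])
    then show False by simp
  qed
  then have q3: "\<not> 3 dvd int q" using prime_ne_not_dvd[of 3 q] q by simp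
  have "\<not> 3 dvd a" unfolding a_def using q3 prime_dvd_power[OF p3] by blast
  then have "3 dvd a\<^sup>2 - 1" using square_cong_3 by (simp only: cong_iff_dvd_diff)
  then have "3 dvd (a\<^sup>2 - 1) - (2 ^ x1 - 2 ^ x0 - (a\<^sup>2 - 1))" using E by simp
  then have d30: "3 dvd (2::int) ^ x1 - 2 ^ x0" using E \<open>3 dvd a\<^sup>2 - 1\<close> by simp
  then have "[(2::int) ^ x1 = 2 ^ x0] (mod 3)" by (simp only: cong_iff_dvd_diff)
  then have "[if even x1 then 1 else 2 = (if even x0 then 1 else 2 :: int)] (mod 3)"
    using power2_mod_3[of x1] power2_mod_3[of x0] by (metis cong_sym cong_trans)
  then have par: "even x1 \<longleftrightarrow> even x0" by (auto simp: cong_def split: if_splits)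
  show False
  proof (cases "even x0")
    case True
    then obtain s where s: "x1 = 2 * s" using par by (auto elim: evenE)
    \<comment> \<open>\<open>w\<^sup>2\<close> is 1 modulo \<open>2 ^ (s + 1)\<close> and \<open>w < 2 ^ s\<close>, so \<open>w = 1\<close> or \<open>a = 1\<close>.\<close>
    define w where "w = 2 ^ s - a"
    have sq: "(2 ^ s)\<^sup>2 = int c + a\<^sup>2" using E(2) by (simp add: s power_even_eq)
    have "a\<^sup>2 < (2 ^ s)\<^sup>2" using sq c by simp
    then have "a < 2 ^ s" by (rule power_less_imp_less_base) simp
    then have w0: "w > 0" by (simp add: w_def)
    have cw: "int c = w * (2 ^ s + a)" using sq by (simp add: w_def power2_eq_square algebra_simps)
    have "1 * (2 ^ s + a) \<le> w * (2 ^ s + a)" using w0 a by (intro mult_right_mono) auto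
    then have "2 ^ s + a \<le> int c" unfolding cw by simp
    then have "(2::int) ^ s < 2 ^ x0" using E(1) a by linarith
    then have sx: "s < x0" by simp
    have "s \<noteq> 0" using \<open>a < 2 ^ s\<close> a by (intro notI) simp
    then have "odd w" using a by (simp add: w_def)
    have "2 ^ x0 = w * (2 ^ s + a) + 1" using cw E(1) by simp
    then have "w\<^sup>2 - 1 = 2 ^ (s + 1) * w - 2 ^ x0" by (simp add: w_def power2_eq_square algebra_simps)
    moreover have "(2::int) ^ (s + 1) dvd 2 ^ x0" using sx by (intro le_imp_power_dvd) simp
    ultimately have "2 ^ (s + 1) dvd w\<^sup>2 - 1" by simp
    then have "2 ^ s dvd w - 1 \<or> 2 ^ s dvd w + 1" by (rule two_power_dvd_square[OF \<open>odd w\<close>])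
    moreover have "\<not> 2 ^ s dvd w + 1"
    proof
      assume "2 ^ s dvd w + 1"
      then have "2 ^ s \<le> w + 1" using w0 by (intro zdvd_imp_le) auto
      then show False using a by (simp add: w_def)
    qed
    moreover have "w = 1" if "2 ^ s dvd w - 1"
    proof (rule ccontr)
      assume "w \<noteq> 1"
      then have "2 ^ s \<le> w - 1" using w0 that by (intro zdvd_imp_le) auto
      then show False using a by (simp add: w_def)
    qed
    ultimately have w1: "w = 1" by blast
    then have as: "a + 1 = 2 ^ s" by (simp add: w_def)
    have "(2::int) ^ x0 = 2 ^ (s + 1)" using cw w1 as E(1) by simp
    then have xs: "x0 = s + 1" using power_inject_exp[of "2::int" x0 "s + 1"] by simp
    have "int (q ^ m + 1) = int (2 ^ (x0 - 1))" using as xs by (simp add: a_def)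
    then have m1: "q ^ m + 1 = 2 ^ (x0 - 1)" by (simp only: of_nat_eq_iff)
    have "int (q ^ y3 + 1) = int (2 ^ x0 + 2 ^ x3)" using E(3) by simp
    then have "q ^ y3 + 1 = 2 ^ x0 + 2 ^ x3" by (simp only: of_nat_eq_iff)
    then show False using mersenne_contradiction[OF q(2) q1 x0 m m1 y3 _ x3] by blast
  next
    case False
    then have x1: "odd x1" using par by simp
    obtain h where h: "x0 = 2 * h + 1" using False by (auto elim: oddE)
    obtain h1 where h1: "x1 = 2 * h1 + 1" using x1 by (auto elim: oddE)
    have hh: "h \<ge> 2" "h1 > h" using x0 x01 h h1 by simp_all
    define t where "t = h1 - 2"
    define i j where "i = x0 - 2" and "j = x1 - 2"
    have ij: "i = 2 * (h - 1) + 1" "j = 2 * t + 3" using h h1 hh by (simp_all add: i_def j_def t_def)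
    define Q where "Q = (2::int) ^ i"
    have "(2::int) ^ 3 \<le> 2 ^ i" using hh ij by (intro power_increasing) auto
    then have Q8: "Q \<ge> 8" by (simp add: Q_def)
    have R: "1\<^sup>2 + int c = 2 ^ (i + 2)" "a\<^sup>2 + int c * 1\<^sup>2 = 2 ^ (j + 2)"
      using E h h1 hh by (simp_all add: i_def j_def)
    have "(lucas 1 (2 ^ i) j)\<^sup>2 = (1 * lucas a (2 ^ j) i)\<^sup>2"
      using ij c by (intro lucas_norm_unique[OF _ a(1) R]) auto
    then have L: "lucas 1 Q j = lucas a (2 ^ j) i \<or> lucas 1 Q j = - lucas a (2 ^ j) i"
      by (simp add: Q_def power2_eq_iff)
    have "even Q" using ij by (simp add: Q_def)
    have jn: "j = (2 * t + 1) + 2" using ij by simp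
    have l1: "2 * Q dvd lucas 1 Q j - (1 - int (2 * t + 1) * Q)"
      unfolding jn by (rule lucas_one_cong[OF \<open>even Q\<close>])
    have "2 * Q dvd (lucas 1 Q j - (1 - int (2 * t + 1) * Q)) - 2 * Q * int t"
      using l1 by (rule dvd_diff) simp
    also have "(lucas 1 Q j - (1 - int (2 * t + 1) * Q)) - 2 * Q * int t = lucas 1 Q j - (1 - Q)"
      by (simp add: algebra_simps)
    finally have l1': "2 * Q dvd lucas 1 Q j - (1 - Q)" .
    have "[lucas a (2 ^ j) (Suc (2 * (h - 1))) = a ^ (2 * (h - 1))] (mod 2 ^ j)" by (rule lucas_cong)
    moreover have "2 * Q dvd 2 ^ j"
    proof -
      have "(2::int) ^ (i + 1) dvd 2 ^ j" using ij hh by (intro le_imp_power_dvd) (simp add: t_def)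
      then show ?thesis by (simp add: Q_def)
    qed
    ultimately have l2: "[lucas a (2 ^ j) i = a ^ (2 * (h - 1))] (mod (2 * Q))"
      unfolding ij(1) by (simp add: cong_dvd_modulus)
    have "[a\<^sup>2 = 1] (mod (2 * Q))"
    proof -
      have "a\<^sup>2 - 1 = 2 ^ (j + 2) - 2 ^ (i + 2)" using R by simp
      also have "\<dots> = 2 ^ j * 4 - 2 * Q * 2" by (simp add: Q_def power_add)
      finally show ?thesis using \<open>2 * Q dvd 2 ^ j\<close> by (simp only: cong_iff_dvd_diff dvd_diff dvd_mult2 dvd_triv_left)
    qed
    then have "[a ^ (2 * (h - 1)) = 1] (mod (2 * Q))" by (rule even_power_cong) simp
    with l2 have "[lucas a (2 ^ j) i = 1] (mod (2 * Q))" by (rule cong_trans)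
    then have l2': "2 * Q dvd lucas a (2 ^ j) i - 1" by (simp only: cong_iff_dvd_diff)
    from L show False
    proof
      assume *: "lucas 1 Q j = lucas a (2 ^ j) i"
      have "2 * Q dvd (lucas 1 Q j - (1 - Q)) - (lucas a (2 ^ j) i - 1)" by (rule dvd_diff[OF l1' l2'])
      then have "2 * Q dvd Q" by (simp add: *)
      then show False using Q8 zdvd_imp_le[of "2 * Q" Q] by simp
    next
      assume *: "lucas 1 Q j = - lucas a (2 ^ j) i"
      have "2 * Q dvd (lucas 1 Q j - (1 - Q)) + (lucas a (2 ^ j) i - 1)" by (rule dvd_add[OF l1' l2'])
      then have "2 * Q dvd Q - 2" by (simp add: *)
      then show False using Q8 zdvd_imp_le[of "2 * Q" "Q - 2"] by simp
    qed
  qed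
qed

text \<open>For \<open>y1\<close> odd this gives the Fermat primes. For \<open>y1\<close> even and \<open>x3 =
1\<close>, the equation \<open>q ^ y3 = 2 ^ x0 + 1\<close> gives a Fermat prime or 9. Otherwise
the powers of 2 in \<open>q + 1\<close> and in \<open>q ^ y1 - 1\<close> show \<open>x3 <
x0\<close>, and only \<open>x0 = 3\<close> is possible, with \<open>q = 11\<close>.\<close>

lemma zero_plus_minus_power2:
  fixes q c :: nat
  assumes q: "prime q" "odd q" and c: "c > 1" and e0: "2 ^ x0 = c + 1"
    and e1: "2 ^ x1 = c + q ^ y1" and y1: "y1 > 0"
    and e3: "q ^ y3 = c + 2 ^ x3" and x3: "x3 > 0"
  shows "(fermat_prime q \<and> c = q - 2) \<or> (q = 3 \<and> c = 7) \<or> (q = 11 \<and> c = 7)"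
proof (cases "odd y1")
  case True
  then show ?thesis using zero_plus_minus_power2_odd[OF q c e0 e1 _ e3] by blast
next
  case False
  then obtain m where m: "y1 = 2 * m" by (auto elim: evenE)
  have m0: "m > 0" using m y1 by simp
  have q1: "q > 1" by (rule prime_gt_1_nat[OF q(1)])
  have "(2::nat) ^ x0 > 2 ^ 1" using e0 c by simp
  then have x0: "x0 \<ge> 2" using power_less_imp_less_exp[of "2::nat" 1 x0] by simp
  have y3: "y3 > 0" using exp_pos_of_eq[OF e3 two_is_prime_nat] c by simp
  have E: "2 ^ x0 = int c + 1" "2 ^ x1 = int c + int q ^ y1" "int q ^ y3 = int c + 2 ^ x3"
    using arg_cong[OF e0, of int] arg_cong[OF e1, of int] arg_cong[OF e3, of int] by simp_all
  show ?thesis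
  proof (cases "x3 = 1")
    case True
    then have e: "q ^ y3 = 2 ^ x0 + 1" using e0 e3 by simp
    then have "y3 = 1 \<or> (q = 3 \<and> x0 = 3)" using power_eq_power2_plus_1[OF q(2) q1 _ e] x0 by simp
    then show ?thesis
    proof
      assume "y3 = 1"
      then have "q = 2 ^ x0 + 1" using e by simp
      then show ?thesis using fermat_prime_of_prime[OF q(1), of x0] x0 e0 by simp
    next
      assume "q = 3 \<and> x0 = 3"
      then show ?thesis using e0 by simp
    qed
  next
    case False
    then have x32: "x3 \<ge> 2" using x3 by simp
    have sum: "int q ^ y3 + 1 = 2 ^ x0 + 2 ^ x3" unfolding E by simp
    have "odd y3"
    proof (rule ccontr)
      assume "\<not> odd y3"
      then have "[int q ^ y3 = 1] (mod 4)" using q by (intro even_power_cong[OF square_cong_4]) simp_all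
      then have "4 dvd int q ^ y3 - 1" by (simp only: cong_iff_dvd_diff)
      moreover have "4 dvd int q ^ y3 + 1" unfolding sum using power2_mod_4 x0 x32 by (intro dvd_add)
      ultimately have "4 dvd (int q ^ y3 + 1) - (int q ^ y3 - 1)" by (rule dvd_diff[rotated])
      then show False by simp
    qed
    have dv: "2 ^ k dvd int q + 1" if "2 ^ k dvd int q ^ y3 + 1" for k
    proof -
      have "(- int q) ^ y3 - 1 = - (int q ^ y3 + 1)" using \<open>odd y3\<close> by simp
      then have "2 ^ k dvd (- int q) ^ y3 - 1" using that by (simp only: dvd_minus_iff)
      then have "2 ^ k dvd - int q - 1" using pow2_dvd_odd_power_iff[of "- int q" y3 k] q \<open>odd y3\<close> by simp
      then have "2 ^ k dvd - (int q + 1)" by simp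
      then show ?thesis by (simp only: dvd_minus_iff)
    qed
    have x30: "x3 < x0"
    proof (rule ccontr)
      assume "\<not> x3 < x0"
      then have "2 ^ x0 dvd int q ^ y3 + 1" unfolding sum by (intro dvd_add le_imp_power_dvd) auto
      then have "2 ^ x0 dvd int q + 1" by (rule dv)
      moreover have "even (int q - 1)" using q by simp
      ultimately have "2 ^ x0 * 2 dvd (int q + 1) * (int q - 1)" by (rule mult_dvd_mono)
      also have "(int q + 1) * (int q - 1) = (int q)\<^sup>2 - 1" by (simp add: power2_eq_square algebra_simps)
      also have "\<dots> dvd (int q)\<^sup>2 ^ m - 1" unfolding power_diff_1_eq by simp
      also have "(int q)\<^sup>2 ^ m - 1 = 2 ^ x1 - 2 ^ x0" unfolding E m by (simp add: power_mult)
      finally have d: "2 ^ (x0 + 1) dvd 2 ^ x1 - (2::int) ^ x0" by (simp add: mult.commute)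
      have "q ^ y1 > 1" using one_less_power[OF q1 y1] .
      then have "(2::nat) ^ x0 < 2 ^ x1" using e0 e1 by simp
      then have "x0 < x1" by simp
      then have "2 ^ (x0 + 1) dvd (2::int) ^ x1" by (intro le_imp_power_dvd) simp
      then have "2 ^ (x0 + 1) dvd 2 ^ x1 - (2 ^ x1 - (2::int) ^ x0)" using d by (rule dvd_diff)
      then have "2 ^ (x0 + 1) dvd (2::int) ^ x0" by simp
      then have "2 ^ (x0 + 1) \<le> (2::int) ^ x0" by (rule zdvd_imp_le) simp
      then show False by simp
    qed
    show ?thesis
    proof (cases "x0 \<ge> 4")
      case True
      have "2 ^ x3 dvd int q ^ y3 + 1" unfolding sum using x30 by (intro dvd_add le_imp_power_dvd) auto
      then have "2 ^ x3 dvd int q + 1" by (rule dv)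
      then show ?thesis
        using zero_plus_minus_power2_even[OF q e0 True _ m0 e3 x32 x30] e1 m by blast
    next
      case False
      then have x: "x0 = 3" "x3 = 2" using x30 x32 by simp_all
      then have c7: "c = 7" using e0 by simp
      then have "q ^ y3 = 11" using e3 x by simp
      then have "q dvd 11" using y3 by (metis dvd_power)
      then have "q = 11" using q primes_dvd_imp_eq[of q 11] by simp
      then show ?thesis using c7 by simp
    qed
  qed
qed


text \<open>For even \<open>c\<close> there is no plus solution, and \<open>x = 0\<close> in a minus solution.
For \<open>c = 1\<close> all solutions with positive exponents have \<open>y = 1\<close>. For odd
\<open>c\<close> above 1 the combinations are those treated before.\<close>

lemma prime_two_case:
  fixes q c :: nat
  assumes q: "prime q" "odd q" and c: "c > 0"
    and ex: "(2, q, c) \<notin> exceptional_triples"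
  shows "finite (solutions 2 q c) \<and> card (solutions 2 q c) \<le> 2"
proof -
  have q1: "q > 1" by (rule prime_gt_1_nat[OF q(1)])
  have ex': "\<not> (q = 3 \<and> c = 5)" "\<not> (q = 3 \<and> c = 7)" "\<not> (q = 11 \<and> c = 7)" "\<not> (fermat_prime q \<and> c = q - 2)"
    using ex by (auto simp: exceptional_triples_def)
  have fermat: "fermat_prime 3" "fermat_prime 5"
    by (rule fermat_prime_of_prime[of _ 1]; simp) (rule fermat_prime_of_prime[of _ 2]; simp)
  have ex35: "\<not> (q = 5 \<and> c = 3)" "\<not> (q = 3 \<and> c = 1)" using ex'(4) fermat by auto
  consider "even c" | "c = 1" | "odd c" "c > 1"
    using c by (cases "c = 1"; cases "even c") auto
  then show ?thesis
  proof cases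
    case 1
    have P: False if "2 ^ x = c + q ^ y" for x y
    proof -
      have "x > 0" using exp_pos_of_eq[OF that q(1) c] .
      then have "even (c + q ^ y)" unfolding that[symmetric] by simp
      then show False using 1 q by simp
    qed
    have M: "x = 0" if "q ^ y = c + 2 ^ x" for x y
    proof (rule ccontr)
      assume "x \<noteq> 0"
      then have "even (c + 2 ^ x)" using 1 by simp
      then show False unfolding that[symmetric] using q by simp
    qed
    show ?thesis by (rule card_solutions_le_2[OF _ q1 c]) (use P M in force)+
  next
    case 2
    have q3: "q \<noteq> 3" using ex35 2 by simp
    have P: "y = 1" if "2 ^ x = c + q ^ y" "y > 0" for x y
      using power_plus_1_eq_power2[OF q(2) q1 that(2), of x] that 2 by simp
    have M: "y = 1 \<and> x > 0" if "q ^ y = c + 2 ^ x" for x y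
    proof -
      have "x \<noteq> 0"
      proof
        assume "x = 0"
        then have "even (q ^ y)" using that 2 by simp
        then show False using q by simp
      qed
      then show ?thesis using power_eq_power2_plus_1[OF q(2) q1, of x y] that 2 q3 by simp
    qed
    show ?thesis
    proof (rule card_solutions_le_2[OF _ q1 c])
      show False if "2 ^ x1 = c + q ^ y1" "2 ^ x2 = c + q ^ y2" "2 ^ x3 = c + q ^ y3" "y1 < y2" "y2 < y3" for x1 y1 x2 y2 x3 y3
        using P[OF that(2)] P[OF that(3)] that by simp
      show False if "q ^ y1 = c + 2 ^ x1" "q ^ y2 = c + 2 ^ x2" "q ^ y3 = c + 2 ^ x3" "x1 < x2" "x2 < x3" for x1 y1 x2 y2 x3 y3
        using M[OF that(1)] M[OF that(2)] that by simp
      show False if "q ^ y1 = c + 2 ^ x1" "q ^ y2 = c + 2 ^ x2" "2 ^ x3 = c + q ^ y3" "x1 < x2" for x1 y1 x2 y2 x3 y3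
        using M[OF that(1)] M[OF that(2)] that by simp
      show False if e: "2 ^ x1 = c + q ^ y1" "2 ^ x2 = c + q ^ y2" "q ^ y3 = c + 2 ^ x3" "y1 < y2" for x1 y1 x2 y2 x3 y3
      proof -
        have "q + 1 = 2 ^ x2" "q = 1 + 2 ^ x3" "x3 > 0" using P[OF e(2)] M[OF e(3)] e 2 by simp_all
        then have s: "2 ^ x2 = (2::nat) ^ x3 + 2" by simp
        have "(2::nat) ^ 1 < 2 ^ x2" unfolding s by simp
        then have "x2 \<ge> 2" using power_less_imp_less_exp[of "2::nat" 1 x2] by simp
        then have "4 dvd (2::nat) ^ x2" using le_imp_power_dvd[of 2 x2 "2::nat"] by simp
        moreover have "4 dvd (2::nat) ^ x3" if "x3 \<noteq> 1"
          using that \<open>x3 > 0\<close> le_imp_power_dvd[of 2 x3 "2::nat"] by simp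
        moreover have "\<not> 4 dvd (2::nat)" by simp
        ultimately have "x3 = 1" unfolding s by (metis dvd_add_right_iff)
        then show False using \<open>q = 1 + 2 ^ x3\<close> q3 by simp
      qed
    qed simp
  next
    case 3
    have pos: "x > 0" if "q ^ y = c + 2 ^ x" for x y
    proof (rule Nat.gr0I)
      assume "x = 0"
      then have "even (q ^ y)" using that 3 by simp
      then show False using q by simp
    qed
    have q2: "2 \<noteq> q" using q by auto
    have same: "odd (x + x')" if "q ^ y = c + 2 ^ x" "q ^ y' = c + 2 ^ x'" "x < x'" for x y x' y'
    proof (rule ccontr)
      assume e: "\<not> odd (x + x')"
      define k where "k = (x' - x) div 2"
      have k: "x' = x + 2 * k" "k > 0" using that e unfolding k_def by presburger+
      show False
        using same_parity_solutions[OF q two_is_prime_nat q2 3(2) that(1) _ pos[OF that(1)] k(2), of y'] that(2) k(1) by simp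
    qed
    show ?thesis
    proof (rule card_solutions_le_2[OF _ q1 c])
      show False if e: "2 ^ x1 = c + q ^ y1" "2 ^ x2 = c + q ^ y2" "2 ^ x3 = c + q ^ y3" and y: "y1 < y2" "y2 < y3" for x1 y1 x2 y2 x3 y3
      proof -
        have s: "q = 3" "y2 = 1" using two_plus_power2[OF q 3(2) e(2,3) _ y(2)] y ex35 by auto
        then have y1: "y1 = 0" using y by simp
        have "(2::nat) ^ x2 = 2 ^ x1 + 2" using e(1,2) s y1 by simp
        moreover have "(2::nat) ^ 1 < 2 ^ x1" using e(1) y1 3 by simp
        then have "x1 \<ge> 2" using power_less_imp_less_exp[of "2::nat" 1 x1] by simp
        then have d1: "4 dvd (2::nat) ^ x1" using le_imp_power_dvd[of 2 x1 "2::nat"] by simp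
        moreover have "(2::nat) ^ 1 < 2 ^ x2" using e(2) s 3 by simp
        then have "x2 \<ge> 2" using power_less_imp_less_exp[of "2::nat" 1 x2] by simp
        then have "4 dvd (2::nat) ^ x2" using le_imp_power_dvd[of 2 x2 "2::nat"] by simp
        ultimately have "4 dvd (2::nat)" by (simp only: dvd_add_right_iff)
        then show False by simp
      qed
      show False if e: "q ^ y1 = c + 2 ^ x1" "q ^ y2 = c + 2 ^ x2" "q ^ y3 = c + 2 ^ x3" and x: "x1 < x2" "x2 < x3" for x1 y1 x2 y2 x3 y3
        using same[OF e(1,2) x(1)] same[OF e(2,3) x(2)] same[OF e(1,3)] x by simp
      show False if e: "2 ^ x1 = c + q ^ y1" "2 ^ x2 = c + q ^ y2" "q ^ y3 = c + 2 ^ x3" and y: "y1 < y2" for x1 y1 x2 y2 x3 y3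
      proof (cases "y1 = 0")
        case True
        then have e0: "2 ^ x1 = c + 1" using e(1) by simp
        show False using zero_plus_minus_power2[OF q 3(2) e0 e(2) _ e(3) pos[OF e(3)]] y ex' by simp
      next
        case False
        then have s: "q = 3" "y1 = 1" using two_plus_power2[OF q 3(2) e(1,2) _ y] ex35 by auto
        then have "c = 5" using two_plus_one_minus_power2_3[OF 3(2,1), of x1 y3 x3] e by simp
        then show False using ex' s by simp
      qed
      show False if e: "q ^ y1 = c + 2 ^ x1" "q ^ y2 = c + 2 ^ x2" "2 ^ x3 = c + q ^ y3" and x: "x1 < x2" for x1 y1 x2 y2 x3 y3
      proof -
        have o: "odd (x1 + x2)" by (rule same[OF e(1,2) x])
        show False
        proof (cases "y3 = 0")
          case True
          then have e0: "2 ^ x3 = c + 1" using e(3) by simp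
          show False
          proof (cases "even x1")
            case True
            then show False using zero_and_two_minus_power2[OF q 3(2) e0 e(1,2) _ _ pos[OF e(1)]] o by simp
          next
            case False
            then show False using zero_and_two_minus_power2[OF q 3(2) e0 e(2,1) _ _ pos[OF e(2)]] o by simp
          qed
        next
          case False
          then show False using opposite_sign[OF q two_is_prime_nat q2[symmetric] c e(1,2) o e(3)] by simp
        qed
      qed
    qed simp
  qed
qed

section \<open>The theorem\<close>

text \<open>The equation \<open>p ^ x = c + p ^ y\<close> determines \<open>y\<close>, the number of factors
\<open>p\<close> in \<open>c\<close>; so there is at most one solution of each kind.\<close>

lemma equal_primes_case:
  fixes p c :: nat
  assumes p: "prime p" and c: "c > 0"
  shows "finite (solutions p p c) \<and> card (solutions p p c) \<le> 2"
proof -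
  have p1: "p > 1" by (rule prime_gt_1_nat[OF p])
  have uniq: "y = y'" if "p ^ x = c + p ^ y" "p ^ x' = c + p ^ y'" for x y x' y'
  proof -
    have aux: "\<not> v < v'" if "p ^ u = c + p ^ v" "p ^ u' = c + p ^ v'" for u v u' v'
    proof
      assume "v < v'"
      have "p ^ v < p ^ u" "p ^ v' < p ^ u'" using that c by simp_all
      then have "v < u" "v' < u'" using p1 by simp_all
      then have d: "p ^ (v + 1) dvd p ^ u" "p ^ (v + 1) dvd p ^ u'" "p ^ (v + 1) dvd p ^ v'"
        using \<open>v < v'\<close> by (intro le_imp_power_dvd; simp)+
      then have "p ^ (v + 1) dvd c" using that(2) by (simp add: dvd_add_left_iff)
      then have "p ^ (v + 1) dvd p ^ v" using d(1) that(1) by (simp only: dvd_add_right_iff)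
      then show False using p1 power_dvd_imp_le[of p "v + 1" v] by simp
    qed
    show ?thesis using aux[OF that] aux[OF that(2,1)] by simp
  qed
  show ?thesis
  proof (rule card_solutions_le_2[OF p1 p1 c])
  qed (use uniq in blast)+
qed

lemma solutions_swap: "solutions q p c = prod.swap ` solutions p q c"
  by (auto simp: solutions_def image_iff abs_minus_commute)

lemma not_card_le_2_if_three:
  assumes "a \<in> S" "b \<in> S" "d \<in> S" "a \<noteq> b" "a \<noteq> d" "b \<noteq> d"
  shows "\<not> (finite S \<and> card S \<le> 2)"
proof
  assume f: "finite S \<and> card S \<le> 2"
  have "card {a, b, d} \<le> card S" using assms f by (intro card_mono) auto
  then show False using f assms by simp
qed

text \<open>For a Fermat prime \<open>2 ^ m + 1\<close> the three solutions are \<open>2 ^ m - 1\<close>,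
\<open>(2 ^ m + 1) - 2\<close> and \<open>2 ^ (m + 1) - (2 ^ m + 1)\<close>.\<close>

lemma exceptional_triple_not_card_le_2:
  assumes "(p, q, c) \<in> exceptional_triples"
  shows "\<not> (finite (solutions p q c) \<and> card (solutions p q c) \<le> 2)"
proof -
  from assms consider "(p, q, c) = (3, 5, 2)" | "(p, q, c) = (2, 3, 5)" | "(p, q, c) = (2, 3, 7)"
    | "(p, q, c) = (2, 11, 7)" | "p = 2" "fermat_prime q" "c = q - 2"
    by (auto simp: exceptional_triples_def)
  then show ?thesis
  proof cases
    case 1
    then show ?thesis by (intro not_card_le_2_if_three[of "(1, 0)" _ "(1, 1)" "(3, 2)"]) (auto simp: solutions_def)
  next
    case 2
    then show ?thesis by (intro not_card_le_2_if_three[of "(3, 1)" _ "(5, 3)" "(2, 2)"]) (auto simp: solutions_def)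
  next
    case 3
    then show ?thesis by (intro not_card_le_2_if_three[of "(3, 0)" _ "(4, 2)" "(1, 2)"]) (auto simp: solutions_def)
  next
    case 4
    then show ?thesis by (intro not_card_le_2_if_three[of "(3, 0)" _ "(7, 2)" "(2, 1)"]) (auto simp: solutions_def)
  next
    case 5
    then obtain k :: nat where k: "q = 2 ^ (2 ^ k) + 1" by (auto simp: fermat_prime_def)
    define m where "m = (2::nat) ^ k"
    have m: "m > 0" by (simp add: m_def)
    have q: "int q = 2 ^ m + 1" by (simp add: k m_def)
    have "(2::nat) ^ 1 \<le> 2 ^ m" using m by (intro power_increasing) auto
    then have "(2::nat) \<le> 2 ^ m" by simp
    then have c: "int c = 2 ^ m - 1" using 5 k by (simp add: m_def of_nat_diff)
    have "(2::int) ^ 1 \<le> 2 ^ m" using m by (intro power_increasing) auto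
    then have m2: "(2::int) \<le> 2 ^ m" by simp
    show ?thesis
      by (rule not_card_le_2_if_three[of "(m, 0)" _ "(1, 1)" "(m + 1, 1)"])
        (use c q m m2 5 in \<open>simp_all add: solutions_def\<close>)
  qed
qed

theorem theorem2:
  fixes p q c :: nat
  assumes "prime p" and "prime q" and "c > 0"
  shows "(finite (solutions p q c) \<and> card (solutions p q c) \<le> 2) \<longleftrightarrow>
    \<not> ((p, q, c) \<in> exceptional_triples \<or> (q, p, c) \<in> exceptional_triples)"
proof -
  have swap: "finite (solutions q p c) \<and> card (solutions q p c) \<le> 2 \<longleftrightarrow>
      finite (solutions p q c) \<and> card (solutions p q c) \<le> 2"
    unfolding solutions_swap[of q p] by (simp add: card_image finite_image_iff)
  show ?thesis
  proof
    assume "finite (solutions p q c) \<and> card (solutions p q c) \<le> 2"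
    then show "\<not> ((p, q, c) \<in> exceptional_triples \<or> (q, p, c) \<in> exceptional_triples)"
      using exceptional_triple_not_card_le_2[of p q c] exceptional_triple_not_card_le_2[of q p c] swap by blast
  next
    assume ex: "\<not> ((p, q, c) \<in> exceptional_triples \<or> (q, p, c) \<in> exceptional_triples)"
    have odd: "odd r" if "prime r" "r \<noteq> 2" for r :: nat
      using that primes_dvd_imp_eq[of 2 r] by auto
    consider "p = q" | "p = 2" "q \<noteq> 2" | "p \<noteq> 2" "q = 2" | "p \<noteq> q" "p \<noteq> 2" "q \<noteq> 2" by blast
    then show "finite (solutions p q c) \<and> card (solutions p q c) \<le> 2"
    proof cases
      case 1
      then show ?thesis using equal_primes_case assms by simp
    next
      case 2
      then show ?thesis using prime_two_case[of q c] assms odd ex by simp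
    next
      case 3
      then show ?thesis using prime_two_case[of p c] assms odd ex swap by simp
    next
      case 4
      then show ?thesis using odd_primes_case[of p q c] assms odd ex
        by (auto simp: exceptional_triples_def)
    qed
  qed
qed

end
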